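(* Let $H$ be normalised (with $q\ge 2$ the smallest period). Then at least one gap of $H$ is open, and $$\sum_{n=1}^{q-1}|g_n|>\pi\frac{\ln(c/2A)}{h_+}>\pi\frac{\ln(c/2A)}{\ln(2c/A)},$$ $$\sum_{n=1}^{q-1}\int_{g_n}\cos^2x\,dx>\frac{\pi}{h_+}\Big(\frac{\ln(c/2A)}{2}+\frac14-\frac{1}{2qc^2}\mathrm{Tr}\,L^2\Big),$$ $$\frac{\ln(c/2A)}{\max\{1,qh_+/\pi\}}<\sum_{n=1}^{q-1}|g_n|^2<8\ln(c/2A),$$ where $h_+$ satisfies $0<h_+<\ln\!\big(\tfrac cA+\big|\tfrac{1}{Aq}\sum_{j=1}^q b_j\big|\big)<\ln\tfrac{2c}{A}$.
   Context: Let $q\ge 2$ be an integer and let $(a_n)_{n\in\mathbb Z}$, $(b_n)_{n\in\mathbb Z}$ be real sequences with $a_n>0$, $a_{n+q}=a_n$, $b_{n+q}=b_n$ for all $n$, where $q$ is the smallest common period (there is no $1\le p<q$ with $a_{n+p}=a_n$ and $b_{n+p}=b_n$ for all $n$). $H$ is the bounded self-adjoint operator on $\ell^2(\mathbb Z)$ given by $(H\psi)_n=a_{n-1}\psi_{n-1}+b_n\psi_n+a_n\psi_{n+1}$. Set $A=(a_1a_2\cdots a_q)^{1/q}$. For $\lambda\in\mathbb C$ let $\phi(\lambda),\theta(\lambda)$ be the solutions of $a_{n-1}\psi_{n-1}+b_n\psi_n+a_n\psi_{n+1}=\lambda\psi_n$ ($n\in\mathbb Z$) with $\phi_0=0,\phi_1=1$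 and $\theta_0=1,\theta_1=0$; the discriminant is the degree-$q$ polynomial $D(\lambda)=\phi_{q+1}(\lambda)+\theta_q(\lambda)$. The spectrum of $H$ is $\{\lambda\in\mathbb R:|D(\lambda)|\le 2\}$, a union of the $q$ bands $[\lambda^+_{m-1},\lambda^-_m]$, $m=1,\dots,q$, with $\lambda^+_0<\lambda^-_1\le\lambda^+_1<\lambda^-_2\le\dots\le\lambda^+_{q-1}<\lambda^-_q$, separated by the gaps $\gamma_m=(\lambda^-_m,\lambda^+_m)$, $m=1,\dots,q-1$ (a gap is open if $\lambda^-_m<\lambda^+_m$). Let $c=(\lambda^-_q-\lambda^+_0)/2$ be half the width of the spectrum. $H$ is called normalised if $\lambda^+_0=-\lambda^-_q$ (so the spectrum lies in $[-c,c]$ with endpoints $\pm c$). The $q\times q$ matrix $L$ is defined by $L=\begin{pmatrix} b_1 & a_1+ia_2\\ a_1-ia_2 & b_2\end{pmatrix}$ if $q=2$, and for $q\ge 3$ by $L_{jj}=b_j$ ($1\le j\le q$), $L_{j,j+1}=L_{j+1,j}=a_j$ ($1\le j\le q-1$), $L_{1q}=ia_q$, $L_{q1}=-ia_q$, and all other entries $0$. Let $\operatorname{Arccos}:[-1,1]\to[0,\pi]$ denote the principal arccosine. For $n=1,\dots,q-1$ let $g_n=(\operatorname{Arccos}(-\lambda^-_n/c),\operatorname{Arccos}(-\lambda^+_n/c))=\{x\in[0,\pi]:-c\cos x\in\gamma_n\}$, an interval of length $|g_n|=\operatorname{Arccos}(\lambda^-_n/c)-\operatorname{Arccos}(\lambda^+_n/c)$.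 Finally $h_+=\max_{\lambda\in\cup_n\gamma_n}\frac1q\operatorname{arccosh}\big(|D(\lambda)|/2\big)$, where $\operatorname{arccosh}t=\ln(t+\sqrt{t^2-1})$ for $t\ge1$. *)

theory Defs
  imports "HOL-Analysis.Analysis" "HOL-Computational_Algebra.Polynomial" "HOL-Library.Multiset"
begin

text \<open>Solutions of the Jacobi recurrence
  a(n-1) psi(n-1) + b(n) psi(n) + a(n) psi(n+1) = lambda psi(n),
  as real polynomials in lambda, for indices n >= 0, with psi_0 = p0, psi_1 = p1.\<close>
fun jsol :: "(int \<Rightarrow> real) \<Rightarrow> (int \<Rightarrow> real) \<Rightarrow> real poly \<Rightarrow> real poly \<Rightarrow> nat \<Rightarrow> real poly" where
  "jsol a b p0 p1 0 = p0"
| "jsol a b p0 p1 (Suc 0) = p1"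
| "jsol a b p0 p1 (Suc (Suc n)) =
     smult (1 / a (int n + 1)) ([:- b (int n + 1), 1:] * jsol a b p0 p1 (Suc n))
     - smult (a (int n) / a (int n + 1)) (jsol a b p0 p1 n)"

definition phi_sol :: "(int \<Rightarrow> real) \<Rightarrow> (int \<Rightarrow> real) \<Rightarrow> nat \<Rightarrow> real poly" where
  "phi_sol a b = jsol a b 0 1"

definition theta_sol :: "(int \<Rightarrow> real) \<Rightarrow> (int \<Rightarrow> real) \<Rightarrow> nat \<Rightarrow> real poly" where
  "theta_sol a b = jsol a b 1 0"

definition discr :: "(int \<Rightarrow> real) \<Rightarrow> (int \<Rightarrow> real) \<Rightarrow> nat \<Rightarrow> real poly" where
  "discr a b q = phi_sol a b (q + 1) + theta_sol a b q"

text \<open>Band edges: the 2q roots of D^2 - 4, counted with multiplicity, in increasing order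
  (list index 0 .. 2q-1): lambda^+_0, lambda^-_1, lambda^+_1, ..., lambda^-_q.\<close>
definition band_edges :: "(int \<Rightarrow> real) \<Rightarrow> (int \<Rightarrow> real) \<Rightarrow> nat \<Rightarrow> real list" where
  "band_edges a b q = (THE e. sorted e \<and>
      (\<forall>x. count (mset e) x = order x (discr a b q ^ 2 - [:4:])))"

definition lam_minus :: "(int \<Rightarrow> real) \<Rightarrow> (int \<Rightarrow> real) \<Rightarrow> nat \<Rightarrow> nat \<Rightarrow> real" where
  "lam_minus a b q m = band_edges a b q ! (2 * m - 1)"

definition lam_plus :: "(int \<Rightarrow> real) \<Rightarrow> (int \<Rightarrow> real) \<Rightarrow> nat \<Rightarrow> nat \<Rightarrow> real" where
  "lam_plus a b q m = band_edges a b q ! (2 * m)"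

definition gap :: "(int \<Rightarrow> real) \<Rightarrow> (int \<Rightarrow> real) \<Rightarrow> nat \<Rightarrow> nat \<Rightarrow> real set" where
  "gap a b q m = {lam_minus a b q m <..< lam_plus a b q m}"

definition half_width :: "(int \<Rightarrow> real) \<Rightarrow> (int \<Rightarrow> real) \<Rightarrow> nat \<Rightarrow> real" where
  "half_width a b q = (lam_minus a b q q - lam_plus a b q 0) / 2"

definition normalised :: "(int \<Rightarrow> real) \<Rightarrow> (int \<Rightarrow> real) \<Rightarrow> nat \<Rightarrow> bool" where
  "normalised a b q \<longleftrightarrow> lam_plus a b q 0 = - lam_minus a b q q"

definition geomA :: "(int \<Rightarrow> real) \<Rightarrow> nat \<Rightarrow> real" where
  "geomA a q = root q (\<Prod>j = 1..q. a (int j))"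

definition gset :: "(int \<Rightarrow> real) \<Rightarrow> (int \<Rightarrow> real) \<Rightarrow> nat \<Rightarrow> nat \<Rightarrow> real set" where
  "gset a b q n = {arccos (- lam_minus a b q n / half_width a b q) <..<
                   arccos (- lam_plus a b q n / half_width a b q)}"

definition glen :: "(int \<Rightarrow> real) \<Rightarrow> (int \<Rightarrow> real) \<Rightarrow> nat \<Rightarrow> nat \<Rightarrow> real" where
  "glen a b q n = arccos (lam_minus a b q n / half_width a b q)
                - arccos (lam_plus a b q n / half_width a b q)"

definition h_plus :: "(int \<Rightarrow> real) \<Rightarrow> (int \<Rightarrow> real) \<Rightarrow> nat \<Rightarrow> real" where
  "h_plus a b q = (SUP l \<in> (\<Union>n\<in>{1..q-1}. gap a b q n).
                      arcosh (\<bar>poly (discr a b q) l\<bar> / 2) / real q)"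

definition Lmat :: "(int \<Rightarrow> real) \<Rightarrow> (int \<Rightarrow> real) \<Rightarrow> nat \<Rightarrow> nat \<Rightarrow> nat \<Rightarrow> complex" where
  "Lmat a b q j k =
     (if q = 2 then
        (if j = 1 \<and> k = 1 then complex_of_real (b 1)
         else if j = 1 \<and> k = 2 then complex_of_real (a 1) + \<i> * complex_of_real (a 2)
         else if j = 2 \<and> k = 1 then complex_of_real (a 1) - \<i> * complex_of_real (a 2)
         else if j = 2 \<and> k = 2 then complex_of_real (b 2)
         else 0)
      else
        (if j = k then complex_of_real (b (int j))
         else if k = j + 1 then complex_of_real (a (int j))
         else if j = k + 1 then complex_of_real (a (int k))
         else if j = 1 \<and> k = q then \<i> * complex_of_real (a (int q))
         else if j = q \<and> k = 1 then - \<i> * complex_of_real (a (int q))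
         else 0))"

definition trace_L2 :: "(int \<Rightarrow> real) \<Rightarrow> (int \<Rightarrow> real) \<Rightarrow> nat \<Rightarrow> complex" where
  "trace_L2 a b q = (\<Sum>j = 1..q. \<Sum>k = 1..q. Lmat a b q j k * Lmat a b q k j)"

end

theory Submission
  imports Defs "HOL-Computational_Algebra.Fundamental_Theorem_Algebra" "HOL-Complex_Analysis.Complex_Analysis"
begin

text \<open>Put \<open>\<lambda> = - c cos z\<close> and \<open>v z = arcosh ((\<bar>D + 2\<bar> + \<bar>D - 2\<bar>) / 4) / q\<close>. Then \<open>v - Im z\<close> is,
  in the coordinate \<open>\<zeta> = exp (\<i> z)\<close>, the real part of a function holomorphic in the unit disc with
  value \<open>ln (c / 2A)\<close> at \<open>0\<close>, while on the real line \<open>v\<close> vanishes outside the gaps. The mean value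
  and the second Taylor coefficient evaluate the integrals of \<open>v\<close> and of \<open>v cos 2x\<close> over the gaps;
  since \<open>0 < v \<le> h\<^sub>+\<close> there, this gives the first two lower bounds. The same identities show that
  without open gaps the coefficients would be constant, by equality in the AM-GM inequality.
  On a gap \<open>v\<close> dominates the semicircle over it (maximum principle), which bounds \<open>\<Sum> \<bar>g\<^sub>n\<bar>\<^sup>2\<close>
  from above. For the remaining bound, \<open>v\<close> is the imaginary part of a conformal map \<open>k\<close> of the
  half plane onto a comb domain whose slits have foot points \<open>\<pi> n / q\<close>. The Dirichlet integral of
  \<open>k - z\<close> over a half strip is at most \<open>\<pi> ln (c / 2A)\<close>, and a length-area estimate on two triangles
  beside each slit bounds it from below by the slit heights.\<close>

section \<open>Real polynomials at complex arguments\<close>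

text \<open>The operator enters through one fact: D takes values in [-2, 2] only at real points.
  This splits the levels over the reals, puts one zero into each band, keeps D(- c cos z) off
  [-2, 2] in the upper half plane and makes \<open>v\<close> increase with height. The argument of
  arcosh in \<open>v\<close> is cosh (ln |x|) for the outer root x of x + 1/x = D. So
  \<open>v\<close> is continuous everywhere although x jumps when D crosses [-2, 2]: boundary
  estimates are made for \<open>v\<close>, holomorphy is used only inside. No boundary
  correspondence for conformal maps is invoked. Monotonicity of \<open>v\<close> in Im z gives Re k'
  > 0, hence injectivity of k, and the triangles beside the slits are truncated to compact pieces at
  the price of a small factor. Constants: 8 stems from the area pi l^2 / 8 of a half disc of
  diameter l. The lower bound for the squares has constant 1 because the truncated triangles still
  yield a third of min(pi/q, H) H for a slit of height H, and 3 < pi.\<close>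

definition cpoly :: "real poly \<Rightarrow> complex \<Rightarrow> complex" where
  "cpoly p = poly (map_poly complex_of_real p)"

lemma cpoly_pCons [simp]: "cpoly (pCons a p) z = of_real a + z * cpoly p z"
  by (simp add: cpoly_def map_poly_pCons)

lemma cpoly_0 [simp]: "cpoly 0 z = 0"
  by (simp add: cpoly_def)

lemma cpoly_1 [simp]: "cpoly 1 z = 1"
  by (simp add: cpoly_def)

lemma cpoly_add [simp]: "cpoly (p + q) z = cpoly p z + cpoly q z"
proof -
  have "map_poly complex_of_real (p + q) = map_poly of_real p + map_poly of_real q"
    by (rule poly_eqI) (simp add: coeff_map_poly)
  then show ?thesis by (simp add: cpoly_def)
qed

lemma cpoly_smult [simp]: "cpoly (smult c p) z = of_real c * cpoly p z"
proof -
  have "map_poly complex_of_real (smult c p) = smult (of_real c) (map_poly of_real p)"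
    by (rule poly_eqI) (simp add: coeff_map_poly)
  then show ?thesis by (simp add: cpoly_def)
qed

lemma cpoly_diff [simp]: "cpoly (p - q) z = cpoly p z - cpoly q z"
  using cpoly_add[of "p - q" q z] by (simp add: algebra_simps)

lemma cpoly_mult [simp]: "cpoly (p * q) z = cpoly p z * cpoly q z"
  by (induction p) (simp_all add: algebra_simps)

lemma cpoly_of_real [simp]: "cpoly p (of_real x) = of_real (poly p x)"
  by (induction p) simp_all

lemma cpoly_root_exists:
  assumes "degree p > 0"
  shows "\<exists>z. cpoly p z = 0"
proof -
  have "degree (map_poly complex_of_real p) = degree p"
    by (simp add: degree_map_poly)
  then show ?thesis
    using assms Fundamental_Theorem_Algebra.fundamental_theorem_of_algebra[of "map_poly complex_of_real p"]
      constant_degree[of "map_poly complex_of_real p"]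
    by (auto simp: cpoly_def)
qed

text \<open>Every root found over the complex numbers is real by hypothesis, so its linear factor
  can be divided out within the real polynomials. A multiset keeps multiplicities, since the levels
  2 and -2 have double roots at closed gaps.\<close>

lemma real_rooted_splits:
  fixes p :: "real poly"
  assumes "p \<noteq> 0" and "\<And>z. cpoly p z = 0 \<Longrightarrow> z \<in> \<real>"
  shows "\<exists>M. p = smult (lead_coeff p) (\<Prod>x\<in>#M. [:- x, 1:]) \<and> size M = degree p"
  using assms
proof (induction "degree p" arbitrary: p)
  case 0
  then obtain c where "p = [:c:]" by (metis degree_eq_zeroE)
  then show ?case by (intro exI[of _ "{#}"]) (simp add: one_pCons)
next
  case (Suc n)
  then obtain z where z: "cpoly p z = 0" using cpoly_root_exists by (metis zero_less_Suc)
  then obtain r where r: "z = of_real r" using Suc.prems(2) by (auto elim: Reals_cases)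
  then have "poly p r = 0" using z by simp
  then obtain g where g: "p = [:- r, 1:] * g" using poly_eq_0_iff_dvd[of p r] by (auto elim: dvdE)
  have g0: "g \<noteq> 0" using g Suc.prems(1) by auto
  have "degree p = Suc (degree g)" using g g0 by (simp add: degree_mult_eq del: mult_pCons_left)
  then have dg: "n = degree g" using Suc.hyps(2) by simp
  have "\<exists>M. g = smult (lead_coeff g) (\<Prod>x\<in>#M. [:- x, 1:]) \<and> size M = degree g"
    by (rule Suc.hyps(1)[OF dg g0]) (use Suc.prems(2) g in auto)
  then obtain M where M: "g = smult (lead_coeff g) (\<Prod>x\<in>#M. [:- x, 1:])" "size M = degree g" by blast
  have "lead_coeff p = lead_coeff g" unfolding g lead_coeff_mult by simp
  moreover have "p = smult (lead_coeff g) (\<Prod>x\<in>#add_mset r M. [:- x, 1:])"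
  proof -
    have "p = [:- r, 1:] * smult (lead_coeff g) (\<Prod>x\<in>#M. [:- x, 1:])"
      by (subst M(1)[symmetric]) (rule g)
    then show ?thesis by (simp only: mult_smult_right image_mset_add_mset prod_mset.add_mset)
  qed
  ultimately have "p = smult (lead_coeff p) (\<Prod>x\<in>#add_mset r M. [:- x, 1:])"
    by (simp only:)
  moreover have "size (add_mset r M) = degree p" using M(2) dg Suc.hyps(2) by simp
  ultimately show ?case by blast
qed

lemma proots_of_splitting:
  fixes c :: real
  assumes "c \<noteq> 0"
  shows "proots (smult c (\<Prod>x\<in>#M. [:- x, 1:])) = M"
proof -
  have "proots (\<Prod>x\<in>#M. [:- x, 1:]) = M"
  proof (induction M)
    case (add x M)
    have "(\<Prod>x\<in>#M. [:- x, 1:]) \<noteq> 0" for M :: "real multiset"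
      by (auto simp: prod_mset_zero_iff)
    then show ?case using add by (simp add: proots_mult del: mult_pCons_left)
  qed simp
  then show ?thesis using assms by simp
qed

text \<open>With \<open>p = (x - r) g\<close> one has
  \<open>p'\<^sup>2 - p p'' = g\<^sup>2 + (x - r)\<^sup>2 (g'\<^sup>2 - g g'')\<close>.\<close>
lemma laguerre_inequality:
  fixes M :: "real multiset" and c x :: real
  defines "p \<equiv> smult c (\<Prod>r\<in>#M. [:- r, 1:])"
  shows "poly (pderiv p) x ^ 2 - poly p x * poly (pderiv (pderiv p)) x \<ge> 0"
    and "M \<noteq> {#} \<Longrightarrow> poly p x \<noteq> 0 \<Longrightarrow>
      poly (pderiv p) x ^ 2 - poly p x * poly (pderiv (pderiv p)) x > 0"
proof -
  define W where "W g = poly (pderiv g) x ^ 2 - poly g x * poly (pderiv (pderiv g)) x" for g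
  define g where "g M = smult c (\<Prod>r\<in>#M. [:- r, 1:])" for M
  have step: "W (g (add_mset r M)) = poly (g M) x ^ 2 + (x - r)\<^sup>2 * W (g M)" for r M
  proof -
    have gr: "g (add_mset r M) = [:- r, 1:] * g M" by (simp add: g_def del: mult_pCons_left)
    show ?thesis unfolding W_def gr
      by (simp add: pderiv_mult pderiv_pCons pderiv_add del: mult_pCons_left)
         (simp add: power2_eq_square algebra_simps)
  qed
  have nn: "W (g M) \<ge> 0" for M
    by (induction M) (auto simp: step, simp add: W_def g_def pderiv_smult)
  then show "poly (pderiv p) x ^ 2 - poly p x * poly (pderiv (pderiv p)) x \<ge> 0"
    by (simp add: p_def W_def g_def)
  assume "M \<noteq> {#}" "poly p x \<noteq> 0"
  then obtain r M' where M: "M = add_mset r M'" by (metis multiset_cases)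
  have "poly (g M) x \<noteq> 0" using \<open>poly p x \<noteq> 0\<close> by (simp add: p_def g_def)
  then have "poly (g M') x \<noteq> 0" by (auto simp: M g_def)
  then have "W (g M) > 0" using nn[of M'] unfolding M step
    by (meson add_pos_nonneg mult_nonneg_nonneg zero_le_power2 zero_less_power2)
  then show "poly (pderiv p) x ^ 2 - poly p x * poly (pderiv (pderiv p)) x > 0"
    by (simp add: p_def W_def g_def)
qed

section \<open>Jacobi recurrences\<close>

lemma jsol_rec:
  assumes "a (int n + 1) \<noteq> 0"
  shows "smult (a (int n + 1)) (jsol a b p0 p1 (Suc (Suc n))) =
    [:- b (int n + 1), 1:] * jsol a b p0 p1 (Suc n) - smult (a (int n)) (jsol a b p0 p1 n)"
  using assms by (simp add: smult_diff_right smult_add_right)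

text \<open>The discrete Wronskian of two solutions is constant. Over one period, where the
  coefficient returns to \<open>a 0\<close>, this says that the monodromy matrix has determinant
  1.\<close>

lemma jsol_wronskian:
  assumes "\<forall>n. a n > 0"
  shows "of_real (a (int n)) * (cpoly (phi_sol a b (Suc n)) l * cpoly (theta_sol a b n) l
      - cpoly (phi_sol a b n) l * cpoly (theta_sol a b (Suc n)) l) = of_real (a 0)"
proof (induction n)
  case 0
  then show ?case by (simp add: phi_sol_def theta_sol_def)
next
  case (Suc n)
  have a0: "a (int n + 1) \<noteq> 0" using assms by (metis less_irrefl)
  have R: "of_real (a (int n + 1)) * cpoly (jsol a b p0 p1 (Suc (Suc n))) l =
     (l - of_real (b (int n + 1))) * cpoly (jsol a b p0 p1 (Suc n)) l
     - of_real (a (int n)) * cpoly (jsol a b p0 p1 n) l" for p0 p1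
    using arg_cong[OF jsol_rec[where a=a and n=n and b=b and ?p0.0=p0 and ?p1.0=p1, OF a0], of "\<lambda>p. cpoly p l"]
    by (simp del: jsol.simps mult_pCons_left)
  have "of_real (a (int (Suc n))) * (cpoly (phi_sol a b (Suc (Suc n))) l * cpoly (theta_sol a b (Suc n)) l
      - cpoly (phi_sol a b (Suc n)) l * cpoly (theta_sol a b (Suc (Suc n))) l)
     = (of_real (a (int n + 1)) * cpoly (phi_sol a b (Suc (Suc n))) l) * cpoly (theta_sol a b (Suc n)) l
      - cpoly (phi_sol a b (Suc n)) l * (of_real (a (int n + 1)) * cpoly (theta_sol a b (Suc (Suc n))) l)"
    by (simp add: algebra_simps)
  also have "\<dots> = of_real (a (int n)) * (cpoly (phi_sol a b (Suc n)) l * cpoly (theta_sol a b n) l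
      - cpoly (phi_sol a b n) l * cpoly (theta_sol a b (Suc n)) l)"
    unfolding phi_sol_def theta_sol_def R by (simp add: algebra_simps)
  finally show ?case using Suc by simp
qed

text \<open>Symmetry of the operator over one period: after pairing with
  \<open>cnj (\<psi> (Suc n))\<close> the two off-diagonal sums are conjugate to each other, because
  a multiplier of modulus 1 makes the boundary terms agree. Hence \<open>l\<close> times a positive
  sum of squares is real.\<close>

lemma bloch_energy_real:
  fixes \<psi> :: "nat \<Rightarrow> complex"
  assumes q: "q \<ge> 1"
    and rec: "\<And>n. of_real (a (int n)) * \<psi> n + of_real (b (int n + 1)) * \<psi> (Suc n)
        + of_real (a (int n + 1)) * \<psi> (Suc (Suc n)) = l * \<psi> (Suc n)"
    and per: "\<psi> q = \<mu> * \<psi> 0" "\<psi> (Suc q) = \<mu> * \<psi> 1" "cmod \<mu> = 1" "a (int q) = a 0"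
    and nontriv: "\<psi> 0 \<noteq> 0 \<or> \<psi> 1 \<noteq> 0"
  shows "l \<in> \<real>"
proof -
  define w where "w n = of_real (a (int n)) * \<psi> (Suc n) * cnj (\<psi> n)" for n
  define N where "N = (\<Sum>n<q. (cmod (\<psi> (Suc n)))\<^sup>2)"
  have mu: "\<mu> * cnj \<mu> = 1" using per(3) by (simp add: complex_norm_square[symmetric])
  have "w q = w 0" unfolding w_def using per mu
    by (simp add: algebra_simps)
  then have ww: "(\<Sum>n<q. w (Suc n)) = (\<Sum>n<q. w n)"
    using sum.lessThan_Suc_shift[of w q] by simp
  have "l * of_real N = (\<Sum>n<q. (l * \<psi> (Suc n)) * cnj (\<psi> (Suc n)))"
    by (simp add: N_def sum_distrib_left complex_norm_square mult.assoc del: of_real_power)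
  also have "\<dots> = (\<Sum>n<q. cnj (w n) + of_real (b (int n + 1) * (cmod (\<psi> (Suc n)))\<^sup>2) + w (Suc n))"
    unfolding rec[symmetric]
    by (intro sum.cong refl) (simp add: w_def algebra_simps complex_norm_square del: of_real_power)
  also have "\<dots> = cnj (\<Sum>n<q. w n) + (\<Sum>n<q. w n) + of_real (\<Sum>n<q. b (int n + 1) * (cmod (\<psi> (Suc n)))\<^sup>2)"
    by (simp add: sum.distrib ww)
  finally have "Im (l * of_real N) = 0" by (simp del: cnj_sum)
  then have "Im l * N = 0" by simp
  \<comment> \<open>If \<open>N\<close> vanished, \<psi> would be zero at 1 and at q; the multiplier
    carries the second zero back to index 0, which leaves only the trivial solution.\<close>
  moreover have "N \<noteq> 0"
  proof
    assume "N = 0"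
    then have z: "\<psi> (Suc n) = 0" if "n < q" for n
      using that by (simp add: N_def sum_nonneg_eq_0_iff)
    have "\<psi> 1 = 0" "\<psi> q = 0" using z[of 0] z[of "q - 1"] q by auto
    then show False using nontriv per mu by auto
  qed
  ultimately show ?thesis by (simp add: complex_is_Real_iff)
qed

text \<open>The monodromy matrix has determinant 1 and real trace t with |t| <= 2, so its
  eigenvalues lie on the unit circle. An eigenvector gives the initial values of a Bloch solution,
  to which \<open>bloch_energy_real\<close> applies.\<close>

lemma discr_band_real:
  assumes q: "q \<ge> 1" and apos: "\<forall>n. a n > 0" and aper: "a (int q) = a 0"
    and D: "cpoly (discr a b q) l = of_real t" "\<bar>t\<bar> \<le> 2"
  shows "l \<in> \<real>"
proof -
  \<comment> \<open>The root of x^2 - t x + 1 in the closed upper half plane; |t| <= 2 puts it on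
    the unit circle.\<close>
  define \<mu> where "\<mu> = Complex (t / 2) (sqrt (1 - (t / 2)\<^sup>2))"
  have t1: "(t / 2)\<^sup>2 \<le> 1" using D(2) by (simp add: abs_square_le_1)
  have mu1: "cmod \<mu> = 1" by (simp add: \<mu>_def cmod_def t1)
  have mu2: "\<mu>\<^sup>2 - of_real t * \<mu> + 1 = 0"
    using t1 by (simp add: \<mu>_def complex_eq_iff power2_eq_square algebra_simps)
  define \<phi> \<theta> where "\<phi> n = cpoly (phi_sol a b n) l" and "\<theta> n = cpoly (theta_sol a b n) l" for n
  have "a 0 \<noteq> 0" using apos by (metis less_irrefl)
  then have W: "\<phi> (Suc q) * \<theta> q - \<phi> q * \<theta> (Suc q) = 1"
    using jsol_wronskian[OF apos, of q b l] aper by (simp add: \<phi>_def \<theta>_def)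
  have T: "\<phi> (Suc q) + \<theta> q = of_real t" using D(1) by (simp add: \<phi>_def \<theta>_def discr_def)
  have det: "(\<theta> q - \<mu>) * (\<phi> (Suc q) - \<mu>) - \<phi> q * \<theta> (Suc q) = 0"
  proof -
    have "(\<theta> q - \<mu>) * (\<phi> (Suc q) - \<mu>) - \<phi> q * \<theta> (Suc q)
      = (\<phi> (Suc q) * \<theta> q - \<phi> q * \<theta> (Suc q)) - (\<phi> (Suc q) + \<theta> q) * \<mu> + \<mu>\<^sup>2"
      by (simp add: algebra_simps power2_eq_square)
    then have "(\<theta> q - \<mu>) * (\<phi> (Suc q) - \<mu>) - \<phi> q * \<theta> (Suc q) = \<mu>\<^sup>2 - of_real t * \<mu> + 1"
      unfolding W T by simp
    then show ?thesis using mu2 by simp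
  qed
  \<comment> \<open>A kernel vector of a singular 2 by 2 matrix, read off from a nonzero row; if
    both rows vanish, any vector will do.\<close>
  obtain x y where xy: "x \<noteq> 0 \<or> y \<noteq> 0" "x * \<phi> q + y * (\<theta> q - \<mu>) = 0"
      "x * (\<phi> (Suc q) - \<mu>) + y * \<theta> (Suc q) = 0"
  proof (cases "\<phi> q = 0 \<and> \<theta> q = \<mu>")
    case False
    show ?thesis
      by (rule that[of "- (\<theta> q - \<mu>)" "\<phi> q"]) (use False det in \<open>auto simp: algebra_simps\<close>)
  next
    case True
    show ?thesis
    proof (cases "\<phi> (Suc q) = \<mu> \<and> \<theta> (Suc q) = 0")
      case False
      then show ?thesis
        by (intro that[of "- \<theta> (Suc q)" "\<phi> (Suc q) - \<mu>"]) (use True det in \<open>auto simp: algebra_simps\<close>)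
    next
      case True2: True
      show ?thesis by (rule that[of 1 0]) (use True True2 in auto)
    qed
  qed
  define \<psi> where "\<psi> n = x * \<phi> n + y * \<theta> n" for n
  have R: "of_real (a (int n)) * cpoly (jsol a b p0 p1 n) l + of_real (b (int n + 1)) * cpoly (jsol a b p0 p1 (Suc n)) l
      + of_real (a (int n + 1)) * cpoly (jsol a b p0 p1 (Suc (Suc n))) l
     = l * cpoly (jsol a b p0 p1 (Suc n)) l" for p0 p1 n
  proof -
    have a0: "a (int n + 1) \<noteq> 0" using apos by (metis less_irrefl)
    from arg_cong[OF jsol_rec[where a=a and n=n and b=b and ?p0.0=p0 and ?p1.0=p1, OF a0], of "\<lambda>p. cpoly p l"]
    show ?thesis by (simp del: jsol.simps mult_pCons_left add: algebra_simps)
  qed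
  show ?thesis
  proof (rule bloch_energy_real[OF q, of a \<psi> b l \<mu>])
    fix n
    show "of_real (a (int n)) * \<psi> n + of_real (b (int n + 1)) * \<psi> (Suc n)
        + of_real (a (int n + 1)) * \<psi> (Suc (Suc n)) = l * \<psi> (Suc n)"
    proof -
      have "of_real (a (int n)) * \<psi> n + of_real (b (int n + 1)) * \<psi> (Suc n)
          + of_real (a (int n + 1)) * \<psi> (Suc (Suc n))
        = x * (of_real (a (int n)) * \<phi> n + of_real (b (int n + 1)) * \<phi> (Suc n) + of_real (a (int n + 1)) * \<phi> (Suc (Suc n)))
        + y * (of_real (a (int n)) * \<theta> n + of_real (b (int n + 1)) * \<theta> (Suc n) + of_real (a (int n + 1)) * \<theta> (Suc (Suc n)))"
        by (simp add: \<psi>_def algebra_simps)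
      also have "\<dots> = l * \<psi> (Suc n)"
        unfolding \<psi>_def \<phi>_def \<theta>_def phi_sol_def theta_sol_def R by (simp add: algebra_simps)
      finally show ?thesis .
    qed
  next
    have z: "\<psi> 0 = y" "\<psi> 1 = x" by (simp_all add: \<psi>_def \<phi>_def \<theta>_def phi_sol_def theta_sol_def)
    show "\<psi> q = \<mu> * \<psi> 0" "\<psi> (Suc q) = \<mu> * \<psi> 1" using xy z by (simp_all add: \<psi>_def algebra_simps)
    show "\<psi> 0 \<noteq> 0 \<or> \<psi> 1 \<noteq> 0" using xy z by auto
  qed (use mu1 aper in auto)
qed

section \<open>The top three coefficients of the discriminant\<close>

lemma coeff_jsol:
  "coeff (jsol a b p0 p1 (Suc (Suc n))) k =
    ((if k = 0 then 0 else coeff (jsol a b p0 p1 (Suc n)) (k - 1))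
      - b (int n + 1) * coeff (jsol a b p0 p1 (Suc n)) k - a (int n) * coeff (jsol a b p0 p1 n) k)
    / a (int n + 1)"
  by (cases k) (simp_all add: diff_divide_distrib add_divide_distrib algebra_simps)

lemma coeff_phi_above: "k > n \<Longrightarrow> coeff (phi_sol a b (Suc n)) k = 0 \<and> coeff (phi_sol a b n) k = 0"
proof (induction n arbitrary: k)
  case 0
  then show ?case by (auto simp: phi_sol_def coeff_1)
next
  case (Suc n)
  then show ?case
    using Suc.IH[of k] Suc.IH[of "k - 1"] unfolding phi_sol_def by (auto simp: coeff_jsol simp del: jsol.simps)
qed

lemma coeff_theta_above:
  "k > n \<Longrightarrow> coeff (theta_sol a b (Suc (Suc n))) k = 0 \<and> coeff (theta_sol a b (Suc n)) k = 0"
proof (induction n arbitrary: k)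
  case 0
  then show ?case unfolding theta_sol_def by (auto simp: coeff_jsol coeff_1 simp del: jsol.simps(3))
next
  case (Suc n)
  then show ?case
    using Suc.IH[of k] Suc.IH[of "k - 1"] unfolding theta_sol_def
    by (auto simp: coeff_jsol[of _ _ _ _ "Suc n"] simp del: jsol.simps)
qed

context
  fixes a b :: "int \<Rightarrow> real" and P :: "nat \<Rightarrow> real"
  assumes apos: "\<forall>n. a n > 0"
  defines "P \<equiv> \<lambda>n. \<Prod>j = 1..n. a (int j)"
begin

lemma prod_a_Suc: "P (Suc n) = P n * a (int n + 1)"
  by (simp add: P_def add.commute)

lemma a_nonzero: "a n \<noteq> 0"
  using apos by (metis less_irrefl)

lemma coeff_phi_0: "coeff (phi_sol a b (Suc n)) n * P n = 1"
proof (induction n)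
  case 0
  then show ?case by (simp add: phi_sol_def P_def)
next
  case (Suc n)
  have "coeff (phi_sol a b (Suc n)) (Suc n) = 0" "coeff (phi_sol a b n) (Suc n) = 0"
    using coeff_phi_above[of n "Suc n"] by auto
  then show ?case using Suc a_nonzero[of "int n + 1"] unfolding phi_sol_def
    by (simp add: coeff_jsol prod_a_Suc field_simps del: jsol.simps)
qed

lemma coeff_phi_1: "coeff (phi_sol a b (Suc (Suc n))) n * P (Suc n) = - (\<Sum>j = 1..Suc n. b (int j))"
proof (induction n)
  case 0
  then show ?case using a_nonzero[of 1] by (simp add: phi_sol_def P_def)
next
  case (Suc n)
  have 1: "coeff (phi_sol a b (Suc n)) (Suc n) = 0"
    using coeff_phi_above[of n "Suc n"] by auto
  have "coeff (phi_sol a b (Suc (Suc (Suc n)))) (Suc n) * P (Suc (Suc n))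
    = coeff (phi_sol a b (Suc (Suc n))) n * P (Suc n)
      - b (int (Suc n) + 1) * (coeff (phi_sol a b (Suc (Suc n))) (Suc n) * P (Suc n))"
    using 1 a_nonzero[of "int (Suc n) + 1"] unfolding phi_sol_def
    by (simp add: coeff_jsol[of _ _ _ _ "Suc n"] prod_a_Suc[of "Suc n"] field_simps del: jsol.simps)
  also have "\<dots> = - (\<Sum>j = 1..Suc n. b (int j)) - b (int (Suc n) + 1)"
    unfolding Suc coeff_phi_0 by simp
  finally show ?case by (simp add: add.commute)
qed

text \<open>Multiplied by \<open>P\<close>, \<open>phi_sol\<close> is the characteristic polynomial
  of a truncated Jacobi matrix; its third coefficient collects the 2 by 2 principal minors, that is
  b_i b_j, less a_j^2 for neighbours. Only links inside the block occur, so the sum of squares stops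
  one index earlier.\<close>

lemma coeff_phi_2: "coeff (phi_sol a b (Suc (Suc (Suc n)))) n * P (Suc (Suc n)) =
   ((\<Sum>j = 1..Suc (Suc n). b (int j))\<^sup>2 - (\<Sum>j = 1..Suc (Suc n). (b (int j))\<^sup>2)) / 2
    - (\<Sum>j = 1..Suc n. (a (int j))\<^sup>2)"
proof (induction n)
  case 0
  show ?case using a_nonzero[of 1] a_nonzero[of 2]
    by (simp add: phi_sol_def P_def numeral_2_eq_2 power2_eq_square field_simps)
next
  case (Suc n)
  let ?m = "Suc (Suc n)"
  have "coeff (phi_sol a b (Suc (Suc ?m))) (Suc n) * P (Suc ?m)
    = coeff (phi_sol a b (Suc ?m)) n * P ?m
      - b (int ?m + 1) * (coeff (phi_sol a b (Suc ?m)) (Suc n) * P ?m)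
      - a (int ?m) * (coeff (phi_sol a b ?m) (Suc n) * P (Suc n)) * a (int (Suc n) + 1)"
    using a_nonzero[of "int ?m + 1"] unfolding phi_sol_def
    by (simp add: coeff_jsol[of _ _ _ _ ?m] prod_a_Suc field_simps del: jsol.simps)
  also have "\<dots> = ((\<Sum>j = 1..?m. b (int j))\<^sup>2 - (\<Sum>j = 1..?m. (b (int j))\<^sup>2)) / 2
    - (\<Sum>j = 1..Suc n. (a (int j))\<^sup>2) + b (int ?m + 1) * (\<Sum>j = 1..?m. b (int j)) - (a (int ?m))\<^sup>2"
    unfolding Suc coeff_phi_1 coeff_phi_0
    by (simp add: power2_eq_square add.commute right_diff_distrib distrib_left)
  also have "\<dots> = ((\<Sum>j = 1..Suc ?m. b (int j))\<^sup>2 - (\<Sum>j = 1..Suc ?m. (b (int j))\<^sup>2)) / 2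
    - (\<Sum>j = 1..?m. (a (int j))\<^sup>2)"
    by (simp add: power2_eq_square field_simps)
  finally show ?case .
qed

lemma coeff_theta_0: "coeff (theta_sol a b (Suc (Suc n))) n * P (Suc n) = - a 0"
proof (induction n)
  case 0
  then show ?case using a_nonzero[of 1] by (simp add: theta_sol_def P_def)
next
  case (Suc n)
  have "coeff (theta_sol a b (Suc (Suc n))) (Suc n) = 0" "coeff (theta_sol a b (Suc n)) (Suc n) = 0"
    using coeff_theta_above[of n "Suc n"] by auto
  then show ?case using Suc a_nonzero[of "int (Suc n) + 1"] unfolding theta_sol_def
    by (simp add: coeff_jsol[of _ _ _ _ "Suc n"] prod_a_Suc[of "Suc n"] field_simps del: jsol.simps)
qed

text \<open>\<open>theta_sol a b q\<close> has degree q - 2 and so enters only the third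
  coefficient, where it contributes the missing square of a_q, the link that closes the period into
  a ring.\<close>

lemma coeff_discr:
  assumes q: "q \<ge> 2" and aq: "a (int q) = a 0"
  shows "degree (discr a b q) = q" "lead_coeff (discr a b q) * P q = 1"
    "coeff (discr a b q) (q - 1) * P q = - (\<Sum>j = 1..q. b (int j))"
    "coeff (discr a b q) (q - 2) * P q = ((\<Sum>j = 1..q. b (int j))\<^sup>2 - (\<Sum>j = 1..q. (b (int j))\<^sup>2)) / 2
       - (\<Sum>j = 1..q. (a (int j))\<^sup>2)"
proof -
  obtain m where m: "q = Suc (Suc m)" using q by (metis add_2_eq_Suc le_Suc_ex)
  let ?D = "discr a b q"
  have D: "coeff ?D k = coeff (phi_sol a b (Suc q)) k + coeff (theta_sol a b q) k" for k
    by (simp add: discr_def)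
  have th: "coeff (theta_sol a b q) k = 0" if "k > m" for k
    using coeff_theta_above[OF that] m by auto
  have c0: "coeff ?D q * P q = 1"
    using coeff_phi_0[of q] th[of q] m unfolding D by simp
  have "degree ?D \<le> q"
    by (rule degree_le) (unfold D, use coeff_phi_above[of q] th m in auto)
  moreover have "degree ?D \<ge> q" by (rule le_degree) (use c0 in auto)
  ultimately show deg: "degree ?D = q" by simp
  show "lead_coeff ?D * P q = 1" using c0 deg by simp
  show "coeff ?D (q - 1) * P q = - (\<Sum>j = 1..q. b (int j))"
    using coeff_phi_1[of "Suc m"] th[of "Suc m"] m unfolding D by simp
  have "coeff (theta_sol a b q) m * P q = - (a (int q))\<^sup>2"
    using coeff_theta_0[of m] aq by (simp add: m prod_a_Suc[of "Suc m"] power2_eq_square add.commute flip: mult.assoc)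
  then show "coeff ?D (q - 2) * P q = ((\<Sum>j = 1..q. b (int j))\<^sup>2 - (\<Sum>j = 1..q. (b (int j))\<^sup>2)) / 2
       - (\<Sum>j = 1..q. (a (int j))\<^sup>2)"
    using coeff_phi_2[of m] m unfolding D by (simp add: distrib_right)
qed

end

text \<open>Vieta's formulas, with the second elementary symmetric function in terms of power sums.
  Compared with \<open>coeff_discr\<close> they express the sum and the sum of squares of the zeros
  of D through the coefficients of the operator.\<close>

lemma coeff_prod_linear:
  fixes \<mu> :: "nat \<Rightarrow> real"
  defines "p \<equiv> \<lambda>n. \<Prod>i<n. [:- \<mu> i, 1:]"
  shows "degree (p n) = n" "coeff (p n) n = 1" "coeff (p (Suc n)) n = - (\<Sum>i<Suc n. \<mu> i)"
    "coeff (p (Suc (Suc n))) n = ((\<Sum>i<Suc (Suc n). \<mu> i)\<^sup>2 - (\<Sum>i<Suc (Suc n). (\<mu> i)\<^sup>2)) / 2"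
proof -
  have S: "p (Suc n) = p n * [:- \<mu> n, 1:]" for n by (simp add: p_def)
  have c: "coeff (p (Suc n)) k = (if k = 0 then 0 else coeff (p n) (k - 1)) - \<mu> n * coeff (p n) k" for n k
    unfolding S by (cases k) (simp_all add: coeff_pCons)
  show dg: "degree (p n) = n" for n
    unfolding p_def by (subst degree_prod_eq_sum_degree) auto
  then have z: "coeff (p n) k = 0" if "k > n" for n k
    using that coeff_eq_0[of "p n" k] by simp
  show c0: "coeff (p n) n = 1" for n
    by (induction n) (simp_all add: c z, simp add: p_def)
  show c1: "coeff (p (Suc n)) n = - (\<Sum>i<Suc n. \<mu> i)" for n
    by (induction n) (simp_all add: c[of "Suc _"] c0, simp add: p_def)
  show "coeff (p (Suc (Suc n))) n = ((\<Sum>i<Suc (Suc n). \<mu> i)\<^sup>2 - (\<Sum>i<Suc (Suc n). (\<mu> i)\<^sup>2)) / 2"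
  proof (induction n)
    case 0
    then show ?case by (simp add: p_def power2_eq_square field_simps)
  next
    case (Suc n)
    have "coeff (p (Suc (Suc (Suc n)))) (Suc n)
      = coeff (p (Suc (Suc n))) n - \<mu> (Suc (Suc n)) * coeff (p (Suc (Suc n))) (Suc n)"
      by (simp add: c[of "Suc (Suc n)"])
    then show ?case unfolding Suc c1
      by (simp add: power2_eq_square field_simps)
  qed
qed

text \<open>For q >= 3 the corner entries contribute |i a_q|^2 like any other link. For q = 2 both
  links join the same two indices, and the factor i removes the cross term: |a_1 + i a_2|^2 = a_1^2
  + a_2^2.\<close>

lemma Re_trace_L2:
  assumes "q \<ge> 2"
  shows "Re (trace_L2 a b q) = (\<Sum>j = 1..q. (b (int j))\<^sup>2) + 2 * (\<Sum>j = 1..q. (a (int j))\<^sup>2)"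
proof (cases "q = 2")
  case True
  have "{1..2::nat} = {1, 2}" by auto
  then show ?thesis using True by (simp add: trace_L2_def Lmat_def power2_eq_square algebra_simps)
next
  case False
  then have q: "q \<ge> 3" using assms by simp
  define f where "f j = (a (int j))\<^sup>2" for j
  have e: "Re (Lmat a b q j k * Lmat a b q k j) = (if k = j then (b (int j))\<^sup>2 else 0)
      + (if k = Suc j then f j else 0) + (if j = Suc k then f k else 0)
      + (if k = q then (if j = 1 then f q else 0) else 0) + (if k = 1 then (if j = q then f q else 0) else 0)" for j k
    using q False by (auto simp: Lmat_def power2_eq_square f_def)
  have s1: "(\<Sum>j = 1..q. \<Sum>k = 1..q. if k = Suc j then f j else 0) = (\<Sum>j = 1..q - 1. f j)"
  proof -
    have "(\<Sum>k = 1..q. if k = Suc j then f j else 0) = (if j \<le> q - 1 then f j else 0)" if "j \<in> {1..q}" for j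
      using that q by (auto simp: sum.delta)
    then have "(\<Sum>j = 1..q. \<Sum>k = 1..q. if k = Suc j then f j else 0) = (\<Sum>j = 1..q. if j \<le> q - 1 then f j else 0)"
      by (intro sum.cong refl) auto
    also have "\<dots> = (\<Sum>j \<in> {1..q} \<inter> {j. j \<le> q - 1}. f j)" by (subst sum.inter_restrict) auto
    also have "{1..q} \<inter> {j. j \<le> q - 1} = {1..q - 1}" using q by auto
    finally show ?thesis .
  qed
  have s2: "(\<Sum>j = 1..q. \<Sum>k = 1..q. if j = Suc k then f k else 0) = (\<Sum>j = 1..q - 1. f j)"
    by (subst sum.swap) (rule s1)
  have s3: "(\<Sum>j = 1..q. f j) = (\<Sum>j = 1..q - 1. f j) + f q"
  proof -
    obtain r where "q = Suc r" using q by (cases q) auto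
    then show ?thesis by simp
  qed
  have "Re (trace_L2 a b q) = (\<Sum>j = 1..q. (b (int j))\<^sup>2) + (\<Sum>j = 1..q - 1. f j) + (\<Sum>j = 1..q - 1. f j) + f q + f q"
    unfolding trace_L2_def Re_sum e sum.distrib s1 s2 using q by (simp add: sum.delta)
  then show ?thesis unfolding f_def[symmetric] s3 by simp
qed

section \<open>Band structure of a polynomial with real level sets\<close>

lemma prod_neg_iff_odd:
  fixes e :: "'i \<Rightarrow> real"
  assumes "finite S" "\<And>i. i \<in> S \<Longrightarrow> e i \<noteq> x"
  shows "(\<Prod>i\<in>S. x - e i) < 0 \<longleftrightarrow> odd (card {i \<in> S. e i > x})"
    and "(\<Prod>i\<in>S. x - e i) > 0 \<longleftrightarrow> even (card {i \<in> S. e i > x})"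
proof -
  have "((\<Prod>i\<in>S. x - e i) < 0 \<longleftrightarrow> odd (card {i \<in> S. e i > x})) \<and>
    ((\<Prod>i\<in>S. x - e i) > 0 \<longleftrightarrow> even (card {i \<in> S. e i > x}))"
    using assms
  proof (induction S rule: finite_induct)
    case (insert s S)
    have "{i \<in> insert s S. e i > x} = (if e s > x then insert s {i \<in> S. e i > x} else {i \<in> S. e i > x})"
      by auto
    moreover have "e s \<noteq> x" using insert.prems by auto
    then have "e s < x \<longleftrightarrow> \<not> e s > x" by auto
    ultimately show ?case using insert
      by (auto simp: zero_less_mult_iff mult_less_0_iff)
  qed auto
  then show "(\<Prod>i\<in>S. x - e i) < 0 \<longleftrightarrow> odd (card {i \<in> S. e i > x})"
    "(\<Prod>i\<in>S. x - e i) > 0 \<longleftrightarrow> even (card {i \<in> S. e i > x})" by auto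
qed

lemma prod_mset_mset: "(\<Prod>x\<in>#mset xs. f x) = (\<Prod>i<length xs. f (xs ! i))"
proof (induction xs rule: rev_induct)
  case (snoc x xs)
  have "(\<Prod>i<length xs. f ((xs @ [x]) ! i)) = (\<Prod>i<length xs. f (xs ! i))"
    by (intro prod.cong refl) (simp add: nth_append)
  then show ?case using snoc by (simp add: mult.commute)
qed simp

text \<open>The operator is forgotten from here on: \<open>level_real\<close> is what is kept of its
  self-adjointness.\<close>

locale band_poly =
  fixes D :: "real poly" and q :: nat
  assumes q1: "q \<ge> 1" and deg: "degree D = q" and lead: "lead_coeff D > 0"
    and level_real: "\<And>l t. cpoly D l = of_real t \<Longrightarrow> \<bar>t\<bar> \<le> 2 \<Longrightarrow> l \<in> \<real>"
begin

lemma D_nonzero: "D \<noteq> 0"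
  using lead by auto

lemma level_splits:
  assumes "\<bar>t\<bar> \<le> 2"
  obtains M where "D - [:t:] = smult (lead_coeff D) (\<Prod>x\<in>#M. [:- x, 1:])" "size M = q"
proof -
  have dg: "degree (D - [:t:]) = q"
    using deg q1 degree_add_eq_left[of "- [:t:]" D] by (simp del: minus_pCons flip: diff_conv_add_uminus)
  have "D - [:t:] \<noteq> 0" using dg q1 by auto
  moreover have "z \<in> \<real>" if "cpoly (D - [:t:]) z = 0" for z
    using that level_real[OF _ assms, of z] by simp
  ultimately obtain M where M: "D - [:t:] = smult (lead_coeff (D - [:t:])) (\<Prod>x\<in>#M. [:- x, 1:])"
      "size M = degree (D - [:t:])"
    using real_rooted_splits by blast
  have "lead_coeff (D - [:t:]) = lead_coeff D" using dg deg q1 by (simp add: coeff_pCons split: nat.split)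
  then show ?thesis using M dg that by metis
qed

text \<open>An explicit twin of \<open>band_edges\<close>, which is given by a definite description;
  \<open>band_edges_unique\<close> identifies the two.\<close>

definition edges :: "real list" where
  "edges = sorted_list_of_multiset (proots (D\<^sup>2 - [:4:]))"

lemma sorted_edges: "sorted edges"
  by (simp add: edges_def)

lemma edge_factor: "D\<^sup>2 - [:4:] = smult ((lead_coeff D)\<^sup>2) (\<Prod>i<2*q. [:- edges ! i, 1:])"
  and length_edges: "length edges = 2 * q"
proof -
  obtain M1 where M1: "D - [:2:] = smult (lead_coeff D) (\<Prod>x\<in>#M1. [:- x, 1:])" "size M1 = q"
    using level_splits[of 2] by auto
  obtain M2 where M2: "D - [:-2:] = smult (lead_coeff D) (\<Prod>x\<in>#M2. [:- x, 1:])" "size M2 = q"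
    using level_splits[of "-2"] by auto
  have "D\<^sup>2 - [:4:] = (D - [:2:]) * (D - [:-2:])"
  proof -
    have "(D - [:2:]) * (D - [:-2:]) = D * D - [:2:] * D - [:-2:] * D + [:2:] * [:-2:]"
      by (simp only: left_diff_distrib right_diff_distrib) (simp add: mult.commute)
    then show ?thesis by (simp add: power2_eq_square)
  qed
  also have "\<dots> = smult ((lead_coeff D)\<^sup>2) (\<Prod>x\<in>#M1 + M2. [:- x, 1:])"
    unfolding M1(1) M2(1) by (simp only: mult_smult_left mult_smult_right smult_smult power2_eq_square
      image_mset_union prod_mset_Un)
  finally have F: "D\<^sup>2 - [:4:] = smult ((lead_coeff D)\<^sup>2) (\<Prod>x\<in>#M1 + M2. [:- x, 1:])" .
  have "proots (D\<^sup>2 - [:4:]) = M1 + M2"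
    unfolding F by (rule proots_of_splitting) (use D_nonzero in simp)
  then have ms: "mset edges = M1 + M2" by (simp add: edges_def)
  then show len: "length edges = 2 * q" using M1(2) M2(2) by (metis mult_2 size_mset size_union)
  have "(\<Prod>x\<in>#mset edges. [:- x, 1:]) = (\<Prod>i<2*q. [:- edges ! i, 1:])"
    unfolding len[symmetric] by (rule prod_mset_mset)
  then show "D\<^sup>2 - [:4:] = smult ((lead_coeff D)\<^sup>2) (\<Prod>i<2*q. [:- edges ! i, 1:])"
    using F ms by simp
qed

lemma edge_prod: "(poly D x)\<^sup>2 - 4 = (lead_coeff D)\<^sup>2 * (\<Prod>i<2*q. x - edges ! i)"
  using arg_cong[OF edge_factor, of "\<lambda>p. poly p x"] by (simp add: poly_prod)

lemma edge_mono: "i \<le> j \<Longrightarrow> j < 2 * q \<Longrightarrow> edges ! i \<le> edges ! j"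
  using sorted_edges length_edges by (simp add: sorted_nth_mono)

lemma edge_value: "i < 2 * q \<Longrightarrow> \<bar>poly D (edges ! i)\<bar> = 2"
proof -
  assume "i < 2 * q"
  then have "(\<Prod>j<2*q. edges ! i - edges ! j) = 0" by (intro prod_zero) auto
  then have "(poly D (edges ! i))\<^sup>2 = 2\<^sup>2" using edge_prod[of "edges ! i"] by algebra
  then show ?thesis by (metis abs_numeral power2_eq_iff abs_minus)
qed

lemma edge_iff: "\<bar>poly D x\<bar> = 2 \<longleftrightarrow> x \<in> set edges"
proof
  assume "\<bar>poly D x\<bar> = 2"
  then have "(poly D x)\<^sup>2 = 4" by (metis power2_abs power2_eq_square numeral_times_numeral semiring_norm(13) semiring_norm(11) semiring_norm(12))
  then have "(\<Prod>i<2*q. x - edges ! i) = 0" using edge_prod[of x] D_nonzero by simp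
  then obtain i where "i < 2 * q" "x = edges ! i" by auto
  then show "x \<in> set edges" using length_edges by auto
next
  assume "x \<in> set edges"
  then show "\<bar>poly D x\<bar> = 2" using edge_value length_edges by (auto simp: in_set_conv_nth)
qed

text \<open>\<open>k\<close> counts the edges to the left of \<open>x\<close>, so 2 q - k linear
  factors of D^2 - 4 are negative at \<open>x\<close>, and this number has the parity of
  \<open>k\<close>.\<close>

lemma band_gap_sign:
  assumes "k \<le> 2 * q" "\<And>i. i < k \<Longrightarrow> edges ! i < x" "\<And>i. k \<le> i \<Longrightarrow> i < 2 * q \<Longrightarrow> x < edges ! i"
  shows "\<bar>poly D x\<bar> < 2 \<longleftrightarrow> odd k" "\<bar>poly D x\<bar> > 2 \<longleftrightarrow> even k"
proof -
  have ne: "edges ! i \<noteq> x" if "i \<in> {..<2*q}" for i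
    using assms(2)[of i] assms(3)[of i] that by (cases "i < k") auto
  have "{i \<in> {..<2*q}. edges ! i > x} = {k..<2*q}"
    using assms(2,3) by (auto simp: not_less[symmetric]) (meson less_asym not_less)
  then have c: "card {i \<in> {..<2*q}. edges ! i > x} = 2 * q - k" by simp
  have l: "(lead_coeff D)\<^sup>2 > 0" using D_nonzero by simp
  have "\<bar>poly D x\<bar> < 2 \<longleftrightarrow> (poly D x)\<^sup>2 - 4 < 0"
    using abs_le_square_iff[of 2 "poly D x"] by (auto simp: not_le[symmetric])
  also have "\<dots> \<longleftrightarrow> (\<Prod>i<2*q. x - edges ! i) < 0"
    unfolding edge_prod using l by (simp add: mult_less_0_iff)
  also have "\<dots> \<longleftrightarrow> odd k"
    using prod_neg_iff_odd(1)[OF _ ne, of "{..<2*q}"] c assms(1) by simp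
  finally show 1: "\<bar>poly D x\<bar> < 2 \<longleftrightarrow> odd k" .
  have "\<bar>poly D x\<bar> \<noteq> 2" using edge_iff ne length_edges by (auto simp: in_set_conv_nth)
  then show "\<bar>poly D x\<bar> > 2 \<longleftrightarrow> even k" using 1 by linarith
qed

lemma pderiv_level: "pderiv (D - [:t:]) = pderiv D"
  by (simp add: pderiv_diff pderiv_pCons)

text \<open>Laguerre's inequality for D - t: at a critical point the square of the derivative drops
  out and a product of definite sign remains. Every level t in [-2, 2] may be used at the same
  point.\<close>

lemma critical_second_derivative:
  assumes "\<bar>t\<bar> \<le> 2" "poly (pderiv D) x = 0" "poly D x \<noteq> t"
  shows "(poly D x - t) * poly (pderiv (pderiv D)) x < 0"
proof -
  obtain M where M: "D - [:t:] = smult (lead_coeff D) (\<Prod>x\<in>#M. [:- x, 1:])" "size M = q"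
    using level_splits[OF assms(1)] .
  have "M \<noteq> {#}" using M(2) q1 by auto
  from laguerre_inequality(2)[OF this, of "lead_coeff D" x] show ?thesis
    unfolding M(1)[symmetric] pderiv_level using assms by simp
qed

text \<open>At a critical point D'' would have to be opposite in sign both to D - 2 < 0 and to D + 2
  > 0.\<close>

lemma no_critical_in_band:
  assumes "\<bar>poly D x\<bar> < 2"
  shows "poly (pderiv D) x \<noteq> 0"
proof
  assume c: "poly (pderiv D) x = 0"
  have "(poly D x - 2) * poly (pderiv (pderiv D)) x < 0" "(poly D x - (-2)) * poly (pderiv (pderiv D)) x < 0"
    by (rule critical_second_derivative; use assms c in auto)+
  then show False using assms by (auto simp: mult_less_0_iff)
qed

text \<open>Parity excludes a double edge at an even position. A double edge is critical for D, with
  D D'' < 0, so |D| < 2 just to its right. A point of a band has an odd number of edges on its left,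
  which forces a third edge at the same place; but the negative second derivative allows only a
  double root of D^2 - 4.\<close>

lemma band_nondegenerate:
  assumes m: "m < q"
  shows "edges ! (2 * m) < edges ! (2 * m + 1)"
proof (rule ccontr)
  assume "\<not> ?thesis"
  then have eq: "edges ! (2 * m + 1) = edges ! (2 * m)"
    using edge_mono[of "2*m" "2*m+1"] m by simp
  define e where "e = edges ! (2 * m)"
  define P where "P = D\<^sup>2 - [:4:]"
  have dv: "(\<Prod>i\<in>S. [:- edges ! i, 1:]) dvd P" if "S \<subseteq> {..<2*q}" for S
    unfolding P_def edge_factor by (rule dvd_smult) (rule prod_dvd_prod_subset, use that in auto)
  have "[:-e, 1:] * [:-e, 1:] dvd P"
    using dv[of "{2*m, 2*m+1}"] m eq by (simp add: e_def del: mult_pCons_left)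
  then obtain g where g: "P = [:-e, 1:] * [:-e, 1:] * g" by (auto elim: dvdE)
  obtain h where h: "h = [:-e, 1:]" by blast
  then have hz: "poly h e = 0" and hp: "pderiv h = 1" by (simp_all add: pderiv_pCons)
  have P0: "poly P e = 0" and P1: "poly (pderiv P) e = 0" and P2: "poly (pderiv (pderiv P)) e = 2 * poly g e"
    unfolding g h[symmetric] by (simp_all add: pderiv_mult pderiv_add hz hp)
  have De: "\<bar>poly D e\<bar> = 2" using edge_value[of "2*m"] m by (simp add: e_def)
  have d1: "pderiv P = smult 2 (D * pderiv D)"
    using smult_add_left[of 1 1 "D * pderiv D"]
    by (simp add: P_def power2_eq_square pderiv_diff pderiv_mult pderiv_pCons)
  then have D1: "poly (pderiv D) e = 0" using P1 De by auto
  have "poly D e * poly (pderiv (pderiv D)) e < 0"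
    using critical_second_derivative[of 0 e] De D1 by auto
  then have "poly g e < 0"
    using P2 D1 unfolding d1 by (simp add: pderiv_smult pderiv_mult pderiv_add)
  moreover have "(poly g \<longlongrightarrow> poly g e) (at e)"
    using poly_isCont[of e g] by (simp add: isCont_def)
  ultimately have "eventually (\<lambda>x. poly g x < 0) (at e)"
    using order_tendstoD(2) by blast
  then have "eventually (\<lambda>x. poly g x < 0) (at_right e)"
    by (rule filter_leD[OF at_le, rotated]) auto
  moreover have "eventually (\<lambda>x. \<forall>i<2*q. edges ! i > e \<longrightarrow> x < edges ! i) (at_right e)"
  proof -
    have "eventually (\<lambda>x. \<forall>i\<in>{..<2*q}. edges ! i > e \<longrightarrow> x < edges ! i) (at_right e)"
      by (intro eventually_ball_finite ballI) (auto simp: eventually_at_right_field)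
    then show ?thesis by (simp add: Ball_def)
  qed
  moreover have "eventually (\<lambda>x. x > e) (at_right e)"
    by (simp add: eventually_at_filter)
  ultimately have "eventually (\<lambda>x. poly g x < 0 \<and> (\<forall>i<2*q. edges ! i > e \<longrightarrow> x < edges ! i) \<and> x > e) (at_right e)"
    by eventually_elim auto
  \<comment> \<open>A point so close to \<open>e\<close> on its right that \<open>g\<close> has kept
    its sign and no other edge has been passed.\<close>
  then obtain x where x: "poly g x < 0" "\<forall>i<2*q. edges ! i > e \<longrightarrow> x < edges ! i" "x > e"
    using eventually_happens[of _ "at_right e"] by auto
  define k where "k = card {i. i < 2 * q \<and> edges ! i \<le> e}"
  have down: "i < k \<longleftrightarrow> edges ! i \<le> e" if "i < 2 * q" for i
  proof -
    define S where "S = {i. i < 2 * q \<and> edges ! i \<le> e}"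
    have "S \<subseteq> {..<2*q}" and fin: "finite S" by (auto simp: S_def)
    have dc: "j \<in> S" if "j \<le> i" "i \<in> S" for i j
      using that edge_mono[of j i] unfolding S_def by auto
    show ?thesis
    proof
      assume "i < k"
      show "edges ! i \<le> e"
      proof (rule ccontr)
        assume "\<not> edges ! i \<le> e"
        then have "i \<notin> S" by (simp add: S_def)
        then have "S \<subseteq> {..<i}" using dc by (meson lessThan_iff not_le subsetI)
        then have "card S \<le> i" using card_mono[of "{..<i}" S] by simp
        then show False using \<open>i < k\<close> by (simp add: k_def S_def)
      qed
    next
      assume "edges ! i \<le> e"
      then have "i \<in> S" using that by (simp add: S_def)
      then have "{..i} \<subseteq> S" using dc by auto
      then have "Suc i \<le> card S" using card_mono[OF fin] by (metis card_atMost)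
      then show "i < k" by (simp add: k_def S_def)
    qed
  qed
  have k2: "k \<le> 2 * q"
    using card_mono[of "{..<2*q}" "{i. i < 2 * q \<and> edges ! i \<le> e}"] unfolding k_def by auto
  have "poly P x = (x - e)\<^sup>2 * poly g x"
    unfolding g by (simp add: power2_eq_square algebra_simps)
  then have "poly P x < 0"
    using x by (simp add: mult_pos_neg)
  then have "(poly D x)\<^sup>2 < 2\<^sup>2" by (simp add: P_def)
  then have "\<bar>poly D x\<bar> < 2" using abs_le_square_iff[of 2 "poly D x"] by auto
  moreover have "\<bar>poly D x\<bar> < 2 \<longleftrightarrow> odd k"
  proof (rule band_gap_sign(1)[OF k2])
    show "edges ! i < x" if "i < k" for i using that down[of i] k2 x(3) by auto
    show "x < edges ! i" if "k \<le> i" "i < 2 * q" for i using that down[of i] x(2) by auto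
  qed
  ultimately have "odd k" by simp
  moreover have "2 * m + 1 < k" using down[of "2*m+1"] m eq by (simp add: e_def)
  \<comment> \<open>An odd \<open>k\<close> above 2 m + 1 is at least 2 m + 3, so a third edge
    coincides with \<open>e\<close>.\<close>
  ultimately have k3: "2 * m + 2 < k" by presburger
  then have "edges ! (2*m+2) \<le> e" "2 * m + 2 < 2 * q" using down[of "2*m+2"] k2 by auto
  then have "edges ! (2*m+2) = e" using edge_mono[of "2*m" "2*m+2"] by (simp add: e_def)
  then have "[:-e, 1:] * [:-e, 1:] * [:-e, 1:] dvd P"
    using dv[of "{2*m, 2*m+1, 2*m+2}"] \<open>2 * m + 2 < 2 * q\<close> eq by (simp add: e_def mult.assoc del: mult_pCons_left)
  then obtain f where "P = [:-e, 1:] * [:-e, 1:] * [:-e, 1:] * f" by (auto elim: dvdE)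
  then have "[:-e, 1:] * [:-e, 1:] * ([:-e, 1:] * f) = [:-e, 1:] * [:-e, 1:] * g" using g by (simp only: mult.assoc)
  then have "[:-e, 1:] * f = g" by (simp del: mult_pCons_left)
  then have "poly g e = 0" by auto
  then show False using \<open>poly g e < 0\<close> by simp
qed

lemma in_band: "m < q \<Longrightarrow> edges ! (2*m) < x \<Longrightarrow> x < edges ! (2*m+1) \<Longrightarrow> \<bar>poly D x\<bar> < 2"
proof -
  assume m: "m < q" and x: "edges ! (2*m) < x" "x < edges ! (2*m+1)"
  have "edges ! i < x" if "i < 2*m+1" for i using edge_mono[of i "2*m"] that x m by simp
  moreover have "x < edges ! i" if "2*m+1 \<le> i" "i < 2 * q" for i using edge_mono[of "2*m+1" i] that x by simp
  ultimately show ?thesis using band_gap_sign(1)[of "2*m+1" x] m by simp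
qed

lemma in_gap: "1 \<le> m \<Longrightarrow> m < q \<Longrightarrow> edges ! (2*m-1) < x \<Longrightarrow> x < edges ! (2*m) \<Longrightarrow> \<bar>poly D x\<bar> > 2"
proof -
  assume m: "1 \<le> m" "m < q" and x: "edges ! (2*m-1) < x" "x < edges ! (2*m)"
  have "edges ! i < x" if "i < 2*m" for i using edge_mono[of i "2*m-1"] that x m by linarith
  moreover have "x < edges ! i" if "2*m \<le> i" "i < 2 * q" for i using edge_mono[of "2*m" i] that x by simp
  ultimately show ?thesis using band_gap_sign(2)[of "2*m" x] m by simp
qed

text \<open>Equal values at the two ends of a band would, by the mean value theorem, produce a
  critical point inside; so D runs between 2 and -2.\<close>

lemma band_zero:
  assumes m: "m < q"
  obtains x where "edges ! (2*m) < x" "x < edges ! (2*m+1)" "poly D x = 0"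
proof -
  let ?u = "edges ! (2*m)" and ?v = "edges ! (2*m+1)"
  have uv: "?u < ?v" using band_nondegenerate[OF m] .
  have ne: "poly D ?u \<noteq> poly D ?v"
  proof
    assume "poly D ?u = poly D ?v"
    then obtain z where "z > ?u" "z < ?v" "poly D ?v - poly D ?u = (?v - ?u) * poly (pderiv D) z"
      using poly_MVT[OF uv, of D] by auto
    then show False using no_critical_in_band[of z] in_band[OF m, of z] uv \<open>poly D ?u = poly D ?v\<close> by auto
  qed
  then have "poly D ?u < 0 \<and> 0 < poly D ?v \<or> poly D ?v < 0 \<and> 0 < poly D ?u"
    using edge_value[of "2*m"] edge_value[of "2*m+1"] m by linarith
  then obtain x where "?u < x" "x < ?v" "poly D x = 0"
    using poly_IVT[of ?u ?v D] uv mult_less_0_iff[of "poly D ?u" "poly D ?v"] by blast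
  then show ?thesis using that by blast
qed

definition bzero :: "nat \<Rightarrow> real" where
  "bzero m = (SOME x. edges ! (2*m) < x \<and> x < edges ! (2*m+1) \<and> poly D x = 0)"

lemma bzero: "m < q \<Longrightarrow> edges ! (2*m) < bzero m \<and> bzero m < edges ! (2*m+1) \<and> poly D (bzero m) = 0"
  unfolding bzero_def by (rule someI_ex) (use band_zero in metis)

lemma bzero_less: "i < j \<Longrightarrow> j < q \<Longrightarrow> bzero i < bzero j"
  using bzero[of i] bzero[of j] edge_mono[of "2*i+1" "2*j"] by force

text \<open>The q bands supply q distinct zeros. This is already the degree, so there are no others
  and all of them are simple.\<close>

lemma discr_factor: "D = smult (lead_coeff D) (\<Prod>i<q. [:- bzero i, 1:])"
proof -
  obtain M where M: "D - [:0:] = smult (lead_coeff D) (\<Prod>x\<in>#M. [:- x, 1:])" "size M = q"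
    using level_splits[of 0] by auto
  have inj: "inj_on bzero {..<q}"
  proof (rule inj_onI)
    fix i j assume "i \<in> {..<q}" "j \<in> {..<q}" "bzero i = bzero j"
    then show "i = j" using bzero_less[of i j] bzero_less[of j i] by (cases i j rule: linorder_cases) auto
  qed
  have D0: "D - [:0:] = D" by simp
  have "proots (D - [:0:]) = M" unfolding M(1) by (rule proots_of_splitting) (use D_nonzero in simp)
  then have pr: "proots D = M" unfolding D0 .
  have sub: "mset_set (bzero ` {..<q}) \<subseteq># M"
    unfolding pr[symmetric]
  proof (rule mset_subset_eqI)
    fix x
    show "count (mset_set (bzero ` {..<q})) x \<le> count (proots D) x"
    proof (cases "x \<in> bzero ` {..<q}")
      case True
      then have "poly D x = 0" using bzero by auto
      then have "order x D \<noteq> 0" using D_nonzero order_root by blast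
      then show ?thesis using True D_nonzero by simp
    qed simp
  qed
  have "size (mset_set (bzero ` {..<q})) = size M"
    using card_image[OF inj] M(2) by simp
  then have "M = mset_set (bzero ` {..<q})" using sub
    using mset_subset_size[of "mset_set (bzero ` {..<q})" M] by (auto simp: subset_mset_def)
  then have eq: "(\<Prod>x\<in>#M. [:- x, 1:]) = (\<Prod>i<q. [:- bzero i, 1:])"
    using prod.reindex[OF inj, of "\<lambda>x. [:- x, 1:]"] by (simp add: prod_unfold_prod_mset)
  show ?thesis using M(1) unfolding D0 eq .
qed

text \<open>Points of level 2 or -2 are band edges. The bound on them is what later allows these
  roots to be written as - c cos s with real s.\<close>

lemma level2_factor:
  assumes "\<bar>t\<bar> = 2"
  obtains r where "D - [:t:] = smult (lead_coeff D) (\<Prod>i<q. [:- r i, 1:])"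
    "\<And>i. i < q \<Longrightarrow> edges ! 0 \<le> r i \<and> r i \<le> edges ! (2 * q - 1)"
proof -
  obtain M where M: "D - [:t:] = smult (lead_coeff D) (\<Prod>x\<in>#M. [:- x, 1:])" "size M = q"
    using level_splits[of t] assms by auto
  obtain xs where xs: "M = mset xs" by (metis ex_mset)
  have len: "length xs = q" using M(2) xs by simp
  have "(\<Prod>x\<in>#M. [:- x, 1:]) = (\<Prod>i<q. [:- xs ! i, 1:])"
    unfolding len[symmetric] xs by (rule prod_mset_mset)
  moreover have "edges ! 0 \<le> xs ! i \<and> xs ! i \<le> edges ! (2 * q - 1)" if "i < q" for i
  proof -
    have "xs ! i \<in># M" using xs len that by simp
    then have "poly (D - [:t:]) (xs ! i) = 0"
      unfolding M(1) by (simp add: poly_prod_mset image_mset.compositionality o_def)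
    then have "\<bar>poly D (xs ! i)\<bar> = 2" using assms by simp
    then obtain j where "j < 2 * q" "xs ! i = edges ! j" unfolding edge_iff using length_edges by (auto simp: in_set_conv_nth)
    then show ?thesis using edge_mono[of 0 j] edge_mono[of j "2*q-1"] by simp
  qed
  ultimately show ?thesis using that[of "(!) xs"] M(1) by simp
qed

end

section \<open>Inverting the Joukowski map\<close>

lemma one_minus_inverse_square_nonpos:
  fixes w :: complex
  assumes "1 - 4 / w\<^sup>2 \<in> \<real>\<^sub>\<le>\<^sub>0" "w \<noteq> 0"
  obtains t where "w = of_real t" "\<bar>t\<bar> \<le> 2"
proof -
  from assms(1) obtain r where r: "1 - 4 / w\<^sup>2 = of_real r" "r \<le> 0"
    by (auto elim!: nonpos_Reals_cases)
  then have "w\<^sup>2 = of_real (4 / (1 - r))" using assms(2) by (simp add: field_simps)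
  also have "\<dots> = (of_real (sqrt (4 / (1 - r))))\<^sup>2" using r(2) by (simp flip: of_real_power)
  finally have "w = of_real (sqrt (4 / (1 - r))) \<or> w = of_real (- sqrt (4 / (1 - r)))"
    by (simp add: power2_eq_iff)
  moreover have "\<bar>sqrt (4 / (1 - r))\<bar> \<le> 2"
    using r(2) by (simp add: real_sqrt_le_iff' real_le_lsqrt field_simps)
  ultimately show ?thesis
    using that[of "sqrt (4 / (1 - r))"] that[of "- sqrt (4 / (1 - r))"] by auto
qed

lemma one_plus_csqrt_slit: "(1 + csqrt w) / 2 \<notin> \<real>\<^sub>\<le>\<^sub>0"
proof -
  have "Re ((1 + csqrt w) / 2) > 0" using Re_csqrt[of w] by (simp del: csqrt.simps)
  then show ?thesis by (auto simp: complex_nonpos_Reals_iff)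
qed

lemma one_minus_slit: "cmod w < 1 \<Longrightarrow> 1 - w \<notin> \<real>\<^sub>\<le>\<^sub>0"
  using complex_Re_le_cmod[of w] by (auto simp: complex_nonpos_Reals_iff)

text \<open>The focal equation of an ellipse: x + 1/x maps circles about 0 to ellipses with foci 2
  and -2. Both summands are squares divided by x, and the parallelogram law adds them.\<close>

lemma joukowski_norm:
  assumes "x * x' = 1"
  shows "cmod (x + x' + 2) + cmod (x + x' - 2) = 2 * (cmod x + 1 / cmod x)"
proof -
  have x0: "x \<noteq> 0" and x': "x' = 1 / x" using assms by (auto simp: eq_divide_eq mult.commute)
  have "x + x' + 2 = (x + 1)\<^sup>2 / x" "x + x' - 2 = (x - 1)\<^sup>2 / x"
    using x0 by (simp_all add: x' power2_eq_square field_simps)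
  then have "cmod (x + x' + 2) + cmod (x + x' - 2) = ((cmod (x + 1))\<^sup>2 + (cmod (x - 1))\<^sup>2) / cmod x"
    by (simp add: norm_divide norm_power add_divide_distrib)
  also have "(cmod (x + 1))\<^sup>2 + (cmod (x - 1))\<^sup>2 = 2 * (cmod x)\<^sup>2 + 2"
    by (simp add: cmod_power2) (simp add: power2_eq_square algebra_simps)
  also have "(2 * (cmod x)\<^sup>2 + 2) / cmod x = 2 * (cmod x + 1 / cmod x)"
    using x0 by (simp add: power2_eq_square field_simps)
  finally show ?thesis .
qed

text \<open>The root \<open>x\<close> of \<open>x + 1 / x = w\<close> outside the unit disc; holomorphic off \<open>[-2, 2]\<close>.\<close>
definition joukowski_inv :: "complex \<Rightarrow> complex" where
  "joukowski_inv w = w * ((1 + csqrt (1 - 4 / w\<^sup>2)) / 2)"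

text \<open>Since \<open>csqrt\<close> has nonnegative real part, the plus sign selects the root of
  larger modulus. The identity also holds on the cut [-2, 2], where both sides equal 1.\<close>

lemma norm_joukowski_inv:
  assumes "w \<noteq> 0"
  shows "cmod (joukowski_inv w) = exp (arcosh ((cmod (w + 2) + cmod (w - 2)) / 4))"
proof -
  define s where "s = csqrt (1 - 4 / w\<^sup>2)"
  have s2: "s\<^sup>2 = 1 - 4 / w\<^sup>2" by (simp add: s_def)
  define X X' where "X = w * ((1 + s) / 2)" and "X' = w * ((1 - s) / 2)"
  have XX: "X * X' = 1"
  proof -
    have "X * X' = w\<^sup>2 * (1 - s\<^sup>2) / 4" by (simp add: X_def X'_def power2_eq_square algebra_simps)
    moreover have "w\<^sup>2 * (1 - s\<^sup>2) = 4" unfolding s2 using assms by (simp add: field_simps)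
    ultimately show ?thesis by simp
  qed
  have Xs: "X + X' = w" by (simp add: X_def X'_def field_simps)
  have "Re s \<ge> 0" unfolding s_def by (rule Re_csqrt)
  then have "(cmod (1 - s))\<^sup>2 \<le> (cmod (1 + s))\<^sup>2"
    by (simp add: cmod_power2) (simp add: power2_eq_square algebra_simps)
  then have "cmod (1 - s) \<le> cmod (1 + s)" by (rule power2_le_imp_le) simp
  then have "cmod X' \<le> cmod X" by (simp add: X_def X'_def norm_mult norm_divide mult_left_mono)
  moreover have "cmod X * cmod X' = 1" using XX by (metis norm_mult norm_one)
  ultimately have "1\<^sup>2 \<le> (cmod X)\<^sup>2"
    using mult_left_mono[of "cmod X'" "cmod X" "cmod X"] by (simp add: power2_eq_square)
  then have X1: "cmod X \<ge> 1" by (rule power2_le_imp_le) simp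
  then have X0: "X \<noteq> 0" by auto
  define R where "R = cmod X + 1 / cmod X"
  have "(cmod (w + 2) + cmod (w - 2)) = 2 * R"
    using joukowski_norm[OF XX] Xs by (simp add: R_def)
  moreover have "cosh (ln (cmod X)) = R / 2"
    using X1 by (subst cosh_ln_real) (auto simp: inverse_eq_divide R_def)
  ultimately have "(cmod (w + 2) + cmod (w - 2)) / 4 = cosh (ln (cmod X))" by simp
  then have "arcosh ((cmod (w + 2) + cmod (w - 2)) / 4) = ln (cmod X)"
    using X1 arcosh_cosh_real[of "ln (cmod X)"] by simp
  then show ?thesis using X0 by (simp add: joukowski_inv_def X_def s_def)
qed

text \<open>Only w in [-2, 2] puts 1 - 4/w^2 on the cut of \<open>csqrt\<close>. Taking the factor w
  out first avoids the further cut along the imaginary axis that the principal root of w^2 - 4 would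
  have.\<close>

lemma joukowski_inv_holomorphic:
  assumes "f holomorphic_on S" "\<And>z t. z \<in> S \<Longrightarrow> f z = of_real t \<Longrightarrow> \<bar>t\<bar> > 2"
  shows "(\<lambda>z. joukowski_inv (f z)) holomorphic_on S"
proof -
  have nz: "f z \<noteq> 0" if "z \<in> S" for z using assms(2)[OF that, of 0] by auto
  have "1 - 4 / (f z)\<^sup>2 \<notin> \<real>\<^sub>\<le>\<^sub>0" if "z \<in> S" for z
    using one_minus_inverse_square_nonpos[of "f z"] nz[OF that] assms(2)[OF that] by (metis not_le)
  then show ?thesis unfolding joukowski_inv_def by (intro holomorphic_intros assms) (use nz in auto)
qed

lemma norm_cos_diff_squared:
  "(cmod (of_real (cos s) - cos z))\<^sup>2 = (cosh (Im z))\<^sup>2 - 2 * (cos s * cos (Re z)) * cosh (Im z)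
     + (cos s)\<^sup>2 + (cos (Re z))\<^sup>2 - 1"
proof -
  have "(cmod (of_real (cos s) - cos z))\<^sup>2
      = (cos s - cos (Re z) * cosh (Im z))\<^sup>2 + (sin (Re z))\<^sup>2 * (sinh (Im z))\<^sup>2"
  proof -
    have "Re (cos z) = cos (Re z) * cosh (Im z)" "Im (cos z) = - (sin (Re z) * sinh (Im z))"
      by (simp_all add: Re_cos Im_cos cosh_field_def sinh_field_def field_simps)
    then show ?thesis by (simp add: cmod_power2 power_mult_distrib)
  qed
  also have "(sin (Re z))\<^sup>2 = 1 - (cos (Re z))\<^sup>2" by (simp add: sin_squared_eq)
  also have "(sinh (Im z))\<^sup>2 = (cosh (Im z))\<^sup>2 - 1" by (simp add: sinh_square_eq)
  finally show ?thesis by (simp add: power2_eq_square algebra_simps)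
qed

text \<open>As a function of cosh y the squared modulus is a quadratic with vertex at cos s cos x,
  which is at most 1 and so lies to the left of all values of cosh.\<close>

lemma norm_cos_diff_mono:
  assumes "0 \<le> y" "y \<le> y'"
  shows "cmod (of_real (cos s) - cos (Complex x y)) \<le> cmod (of_real (cos s) - cos (Complex x y'))"
proof -
  have c: "1 \<le> cosh y" "cosh y \<le> cosh y'"
    using assms by (auto simp: cosh_real_ge_1 cosh_real_nonneg_le_iff)
  have "\<bar>cos s * cos x\<bar> \<le> 1 * 1"
    unfolding abs_mult by (intro mult_mono) auto
  then have "0 \<le> (cosh y' - cosh y) * (cosh y' + cosh y - 2 * (cos s * cos x))"
    using c by (intro mult_nonneg_nonneg) auto
  then have "(cmod (of_real (cos s) - cos (Complex x y)))\<^sup>2 \<le> (cmod (of_real (cos s) - cos (Complex x y')))\<^sup>2"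
    unfolding norm_cos_diff_squared by (simp add: power2_eq_square algebra_simps)
  then show ?thesis by (rule power2_le_imp_le) simp
qed

section \<open>The exponent function of a comb polynomial\<close>

text \<open>Here \<open>Dz z\<close> is the discriminant at \<open>- c cos z\<close>, \<open>K = c / (2 A)\<close>, and \<open>\<psi>\<close>, \<open>s1\<close>, \<open>s2\<close>
  are the lifted roots of the levels \<open>0\<close>, \<open>2\<close>, \<open>-2\<close>. That all of them are real makes
  \<open>\<bar>Dz z - 2\<bar>\<close> and \<open>\<bar>Dz z + 2\<bar>\<close> increase with \<open>\<bar>Im z\<bar>\<close>.\<close>
locale comb =
  fixes q :: nat and K :: real and \<psi> s1 s2 \<alpha> \<beta> :: "nat \<Rightarrow> real" and Dz :: "complex \<Rightarrow> complex"
  assumes q2: "q \<ge> 2" and K: "K > 0"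
    and \<psi>: "\<And>j. j < q \<Longrightarrow> 0 < \<psi> j \<and> \<psi> j < pi"
    and Dz: "\<And>z. Dz z = (2 * of_real K) ^ q * (\<Prod>j<q. of_real (cos (\<psi> j)) - cos z)"
    and Dz_minus: "\<And>z. Dz z - 2 = (2 * of_real K) ^ q * (\<Prod>j<q. of_real (cos (s1 j)) - cos z)"
    and Dz_plus: "\<And>z. Dz z + 2 = (2 * of_real K) ^ q * (\<Prod>j<q. of_real (cos (s2 j)) - cos z)"
    and Dz_level: "\<And>z t. Im z > 0 \<Longrightarrow> Dz z = of_real t \<Longrightarrow> \<bar>t\<bar> > 2"
    and edge_bounds: "\<And>n. 1 \<le> n \<Longrightarrow> n < q \<Longrightarrow> 0 < \<alpha> n \<and> \<alpha> n \<le> \<beta> n \<and> \<beta> n < pi"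
    and edge_order: "\<And>m n. 1 \<le> m \<Longrightarrow> m < n \<Longrightarrow> n < q \<Longrightarrow> \<beta> m < \<alpha> n"
    and band: "\<And>x. 0 \<le> x \<Longrightarrow> x \<le> pi \<Longrightarrow> (\<And>n. 1 \<le> n \<Longrightarrow> n < q \<Longrightarrow> \<not> (\<alpha> n < x \<and> x < \<beta> n)) \<Longrightarrow>
      cmod (Dz (of_real x)) \<le> 2"
    and gap: "\<And>n x. 1 \<le> n \<Longrightarrow> n < q \<Longrightarrow> \<alpha> n < x \<Longrightarrow> x < \<beta> n \<Longrightarrow> cmod (Dz (of_real x)) > 2"
    and count: "\<And>n x. 1 \<le> n \<Longrightarrow> n < q \<Longrightarrow> \<alpha> n < x \<Longrightarrow> x < \<beta> n \<Longrightarrow> card {j. j < q \<and> \<psi> j < x} = n"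
begin

lemma q_pos: "real q > 0"
  using q2 by simp

lemma Dz_holomorphic: "Dz holomorphic_on S"
proof -
  have "Dz = (\<lambda>z. (2 * of_real K) ^ q * (\<Prod>j<q. of_real (cos (\<psi> j)) - cos z))" using Dz by auto
  then show ?thesis by (auto intro!: holomorphic_intros)
qed

lemma Dz_continuous: "continuous_on S Dz"
  using Dz_holomorphic holomorphic_on_imp_continuous_on by blast

lemma Dz_real: "Dz (of_real x) = of_real (Re (Dz (of_real x)))"
proof -
  have "Dz (of_real x) = of_real ((2 * K) ^ q * (\<Prod>j<q. cos (\<psi> j) - cos x))"
    by (simp add: Dz cos_of_real)
  then show ?thesis by simp
qed

lemma Dz_periodic [simp]: "Dz (z + 2 * of_real pi) = Dz z"
  using cos.plus_of_int[of z 1] by (simp add: Dz cos_add)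

lemma Dz_cnj: "Dz (cnj z) = cnj (Dz z)"
  by (simp add: Dz cnj_cos)

lemma Dz_minus_arg: "Dz (- z) = Dz z"
  by (simp add: Dz)

text \<open>Half the major semi-axis of the ellipse with foci 2 and -2 through \<open>Dz z\<close>.
  As a sum of moduli it needs no choice of branch.\<close>

definition M :: "complex \<Rightarrow> real" where
  "M z = (cmod (Dz z + 2) + cmod (Dz z - 2)) / 4"

text \<open>When \<open>Dz\<close> comes from a Jacobi operator, this is its Lyapunov exponent at
  the energy - c cos z.\<close>

definition v :: "complex \<Rightarrow> real" where
  "v z = arcosh (M z) / real q"

lemma M_ge_1: "M z \<ge> 1"
proof -
  have "cmod ((Dz z + 2) - (Dz z - 2)) \<le> cmod (Dz z + 2) + cmod (Dz z - 2)"
    by (rule norm_triangle_ineq4)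
  then show ?thesis by (simp add: M_def)
qed

lemma v_nonneg: "v z \<ge> 0"
  using M_ge_1 q_pos by (simp add: v_def)

lemma continuous_on_v: "continuous_on S v"
proof -
  have "continuous_on S M"
    unfolding M_def[abs_def] by (intro continuous_intros Dz_continuous) auto
  then have "continuous_on S (\<lambda>z. arcosh (M z))"
    by (rule continuous_on_compose2[OF continuous_on_arcosh[OF order.refl]]) (use M_ge_1 in auto)
  then show ?thesis unfolding v_def[abs_def] using q_pos by (intro continuous_intros) auto
qed

lemma v_periodic [simp]: "v (z + 2 * of_real pi) = v z"
  by (simp add: v_def M_def)

text \<open>Reflection in the line Re z = pi. It reduces integrals over the full circle to [0, pi]
  and makes the vertical sides of the half strip free of flux.\<close>

lemma v_reflect: "v (2 * of_real pi - cnj z) = v z"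
proof -
  have "Dz (2 * of_real pi - cnj z) = cnj (Dz z)"
    using Dz_periodic[of "- cnj z"] by (simp add: Dz_minus_arg Dz_cnj add.commute)
  moreover have "cmod (cnj w + 2) = cmod (w + 2)" "cmod (cnj w - 2) = cmod (w - 2)" for w
    using complex_mod_cnj[of "w + 2"] complex_mod_cnj[of "w - 2"] by simp_all
  ultimately show ?thesis by (simp add: v_def M_def)
qed

lemma v_real_le: "cmod (Dz (of_real x)) \<le> 2 \<Longrightarrow> v (of_real x) = 0"
proof -
  assume a: "cmod (Dz (of_real x)) \<le> 2"
  obtain t where t: "Dz (of_real x) = of_real t" using Dz_real by blast
  have "cmod (of_real t + 2) = \<bar>t + 2\<bar>" "cmod (of_real t - 2) = \<bar>t - 2\<bar>"
    by (metis norm_of_real of_real_add of_real_numeral, metis norm_of_real of_real_diff of_real_numeral)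
  then have "M (of_real x) = 1" using a by (simp add: M_def t)
  then show ?thesis by (simp add: v_def)
qed

lemma v_real_gt: "cmod (Dz (of_real x)) \<ge> 2 \<Longrightarrow> v (of_real x) = arcosh (cmod (Dz (of_real x)) / 2) / real q"
proof -
  assume a: "cmod (Dz (of_real x)) \<ge> 2"
  obtain t where t: "Dz (of_real x) = of_real t" using Dz_real by blast
  have "cmod (of_real t + 2) = \<bar>t + 2\<bar>" "cmod (of_real t - 2) = \<bar>t - 2\<bar>"
    by (metis norm_of_real of_real_add of_real_numeral, metis norm_of_real of_real_diff of_real_numeral)
  then have "M (of_real x) = (\<bar>t + 2\<bar> + \<bar>t - 2\<bar>) / 4" by (simp add: M_def t)
  then have "M (of_real x) = \<bar>t\<bar> / 2" using a by (auto simp: t abs_if split: if_splits)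
  then have "M (of_real x) = cmod (Dz (of_real x)) / 2" by (simp add: t)
  then show ?thesis by (simp only: v_def)
qed

lemma v_band: "0 \<le> x \<Longrightarrow> x \<le> pi \<Longrightarrow> (\<And>n. 1 \<le> n \<Longrightarrow> n < q \<Longrightarrow> \<not> (\<alpha> n < x \<and> x < \<beta> n)) \<Longrightarrow> v (of_real x) = 0"
  using band v_real_le by blast

lemma v_gap_pos: "1 \<le> n \<Longrightarrow> n < q \<Longrightarrow> \<alpha> n < x \<Longrightarrow> x < \<beta> n \<Longrightarrow> v (of_real x) > 0"
  using gap[of n x] v_real_gt[of x] q_pos arcosh_real_gt_1_iff[of "cmod (Dz (of_real x)) / 2"] by simp

lemma v_edge:
  assumes "1 \<le> n" "n < q"
  shows "v (of_real (\<alpha> n)) = 0" "v (of_real (\<beta> n)) = 0"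
proof -
  have o: "\<not> (\<alpha> m < x \<and> x < \<beta> m)" if "1 \<le> m" "m < q" "x = \<alpha> n \<or> x = \<beta> n" for m x
    using edge_order[of m n] edge_order[of n m] edge_bounds[of m] edge_bounds[of n] that assms
    by (cases m n rule: linorder_cases) auto
  show "v (of_real (\<alpha> n)) = 0" "v (of_real (\<beta> n)) = 0"
    by (rule v_band; use edge_bounds[of n] assms o in force)+
qed

lemma v_mono:
  assumes "0 \<le> y" "y \<le> y'"
  shows "v (Complex x y) \<le> v (Complex x y')"
proof -
  have "M (Complex x y) \<le> M (Complex x y')"
    unfolding M_def Dz_minus Dz_plus norm_mult prod_norm[symmetric]
    by (intro divide_right_mono add_mono mult_left_mono prod_mono conjI norm_cos_diff_mono assms) auto
  then have "arcosh (M (Complex x y)) \<le> arcosh (M (Complex x y'))"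
  proof (cases "M (Complex x y) = M (Complex x y') \<or> M (Complex x y) = 1")
    case False
    then show ?thesis using \<open>M (Complex x y) \<le> M (Complex x y')\<close> M_ge_1[of "Complex x y"]
      by (intro less_imp_le arcosh_real_strict_mono) auto
  qed (use M_ge_1[of "Complex x y'"] in auto)
  then show ?thesis
    unfolding v_def by (rule divide_right_mono) simp
qed

subsection \<open>The logarithm in the unit disc\<close>

text \<open>In the coordinate \<open>\<zeta> = exp (\<i> z)\<close> the polynomial becomes regular at \<open>\<zeta> = 0\<close>, and
  \<open>Re (L \<zeta>) = q (v z - Im z)\<close>.\<close>

definition P :: "complex \<Rightarrow> complex" where
  "P \<zeta> = of_real K ^ q * (\<Prod>j<q. (1 - \<zeta> * cis (\<psi> j)) * (1 - \<zeta> * cis (- \<psi> j)))"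

definition W :: "complex \<Rightarrow> complex" where
  "W \<zeta> = 1 - 4 * \<zeta> ^ (2 * q) / (P \<zeta>)\<^sup>2"

text \<open>A logarithm of \<open>(- \<zeta>) ^ q * joukowski_inv (Dz z)\<close>. It is assembled as
  a sum so that for |\<zeta>| < 1 every argument of \<open>Ln\<close> stays in the right half plane,
  where the principal branch is holomorphic.\<close>

definition L :: "complex \<Rightarrow> complex" where
  "L \<zeta> = of_real (real q * ln K) + (\<Sum>j<q. Ln (1 - \<zeta> * cis (\<psi> j)) + Ln (1 - \<zeta> * cis (- \<psi> j)))
     + Ln ((1 + csqrt (W \<zeta>)) / 2)"

lemma P_Dz: "P (exp (\<i> * z)) = (- exp (\<i> * z)) ^ q * Dz z"
proof -
  have "(1 - \<zeta> * cis t) * (1 - \<zeta> * cis (- t)) = - \<zeta> * 2 * (of_real (cos t) - cos z)"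
    if \<zeta>: "\<zeta> = exp (\<i> * z)" for t \<zeta>
  proof -
    have "\<zeta> * exp (- (\<i> * z)) = 1" by (simp add: \<zeta> flip: exp_add)
    then have c: "2 * \<zeta> * cos z = \<zeta>\<^sup>2 + 1"
      by (simp add: cos_exp_eq \<zeta>[symmetric] power2_eq_square distrib_left mult.commute)
    have t: "cis t + cis (- t) = 2 * of_real (cos t)" "cis t * cis (- t) = 1"
      by (simp_all add: complex_eq_iff cis_mult)
    have "(1 - \<zeta> * cis t) * (1 - \<zeta> * cis (- t)) = 1 - \<zeta> * (cis t + cis (- t)) + \<zeta>\<^sup>2 * (cis t * cis (- t))"
      by (simp add: power2_eq_square algebra_simps)
    also have "\<dots> = 1 - \<zeta> * (2 * of_real (cos t)) + \<zeta>\<^sup>2" by (simp only: t mult_1_right)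
    also have "\<dots> = - \<zeta> * 2 * (of_real (cos t) - cos z)" using c by (simp add: algebra_simps)
    finally show ?thesis .
  qed
  from this[OF refl] have e: "(1 - exp (\<i> * z) * cis t) * (1 - exp (\<i> * z) * cis (- t)) = - exp (\<i> * z) * 2 * (of_real (cos t) - cos z)" for t .
  have "P (exp (\<i> * z)) = of_real K ^ q * ((- exp (\<i> * z) * 2) ^ q * (\<Prod>j<q. of_real (cos (\<psi> j)) - cos z))"
    unfolding P_def by (simp only: e prod.distrib prod_constant card_lessThan power_mult_distrib)
  also have "\<dots> = (- exp (\<i> * z)) ^ q * ((2 * of_real K) ^ q * (\<Prod>j<q. of_real (cos (\<psi> j)) - cos z))"
    by (simp only: power_mult_distrib mult.assoc mult.left_commute mult.commute)
  finally show ?thesis by (simp only: Dz)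
qed

lemma P_nonzero: "cmod \<zeta> < 1 \<Longrightarrow> P \<zeta> \<noteq> 0"
proof -
  assume "cmod \<zeta> < 1"
  then have "1 - \<zeta> * cis t \<noteq> 0" for t
    using norm_mult[of \<zeta> "cis t"] by auto
  then show ?thesis using K by (simp add: P_def)
qed

lemma W_Dz:
  assumes "Dz z \<noteq> 0"
  shows "W (exp (\<i> * z)) = 1 - 4 / (Dz z)\<^sup>2"
proof -
  have "(P (exp (\<i> * z)))\<^sup>2 = exp (\<i> * z) ^ (2 * q) * (Dz z)\<^sup>2"
    unfolding P_Dz by (simp add: power_mult_distrib power_even_eq power2_eq_square flip: power_mult power_mult_distrib)
  then show ?thesis using assms by (simp add: W_def)
qed

lemma exp_coordinate:
  assumes "\<zeta> \<noteq> 0"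
  obtains z where "\<zeta> = exp (\<i> * z)" "cmod \<zeta> = exp (- Im z)"
proof -
  have "\<zeta> = exp (\<i> * (- \<i> * Ln \<zeta>))" using assms by simp
  then show ?thesis using that by (metis norm_exp_eq_Re Re_i_times)
qed

lemma Dz_nonzero: "Im z > 0 \<Longrightarrow> Dz z \<noteq> 0"
  using Dz_level[of z 0] by auto

lemma W_slit: "cmod \<zeta> < 1 \<Longrightarrow> W \<zeta> \<notin> \<real>\<^sub>\<le>\<^sub>0"
proof
  assume z1: "cmod \<zeta> < 1" and W: "W \<zeta> \<in> \<real>\<^sub>\<le>\<^sub>0"
  show False
  proof (cases "\<zeta> = 0")
    case True
    then have "W \<zeta> = 1" using q2 by (simp add: W_def)
    then show False using W by simp
  next
    case False
    then obtain z where z: "\<zeta> = exp (\<i> * z)" "cmod \<zeta> = exp (- Im z)" by (rule exp_coordinate)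
    then have "Im z > 0" using z1 by simp
    then show False
      using W W_Dz[of z] Dz_nonzero[of z] Dz_level[of z] one_minus_inverse_square_nonpos[of "Dz z"] z
      by (metis not_le)
  qed
qed

lemma W_holomorphic: "W holomorphic_on ball 0 1"
proof -
  have "P holomorphic_on ball 0 1" unfolding P_def[abs_def] by (intro holomorphic_intros)
  then show ?thesis unfolding W_def[abs_def]
    by (intro holomorphic_intros) (use P_nonzero in auto)
qed

lemma L_holomorphic: "L holomorphic_on ball 0 1"
proof -
  have c: "(\<lambda>\<zeta>. csqrt (W \<zeta>)) holomorphic_on ball 0 1"
    using W_slit by (intro holomorphic_on_compose_gen[OF W_holomorphic holomorphic_on_csqrt, unfolded o_def]) auto
  show ?thesis unfolding L_def[abs_def]
    by (intro holomorphic_intros c) (use one_plus_csqrt_slit in \<open>auto intro!: one_minus_slit simp: norm_mult\<close>)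
qed

lemma exp_L: "cmod \<zeta> < 1 \<Longrightarrow> exp (L \<zeta>) = P \<zeta> * ((1 + csqrt (W \<zeta>)) / 2)"
proof -
  assume z: "cmod \<zeta> < 1"
  have "1 - \<zeta> * cis t \<noteq> 0" for t
    using z norm_mult[of \<zeta> "cis t"] by auto
  moreover have "(1 + csqrt (W \<zeta>)) / 2 \<noteq> 0" using one_plus_csqrt_slit[of "W \<zeta>"] by auto
  moreover have "exp (of_real (real q * ln K)) = (of_real K :: complex) ^ q"
    using K by (simp add: exp_of_nat_mult exp_of_real)
  ultimately show ?thesis
    by (simp add: L_def P_def exp_add exp_sum del: of_real_mult)
qed

lemma norm_joukowski_inv_Dz: "Dz z \<noteq> 0 \<Longrightarrow> cmod (joukowski_inv (Dz z)) = exp (real q * v z)"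
  using norm_joukowski_inv[of "Dz z"] q_pos by (simp add: v_def M_def)

lemma Re_L:
  assumes z: "Im z > 0"
  shows "Re (L (exp (\<i> * z))) = real q * (v z - Im z)"
proof -
  define \<zeta> where "\<zeta> = exp (\<i> * z)"
  have nz: "cmod \<zeta> = exp (- Im z)" by (simp add: \<zeta>_def)
  then have z1: "cmod \<zeta> < 1" using z by auto
  have "exp (L \<zeta>) = (- \<zeta>) ^ q * joukowski_inv (Dz z)"
    unfolding exp_L[OF z1] unfolding \<zeta>_def P_Dz W_Dz[OF Dz_nonzero[OF z]] joukowski_inv_def by (simp only: mult.assoc)
  then have "exp (Re (L \<zeta>)) = cmod \<zeta> ^ q * exp (real q * v z)"
    by (metis norm_exp_eq_Re norm_mult norm_power norm_minus_cancel norm_joukowski_inv_Dz[OF Dz_nonzero[OF z]])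
  also have "\<dots> = exp (real q * (v z - Im z))"
    by (simp add: nz right_diff_distrib flip: exp_add exp_of_nat_mult)
  finally show ?thesis by (simp add: \<zeta>_def)
qed

end

section \<open>Taylor coefficients on circles and the integrals of \<open>v\<close>\<close>

lemma circle_mean:
  assumes f: "f holomorphic_on ball 0 1" and r: "0 < r" "r < 1"
  shows "((\<lambda>t. f (of_real r * cis t)) has_integral (2 * of_real pi * f 0)) {0..2 * pi}"
proof -
  have "f holomorphic_on cball 0 r" using f r by (auto elim!: holomorphic_on_subset)
  then have "((\<lambda>u. f u / (u - 0)) has_contour_integral (2 * of_real pi * \<i> * f 0)) (part_circlepath 0 r 0 (2 * pi))"
    using Cauchy_integral_circlepath_simple[of f 0 r 0] r by (simp add: circlepath_def)
  then have "((\<lambda>t. f (of_real r * cis t) * \<i>) has_integral (2 * of_real pi * \<i> * f 0)) {0..2 * pi}"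
    using r by (subst (asm) has_contour_integral_part_circlepath_iff) (simp_all add: field_simps)
  from has_integral_mult_right[OF this, of "-\<i>"] show ?thesis by (simp add: algebra_simps)
qed

text \<open>cos 2t is the mean of exp(-2it) and exp(2it). The first exponential gives Cauchy's
  formula for the second derivative, the second the contour integral of \<open>f u * u\<close>,
  which vanishes.\<close>

lemma circle_cos_coefficient:
  assumes f: "f holomorphic_on ball 0 1" and r: "0 < r" "r < 1"
  shows "((\<lambda>t. f (of_real r * cis t) * of_real (cos (2 * t))) has_integral
    (of_real pi / 2 * of_real (r\<^sup>2) * (deriv ^^ 2) f 0)) {0..2 * pi}"
proof -
  have fc: "f holomorphic_on cball 0 r" using f r by (auto elim!: holomorphic_on_subset)
  have r0: "complex_of_real r \<noteq> 0" using r by simp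
  have c1: "(\<lambda>u. f u / (u - 0) ^ Suc 2) contour_integrable_on (circlepath 0 r)"
    "(deriv ^^ 2) f 0 = (fact 2) / (2 * pi * \<i>) * contour_integral (circlepath 0 r) (\<lambda>u. f u / (u - 0) ^ Suc 2)"
    using fc r holomorphic_on_subset[OF fc ball_subset_cball]
    by (intro Cauchy_higher_derivative_integral_circlepath; auto simp: holomorphic_on_imp_continuous_on)+
  have "contour_integral (circlepath 0 r) (\<lambda>u. f u / (u - 0) ^ Suc 2) = pi * \<i> * (deriv ^^ 2) f 0"
    unfolding c1(2) by (simp add: fact_2)
  then have "((\<lambda>u. f u / (u - 0) ^ Suc 2) has_contour_integral (pi * \<i> * (deriv ^^ 2) f 0)) (part_circlepath 0 r 0 (2 * pi))"
    using has_contour_integral_integral[OF c1(1)] by (simp add: circlepath_def)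
  then have i1: "((\<lambda>t. f (of_real r * cis t) / (of_real r * cis t) ^ Suc 2 * of_real r * \<i> * cis t) has_integral (pi * \<i> * (deriv ^^ 2) f 0)) {0..2 * pi}"
    using r by (subst (asm) has_contour_integral_part_circlepath_iff) simp_all
  have "f (of_real r * cis t) / (of_real r * cis t) ^ Suc 2 * of_real r * \<i> * cis t = \<i> / of_real (r\<^sup>2) * (f (of_real r * cis t) * cis (- 2 * t))" for t
  proof -
    have "cis (- 2 * t) = 1 / (cis t)\<^sup>2"
    proof -
      have "cis (- 2 * t) * (cis t * cis t) = 1" by (simp add: cis_mult)
      then show ?thesis by (simp add: eq_divide_eq power2_eq_square)
    qed
    then show ?thesis using r0 by (simp only:) (simp add: power2_eq_square power3_eq_cube field_simps)
  qed
  then have i1: "((\<lambda>t. \<i> / of_real (r\<^sup>2) * (f (of_real r * cis t) * cis (- 2 * t))) has_integral (pi * \<i> * (deriv ^^ 2) f 0)) {0..2 * pi}"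
    using i1 by simp
  have i1: "((\<lambda>t. f (of_real r * cis t) * cis (- 2 * t)) has_integral (pi * of_real (r\<^sup>2) * (deriv ^^ 2) f 0)) {0..2 * pi}"
    using has_integral_mult_right[OF i1, of "- \<i> * of_real (r\<^sup>2)"] r0 by (simp add: algebra_simps)
  have "((\<lambda>u. f u * u) has_contour_integral 0) (circlepath 0 r)"
    using f r by (intro Cauchy_theorem_disc_simple[of _ 0 1] holomorphic_intros) auto
  then have "((\<lambda>t. f (of_real r * cis t) * (of_real r * cis t) * of_real r * \<i> * cis t) has_integral 0) {0..2 * pi}"
    unfolding circlepath_def using r by (subst (asm) has_contour_integral_part_circlepath_iff) simp_all
  moreover have "f (of_real r * cis t) * (of_real r * cis t) * of_real r * \<i> * cis t = (\<i> * of_real (r\<^sup>2)) * (f (of_real r * cis t) * cis (2 * t))" for t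
    by (simp add: power2_eq_square cis_mult flip: mult_2)
  ultimately have i2: "((\<lambda>t. (\<i> * of_real (r\<^sup>2)) * (f (of_real r * cis t) * cis (2 * t))) has_integral 0) {0..2 * pi}"
    by simp
  have i2: "((\<lambda>t. f (of_real r * cis t) * cis (2 * t)) has_integral 0) {0..2 * pi}"
    using has_integral_mult_right[OF i2, of "1 / (\<i> * of_real (r\<^sup>2))"] r0 by simp
  have "f (of_real r * cis t) * cis (- 2 * t) + f (of_real r * cis t) * cis (2 * t) = 2 * (f (of_real r * cis t) * of_real (cos (2 * t)))" for t
    by (simp add: complex_eq_iff algebra_simps)
  then have "((\<lambda>t. 2 * (f (of_real r * cis t) * of_real (cos (2 * t)))) has_integral (pi * of_real (r\<^sup>2) * (deriv ^^ 2) f 0)) {0..2 * pi}"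
    using has_integral_add[OF i1 i2] by simp
  from has_integral_mult_right[OF this, of "1/2"] show ?thesis by simp
qed

lemma has_integral_half_period:
  fixes g :: "real \<Rightarrow> real"
  assumes g: "(g has_integral I) {0..2 * pi}" and sym: "\<And>x. g (2 * pi - x) = g x"
  shows "(g has_integral I / 2) {0..pi}"
proof -
  have comb_inv: "g integrable_on {0..pi}"
    by (rule integrable_on_subinterval[OF has_integral_integrable[OF g]]) auto
  then obtain J where J: "(g has_integral J) {0..pi}" by (auto simp: integrable_on_def)
  have "((\<lambda>x. g (2 * pi - x)) has_integral J) {pi..2 * pi}"
    using has_integral_affinity[of g J 0 pi "-1" "2 * pi"] J by (simp add: image_affinity_atLeastAtMost_diff uminus_add_conv_diff)
  then have "(g has_integral J) {pi..2 * pi}" by (simp add: sym)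
  then have "(g has_integral (J + J)) {0..2 * pi}"
    by (intro has_integral_combine[OF _ _ J]) auto
  then have "I = J + J" using g has_integral_unique by blast
  then show ?thesis using J by simp
qed

context comb
begin

lemma L_0: "L 0 = of_real (real q * ln K)"
  using q2 by (simp add: L_def W_def power_0_left)

lemma csqrt_W_nonzero: "cmod \<zeta> < 1 \<Longrightarrow> csqrt (W \<zeta>) \<noteq> 0"
  using W_slit[of \<zeta>] by auto

text \<open>\<open>W\<close> differs from 1 by a term of order 2 q >= 4 in \<zeta>, so the square
  root does not reach the second Taylor coefficient; only the logarithms of the linear factors
  contribute.\<close>

lemma L_second_deriv: "(deriv ^^ 2) L 0 = - of_real (\<Sum>j<q. 2 * cos (2 * \<psi> j))"
proof -
  let ?B = "ball (0::complex) 1"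
  \<comment> \<open>What remains of 1 - W after \<zeta>^4 is taken out; q >= 2 makes 2 q - 4 a
    genuine difference.\<close>
  define R where "R \<zeta> = 4 * \<zeta> ^ (2 * q - 4) / (P \<zeta>)\<^sup>2" for \<zeta>
  \<comment> \<open>Chosen so that \<zeta>^3 H is the derivative of the logarithm of (1 + csqrt W) /
    2.\<close>
  define H where "H \<zeta> = - (4 * R \<zeta> + \<zeta> * deriv R \<zeta>) / (2 * csqrt (W \<zeta>) * (1 + csqrt (W \<zeta>)))" for \<zeta>
  define W1 where "W1 \<zeta> = - (\<zeta> ^ 3 * (4 * R \<zeta> + \<zeta> * deriv R \<zeta>))" for \<zeta>
  define S' where "S' \<zeta> = (\<Sum>j<q. - cis (\<psi> j) / (1 - \<zeta> * cis (\<psi> j)) + - cis (- \<psi> j) / (1 - \<zeta> * cis (- \<psi> j)))" for \<zeta>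
  have "P holomorphic_on ?B" unfolding P_def[abs_def] by (intro holomorphic_intros)
  then have Rh: "R holomorphic_on ?B" unfolding R_def[abs_def]
    by (intro holomorphic_intros) (use P_nonzero in auto)
  have ch: "(\<lambda>\<zeta>. csqrt (W \<zeta>)) holomorphic_on ?B"
    using W_slit by (intro holomorphic_on_compose_gen[OF W_holomorphic holomorphic_on_csqrt, unfolded o_def]) auto
  have one: "1 + csqrt w \<noteq> 0" for w
    using one_plus_csqrt_slit[of w] by auto
  have Hh: "H holomorphic_on ?B"
    unfolding H_def[abs_def] by (intro holomorphic_intros Rh ch) (use one csqrt_W_nonzero in auto)
  have WR: "W = (\<lambda>\<zeta>. 1 - \<zeta> ^ 4 * R \<zeta>)"
  proof
    fix \<zeta> :: complex
    have "\<zeta> ^ 4 * \<zeta> ^ (2 * q - 4) = \<zeta> ^ (2 * q)" using q2 by (simp flip: power_add)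
    then show "W \<zeta> = 1 - \<zeta> ^ 4 * R \<zeta>" by (simp add: W_def R_def)
  qed
  have nz: "1 - \<zeta> * cis t \<noteq> 0" if "cmod \<zeta> < 1" for \<zeta> t
    using that norm_mult[of \<zeta> "cis t"] by auto
  have dL: "(L has_field_derivative (S' \<zeta> + \<zeta> ^ 3 * H \<zeta>)) (at \<zeta>)" if z: "cmod \<zeta> < 1" for \<zeta>
  proof -
    have "(R has_field_derivative deriv R \<zeta>) (at \<zeta>)"
      using Rh z by (intro holomorphic_derivI[of _ ?B]) auto
    then have dW: "(W has_field_derivative (W1 \<zeta>)) (at \<zeta>)"
      unfolding WR W1_def by (auto intro!: derivative_eq_intros simp: algebra_simps power3_eq_cube power4_eq_xxxx)
    have dc: "((\<lambda>\<zeta>. csqrt (W \<zeta>)) has_field_derivative (W1 \<zeta> / (2 * csqrt (W \<zeta>)))) (at \<zeta>)"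
      using DERIV_chain2[OF has_field_derivative_csqrt[OF W_slit[OF z]] dW] by (simp add: inverse_eq_divide)
    have s: "(1 + csqrt (W \<zeta>)) / 2 \<notin> \<real>\<^sub>\<le>\<^sub>0" by (rule one_plus_csqrt_slit)
    have "((\<lambda>\<zeta>. (1 + csqrt (W \<zeta>)) / 2) has_field_derivative (W1 \<zeta> / (2 * csqrt (W \<zeta>)) / 2)) (at \<zeta>)"
      by (rule DERIV_cong[OF DERIV_cdivide[OF DERIV_add[OF DERIV_const dc]]]) simp
    from DERIV_chain2[OF has_field_derivative_Ln[OF s] this]
    have t: "((\<lambda>\<zeta>. Ln ((1 + csqrt (W \<zeta>)) / 2)) has_field_derivative \<zeta> ^ 3 * H \<zeta>) (at \<zeta>)"
    proof (rule DERIV_cong)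
      have alg: "inverse ((1 + s) / 2) * (- (Z * n) / (2 * s) / 2) = Z * (- n / (2 * s * (1 + s)))"
        if "s \<noteq> 0" "1 + s \<noteq> 0" for s n Z :: complex
        using that by (simp add: divide_simps)
      show "inverse ((1 + csqrt (W \<zeta>)) / 2) * (W1 \<zeta> / (2 * csqrt (W \<zeta>)) / 2) = \<zeta> ^ 3 * H \<zeta>"
        unfolding W1_def H_def by (rule alg[OF csqrt_W_nonzero[OF z] one])
    qed
    have l: "((\<lambda>\<zeta>. Ln (1 - \<zeta> * cis u)) has_field_derivative - cis u / (1 - \<zeta> * cis u)) (at \<zeta>)" for u
      using nz[OF z, of u] z by (auto intro!: derivative_eq_intros one_minus_slit simp: norm_mult field_simps)
    have "((\<lambda>\<zeta>. \<Sum>j<q. Ln (1 - \<zeta> * cis (\<psi> j)) + Ln (1 - \<zeta> * cis (- \<psi> j))) has_field_derivative S' \<zeta>) (at \<zeta>)"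
      unfolding S'_def by (intro DERIV_sum DERIV_add l)
    then show ?thesis unfolding L_def[abs_def]
      by (rule DERIV_cong[OF DERIV_add[OF DERIV_add[OF DERIV_const] t]]) simp
  qed
  have dS: "(S' has_field_derivative (\<Sum>j<q. - (cis (\<psi> j))\<^sup>2 + - (cis (- \<psi> j))\<^sup>2)) (at 0)"
  proof -
    have "((\<lambda>\<zeta>. - cis u / (1 - \<zeta> * cis u)) has_field_derivative - (cis u)\<^sup>2) (at 0)" for u
      by (auto intro!: derivative_eq_intros simp: power2_eq_square)
    then show ?thesis unfolding S'_def[abs_def] by (intro DERIV_sum DERIV_add)
  qed
  have "(H has_field_derivative deriv H 0) (at 0)"
    using Hh by (intro holomorphic_derivI[of _ ?B]) auto
  then have "((\<lambda>\<zeta>. S' \<zeta> + \<zeta> ^ 3 * H \<zeta>) has_field_derivative (\<Sum>j<q. - (cis (\<psi> j))\<^sup>2 + - (cis (- \<psi> j))\<^sup>2)) (at 0)"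
    by (auto intro!: derivative_eq_intros dS)
  then have "(deriv L has_field_derivative (\<Sum>j<q. - (cis (\<psi> j))\<^sup>2 + - (cis (- \<psi> j))\<^sup>2)) (at 0)"
    by (rule has_field_derivative_transform_within_open[of _ _ _ ?B]) (use DERIV_imp_deriv[OF dL] in auto)
  then have "(deriv ^^ 2) L 0 = (\<Sum>j<q. - (cis (\<psi> j))\<^sup>2 + - (cis (- \<psi> j))\<^sup>2)"
    by (simp add: DERIV_imp_deriv numeral_2_eq_2)
  also have "\<dots> = (\<Sum>j<q. - of_real (2 * cos (2 * \<psi> j)))"
    by (intro sum.cong refl) (simp add: power2_eq_square cis_mult complex_eq_iff flip: mult_2)
  finally show ?thesis by (simp flip: sum_negf)
qed

text \<open>Maximum principle for exp(-L) on a disc of radius \<rho>: on its boundary Re L = q (v +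
  ln \<rho>) >= q ln \<rho>, a defect that disappears as \<rho> tends to 1.\<close>

lemma L_nonneg:
  assumes "cmod \<zeta> < 1"
  shows "Re (L \<zeta>) \<ge> 0"
proof (rule ccontr)
  assume "\<not> ?thesis"
  then have neg: "Re (L \<zeta>) < 0" by simp
  \<comment> \<open>Large enough for the disc to contain \<zeta> and for q ln \<rho> >= Re L / 2,
    which is incompatible with Re L >= q ln \<rho> when Re L < 0.\<close>
  define \<rho> where "\<rho> = max (cmod \<zeta>) (exp (Re (L \<zeta>) / (2 * real q)))"
  have rho: "0 < \<rho>" "\<rho> < 1" "cmod \<zeta> \<le> \<rho>"
    using assms neg q_pos by (auto simp: \<rho>_def less_max_iff_disj divide_neg_pos)
  have sub: "cball 0 \<rho> \<subseteq> ball (0::complex) 1" using rho by auto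
  have hol: "(\<lambda>w. exp (- L w)) holomorphic_on cball 0 \<rho>"
    by (intro holomorphic_intros holomorphic_on_subset[OF L_holomorphic sub])
  have "cmod (exp (- L \<zeta>)) \<le> exp (- (real q * ln \<rho>))"
  proof (rule maximum_modulus_frontier[of "\<lambda>w. exp (- L w)" "cball 0 \<rho>"])
    fix w :: complex assume "w \<in> frontier (cball 0 \<rho>)"
    then have w: "cmod w = \<rho>" using rho by (simp add: frontier_cball)
    then obtain z where z: "w = exp (\<i> * z)" "cmod w = exp (- Im z)"
      using exp_coordinate[of w] rho by fastforce
    then have y: "Im z = - ln \<rho>" using w by (metis ln_exp minus_minus)
    then have "Im z > 0" using rho by simp
    from Re_L[OF this] have "Re (L w) = real q * (v z + ln \<rho>)" using y z by simp
    then have "Re (L w) \<ge> real q * ln \<rho>" using v_nonneg[of z] by (simp add: mult_left_mono)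
    then show "cmod (exp (- L w)) \<le> exp (- (real q * ln \<rho>))" by simp
  qed (use rho hol in \<open>auto intro: holomorphic_on_imp_continuous_on holomorphic_on_subset\<close>)
  then have "real q * ln \<rho> \<le> Re (L \<zeta>)" by simp
  moreover have "ln (exp (Re (L \<zeta>) / (2 * real q))) \<le> ln \<rho>"
    using rho by (subst ln_le_cancel_iff) (auto simp: \<rho>_def)
  then have "real q * (Re (L \<zeta>) / (2 * real q)) \<le> real q * ln \<rho>"
    using q_pos by (intro mult_left_mono) auto
  ultimately show False using neg q_pos by simp
qed

lemma v_ge_Im: "Im z > 0 \<Longrightarrow> v z \<ge> Im z"
proof -
  assume z: "Im z > 0"
  have "cmod (exp (\<i> * z)) < 1" using z by simp
  then have "real q * (v z - Im z) \<ge> 0" using L_nonneg Re_L[OF z] by metis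
  then show ?thesis using q_pos by (simp add: zero_le_mult_iff)
qed

lemma exp_Complex: "exp (\<i> * Complex x y) = of_real (exp (- y)) * cis x"
  by (simp add: exp_eq_polar)

lemma v_Complex_sym: "v (Complex (2 * pi - x) y) = v (Complex x y)"
proof -
  have "Complex (2 * pi - x) y = 2 * of_real pi - cnj (Complex x y)" by (simp add: complex_eq_iff)
  then show ?thesis using v_reflect by simp
qed

text \<open>The line at height y corresponds to the circle of radius exp(-y), on which Re L = q (v -
  y). The mean of L is L(0), and its second derivative at 0 fixes the cosine coefficient.\<close>

lemma v_mean:
  assumes y: "y > 0"
  shows "((\<lambda>x. v (Complex x y) - y) has_integral pi * ln K) {0..pi}"
    and "((\<lambda>x. (v (Complex x y) - y) * cos (2 * x)) has_integral
      - (pi / (2 * real q)) * exp (- 2 * y) * (\<Sum>j<q. cos (2 * \<psi> j))) {0..pi}"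
proof -
  have r: "0 < exp (- y)" "exp (- y) < 1" using y by auto
  have reL: "Re (L (of_real (exp (- y)) * cis x)) = real q * (v (Complex x y) - y)" for x
    using Re_L[of "Complex x y"] y unfolding exp_Complex by simp
  have "((\<lambda>x. Re (L (of_real (exp (- y)) * cis x))) has_integral Re (2 * of_real pi * L 0)) {0..2 * pi}"
    using has_integral_linear[OF circle_mean[OF L_holomorphic r] bounded_linear_Re] by (simp only: o_def)
  then have "((\<lambda>x. real q * (v (Complex x y) - y)) has_integral 2 * pi * (real q * ln K)) {0..2 * pi}"
    unfolding reL L_0 by simp
  from has_integral_mult_right[OF this, of "1 / real q"]
  have "((\<lambda>x. v (Complex x y) - y) has_integral 2 * (pi * ln K)) {0..2 * pi}"
    using q_pos by simp
  from has_integral_half_period[OF this] show "((\<lambda>x. v (Complex x y) - y) has_integral pi * ln K) {0..pi}"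
    by (simp add: v_Complex_sym)
  define S where "S = (\<Sum>j<q. cos (2 * \<psi> j))"
  have S: "(deriv ^^ 2) L 0 = of_real (- 2 * S)"
    unfolding L_second_deriv S_def by (simp add: sum_distrib_left sum_negf)
  have e2: "(exp (- y))\<^sup>2 = exp (- 2 * y)" by (simp flip: exp_of_nat_mult)
  have "((\<lambda>x. Re (L (of_real (exp (- y)) * cis x) * of_real (cos (2 * x)))) has_integral
      Re (of_real pi / 2 * of_real ((exp (- y))\<^sup>2) * (deriv ^^ 2) L 0)) {0..2 * pi}"
    using has_integral_linear[OF circle_cos_coefficient[OF L_holomorphic r] bounded_linear_Re] by (simp only: o_def)
  then have "((\<lambda>x. real q * (v (Complex x y) - y) * cos (2 * x)) has_integral
      - pi * exp (- 2 * y) * S) {0..2 * pi}"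
    unfolding S e2 using reL by (simp add: mult.assoc)
  from has_integral_mult_right[OF this, of "1 / real q"]
  have "((\<lambda>x. (v (Complex x y) - y) * cos (2 * x)) has_integral - (pi / real q * exp (- 2 * y) * S)) {0..2 * pi}"
    using q_pos by (simp add: mult.assoc)
  from has_integral_half_period[OF this]
  show "((\<lambda>x. (v (Complex x y) - y) * cos (2 * x)) has_integral - (pi / (2 * real q)) * exp (- 2 * y) * (\<Sum>j<q. cos (2 * \<psi> j))) {0..pi}"
    unfolding S_def[symmetric] by (simp add: v_Complex_sym right_diff_distrib cos_diff mult.commute[of "real q" 2])
qed

lemma continuous_on_v_Complex: "continuous_on S (\<lambda>p. v (Complex (snd p) (fst p)))"
  by (intro continuous_on_compose2[OF continuous_on_v[of UNIV]] continuous_intros) auto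

text \<open>The identity above the real line passes to the real line by continuity: the integral is
  constant for 0 < y < 1 and continuous at y = 0.\<close>

lemma v_integral: "((\<lambda>x. v (of_real x)) has_integral pi * ln K) {0..pi}"
proof -
  define J where "J y = integral (cbox 0 pi) (\<lambda>x. v (Complex x y) - y)" for y
  have "continuous_on {0..1} J" unfolding J_def
  proof (rule integral_continuous_on_param)
    show "continuous_on ({0..1} \<times> cbox 0 pi) (\<lambda>(y, x). v (Complex x y) - y)"
      unfolding case_prod_beta' by (intro continuous_on_diff continuous_on_v_Complex continuous_intros)
  qed
  moreover have "J y = pi * ln K" if "y \<in> {0<..<1}" for y
    using v_mean(1)[of y] that unfolding J_def by (simp add: integral_unique)
  ultimately have "J 0 = pi * ln K"
    using continuous_constant_on_closure[of "{0<..<1}" J _ 0] by simp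
  moreover have e: "Complex x 0 = of_real x" for x by (simp add: complex_eq_iff)
  have "(\<lambda>x. v (of_real x)) integrable_on {0..pi}"
    by (intro integrable_continuous_real continuous_on_compose2[OF continuous_on_v[of UNIV]] continuous_intros) auto
  ultimately show ?thesis by (simp add: has_integral_integrable_integral J_def e)
qed

lemma v_cos_integral:
  "((\<lambda>x. v (of_real x) * cos (2 * x)) has_integral - (pi / (2 * real q)) * (\<Sum>j<q. cos (2 * \<psi> j))) {0..pi}"
proof -
  define c where "c = - (pi / (2 * real q)) * (\<Sum>j<q. cos (2 * \<psi> j))"
  \<comment> \<open>Subtracting the known value makes the expression zero for all y > 0, so the
    continuity argument also works with the factor exp(-2y).\<close>
  define J where "J y = integral (cbox 0 pi) (\<lambda>x. (v (Complex x y) - y) * cos (2 * x)) - exp (- 2 * y) * c" for y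
  have "continuous_on {0..1} (\<lambda>y. integral (cbox 0 pi) (\<lambda>x. (v (Complex x y) - y) * cos (2 * x)))"
  proof (rule integral_continuous_on_param)
    show "continuous_on ({0..1} \<times> cbox 0 pi) (\<lambda>(y, x). (v (Complex x y) - y) * cos (2 * x))"
      unfolding case_prod_beta'
      by (intro continuous_on_mult continuous_on_diff continuous_on_v_Complex continuous_intros)
  qed
  then have "continuous_on {0..1} J" unfolding J_def[abs_def] by (intro continuous_intros)
  moreover have "J y = 0" if "y \<in> {0<..<1}" for y
    using v_mean(2)[of y] that unfolding J_def c_def by (simp add: integral_unique)
  ultimately have "J 0 = 0"
    using continuous_constant_on_closure[of "{0<..<1}" J _ 0] by simp
  moreover have e: "Complex x 0 = of_real x" for x by (simp add: complex_eq_iff)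
  have "(\<lambda>x. v (of_real x) * cos (2 * x)) integrable_on {0..pi}"
    by (intro integrable_continuous_real continuous_intros continuous_on_compose2[OF continuous_on_v[of UNIV]]) auto
  ultimately show ?thesis unfolding c_def[symmetric] by (simp add: has_integral_integrable_integral J_def e)
qed

end

section \<open>Lower bound on a gap\<close>

text \<open>The boundary bound is imposed on a continuous extension g of the modulus, because f
  itself may jump across slits. If g has its maximum inside, f has constant modulus and the same
  value is found on the boundary.\<close>

lemma max_norm_principle:
  assumes f: "f holomorphic_on U" and U: "open U" "connected U" "bounded U"
    and g: "continuous_on (closure U) g" "\<And>z. z \<in> U \<Longrightarrow> g z = norm (f z)"
    and B: "\<And>z. z \<in> frontier U \<Longrightarrow> g z \<le> (B::real)" and z: "z \<in> U"
  shows "g z \<le> B"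
proof -
  have "compact (closure U)" "closure U \<noteq> {}" using U z by auto
  then obtain \<xi> where \<xi>: "\<xi> \<in> closure U" "\<And>w. w \<in> closure U \<Longrightarrow> g w \<le> g \<xi>"
    using continuous_attains_sup[OF _ _ g(1)] by blast
  have sub: "U \<subseteq> closure U" by (rule closure_subset)
  have "g \<xi> \<le> B"
  proof (cases "\<xi> \<in> U")
    case False
    then have "\<xi> \<in> frontier U" using \<xi>(1) U(1) by (simp add: frontier_def interior_open)
    then show ?thesis by (rule B)
  next
    case True
    have "f constant_on U"
      by (rule maximum_modulus_principle[OF f U(1,2) U(1) order.refl True]) (use \<xi>(2) sub g(2) True in \<open>metis subsetD\<close>)
    then have c: "\<And>w. w \<in> U \<Longrightarrow> g w = g \<xi>" using g(2) True by (metis constant_on_def)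
    have "U \<noteq> UNIV" using U(3) not_bounded_UNIV by auto
    then have "frontier U \<noteq> {}" using z by (simp add: frontier_eq_empty) auto
    then obtain w where w: "w \<in> frontier U" by auto
    then have "w \<in> closure U" by (simp add: frontier_def)
    then have "g w = g \<xi>" using continuous_constant_on_closure[OF g(1) c] by blast
    then show ?thesis using B[OF w] by simp
  qed
  then show ?thesis using \<xi>(2)[of z] z sub by fastforce
qed

text \<open>The area of half a disc of diameter b - a. The summands of the explicit antiderivative
  are not differentiable at the end points, hence the fundamental theorem with derivatives in the
  interior only.\<close>

lemma has_integral_semicircle:
  fixes a b :: real
  assumes "a \<le> b"
  shows "((\<lambda>x. sqrt ((x - a) * (b - x))) has_integral pi * (b - a)\<^sup>2 / 8) {a..b}"
proof (cases "a = b")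
  case False
  define m \<rho> where "m = (a + b) / 2" and "\<rho> = (b - a) / 2"
  have \<rho>: "\<rho> > 0" using assms False by (simp add: \<rho>_def)
  define F where "F x = ((x - m) * sqrt (\<rho>\<^sup>2 - (x - m)\<^sup>2) + \<rho>\<^sup>2 * arcsin ((x - m) / \<rho>)) / 2" for x
  have e: "(x - a) * (b - x) = \<rho>\<^sup>2 - (x - m)\<^sup>2" for x
    by (simp add: m_def \<rho>_def power2_eq_square field_simps)
  have "((\<lambda>x. sqrt (\<rho>\<^sup>2 - (x - m)\<^sup>2)) has_integral F b - F a) {a..b}"
  proof (rule fundamental_theorem_of_calculus_interior[OF assms])
    have "-1 \<le> (x - m) / \<rho>" "(x - m) / \<rho> \<le> 1" if "x \<in> {a..b}" for x
      using that \<rho> by (auto simp: m_def \<rho>_def field_simps)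
    then have arc: "continuous_on {a..b} (\<lambda>x. arcsin ((x - m) / \<rho>))"
      using \<rho> by (intro continuous_on_arcsin continuous_intros) auto
    then show "continuous_on {a..b} F" unfolding F_def
      by (intro continuous_on_divide[OF continuous_on_add[OF _ continuous_on_mult[OF continuous_on_const arc]]]
        continuous_intros) auto
    fix x assume x: "x \<in> {a<..<b}"
    define s where "s = sqrt (\<rho>\<^sup>2 - (x - m)\<^sup>2)"
    have p: "\<rho>\<^sup>2 - (x - m)\<^sup>2 > 0" using x unfolding e[symmetric] by simp
    then have s: "s > 0" "s\<^sup>2 = \<rho>\<^sup>2 - (x - m)\<^sup>2" by (auto simp: s_def)
    have u: "-1 < (x - m) / \<rho>" "(x - m) / \<rho> < 1"
      using x \<rho> by (auto simp: m_def \<rho>_def field_simps)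
    have su: "sqrt (1 - ((x - m) / \<rho>)\<^sup>2) = s / \<rho>"
    proof -
      have "1 - ((x - m) / \<rho>)\<^sup>2 = (s / \<rho>)\<^sup>2" unfolding power_divide s(2) using \<rho> by (simp add: diff_divide_distrib)
      then show ?thesis using s \<rho> by simp
    qed
    have d1: "((\<lambda>x. sqrt (\<rho>\<^sup>2 - (x - m)\<^sup>2)) has_real_derivative - (x - m) / s) (at x)"
      using p by (auto intro!: derivative_eq_intros simp: s_def field_simps)
    have d2: "((\<lambda>x. arcsin ((x - m) / \<rho>)) has_real_derivative 1 / s) (at x)"
    proof -
      have "((\<lambda>x. (x - m) / \<rho>) has_real_derivative 1 / \<rho>) (at x)"
        using \<rho> by (auto intro!: derivative_eq_intros)
      from DERIV_chain2[OF DERIV_arcsin[OF u] this] show ?thesis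
        unfolding su using \<rho> s by (simp add: inverse_eq_divide)
    qed
    have "(F has_real_derivative ((x - m) * (- (x - m) / s) + s + \<rho>\<^sup>2 * (1 / s)) / 2) (at x)"
    proof -
      have "((\<lambda>x. x - m) has_real_derivative 1) (at x)" by (auto intro!: derivative_eq_intros)
      from DERIV_cdivide[OF DERIV_add[OF DERIV_mult[OF this d1] DERIV_cmult[OF d2, of "\<rho>\<^sup>2"]], of 2]
      show ?thesis unfolding F_def by (rule DERIV_cong) (simp add: s_def)
    qed
    also have "((x - m) * (- (x - m) / s) + s + \<rho>\<^sup>2 * (1 / s)) / 2 = s"
    proof -
      have "d * (- d / s) + s + \<rho>\<^sup>2 * (1 / s) = (\<rho>\<^sup>2 - d\<^sup>2) / s + s" for d
        by (simp add: power2_eq_square diff_divide_distrib)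
      then have "(x - m) * (- (x - m) / s) + s + \<rho>\<^sup>2 * (1 / s) = (\<rho>\<^sup>2 - (x - m)\<^sup>2) / s + s" .
      also have "\<dots> = 2 * s" unfolding s(2)[symmetric] using s(1) by (simp add: power2_eq_square)
      finally show ?thesis by simp
    qed
    finally show "(F has_vector_derivative sqrt (\<rho>\<^sup>2 - (x - m)\<^sup>2)) (at x)"
      by (simp add: has_real_derivative_iff_has_vector_derivative s_def)
  qed
  moreover have "F b = \<rho>\<^sup>2 * (pi / 2) / 2" "F a = - \<rho>\<^sup>2 * (pi / 2) / 2"
  proof -
    have "b - m = \<rho>" "a - m = - \<rho>" by (simp_all add: m_def \<rho>_def field_simps)
    then show "F b = \<rho>\<^sup>2 * (pi / 2) / 2" "F a = - \<rho>\<^sup>2 * (pi / 2) / 2" using \<rho> by (simp_all add: F_def)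
  qed
  moreover have "pi * (b - a)\<^sup>2 / 8 = \<rho>\<^sup>2 * (pi / 2)" by (simp add: \<rho>_def power2_eq_square)
  ultimately show ?thesis by (simp add: e)
qed (auto intro: has_integral_refl)

context comb
begin

lemma v_ge_abs_Im: "v z \<ge> \<bar>Im z\<bar>"
proof -
  have "- cnj z + 2 * of_real pi = 2 * of_real pi - cnj z" by simp
  then have "v (- cnj z) = v z" using v_reflect[of z] v_periodic[of "- cnj z"] by metis
  then have c: "v (cnj z) = v z" by (simp add: v_def M_def Dz_minus_arg)
  show ?thesis using v_ge_Im[of z] v_ge_Im[of "cnj z"] v_nonneg[of z]
    by (cases "Im z" "0::real" rule: linorder_cases) (auto simp: c)
qed

text \<open>Comparison of \<open>v\<close> with the imaginary part of \<open>sqrt ((z - \<alpha>) (z - \<beta>))\<close>, which is the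
  analogue of \<open>v\<close> for the plane slit along the real line outside the single gap.\<close>
lemma v_gap_lower:
  assumes n: "1 \<le> n" "n < q" and x: "\<alpha> n < x" "x < \<beta> n"
  shows "v (of_real x) > sqrt ((x - \<alpha> n) * (\<beta> n - x))"
proof -
  define m \<rho> where "m = (\<alpha> n + \<beta> n) / 2" and "\<rho> = (\<beta> n - \<alpha> n) / 2"
 have mm: "2 * m = \<alpha> n + \<beta> n" "2 * \<rho> = \<beta> n - \<alpha> n" by (simp_all add: m_def \<rho>_def)
  have rho: "0 < \<rho>" "\<rho> < pi" using x edge_bounds[OF n] by (auto simp: \<rho>_def)
  \<comment> \<open>This is (z - \<alpha>)(\<beta> - z), written about the midpoint of the gap; the
    real part of its root is the modulus of the imaginary part of the root of (z - \<alpha>)(z -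
    \<beta>).\<close>
  define w where "w z = of_real (\<rho>\<^sup>2) - (z - of_real m)\<^sup>2" for z :: complex
  define s where "s z = sqrt ((cmod (w z) + Re (w z)) / 2)" for z
  have sS: "Re (csqrt (w z)) = s z" for z by (simp add: s_def)
  have s_cont: "continuous_on A s" for A
    unfolding s_def w_def by (intro continuous_intros) auto
  define U where "U = {z. Im z = 0 \<longrightarrow> \<alpha> n < Re z \<and> Re z < \<beta> n}"
  have U_compl: "- U = {z. Im z = 0} \<inter> ({z. Re z \<le> \<alpha> n} \<union> {z. Re z \<ge> \<beta> n})"
    by (auto simp: U_def)
  have "closed (- U)" unfolding U_compl
    by (intro closed_Int closed_Un closed_halfspace_Re_le closed_halfspace_Re_ge)
       (simp add: closed_Collect_eq continuous_on_Im)
  then have U_open: "open U" by (simp add: closed_def)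
  have m: "\<alpha> n < m" "m < \<beta> n" using x by (auto simp: m_def)
  have seg: "closed_segment (of_real m) z \<subseteq> U" if z: "z \<in> U" for z
  proof
    fix y assume "y \<in> closed_segment (of_real m) z"
    then obtain u where u: "0 \<le> u" "u \<le> 1" "y = (1 - u) *\<^sub>R of_real m + u *\<^sub>R z"
      by (auto simp: closed_segment_def)
    show "y \<in> U"
    proof (cases "u = 0 \<or> Im z \<noteq> 0")
      case True
      then show ?thesis using m u by (auto simp: U_def)
    next
      case False
      then have zz: "\<alpha> n < Re z" "Re z < \<beta> n" using z by (auto simp: U_def)
      have "Re y = (1 - u) * m + u * Re z" using u(3) by simp
      moreover have "(1 - u) * \<alpha> n + u * \<alpha> n < (1 - u) * m + u * Re z"
        using zz m u False by (intro add_le_less_mono mult_left_mono mult_strict_left_mono) auto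
      moreover have "(1 - u) * m + u * Re z < (1 - u) * \<beta> n + u * \<beta> n"
        using zz m u False by (intro add_le_less_mono mult_left_mono mult_strict_left_mono) auto
      ultimately show ?thesis by (auto simp: U_def algebra_simps)
    qed
  qed
  have slit: "w z \<notin> \<real>\<^sub>\<le>\<^sub>0" if z: "z \<in> U" for z
  proof
    assume "w z \<in> \<real>\<^sub>\<le>\<^sub>0"
    then have i: "Im (w z) = 0" "Re (w z) \<le> 0" by (auto simp: complex_nonpos_Reals_iff)
    have i1: "(Re z - m) * Im z = 0" using i(1) by (auto simp: w_def power2_eq_square)
    have i2: "\<rho>\<^sup>2 + (Im z)\<^sup>2 \<le> (Re z - m)\<^sup>2" using i(2) by (simp add: w_def power2_eq_square)
    have "\<rho>\<^sup>2 > 0" using rho by simp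
    then have "Re z - m \<noteq> 0" using i2 by (auto simp: sum_power2_le_zero_iff)
    then have "Im z = 0" using i1 by simp
    then have r: "\<alpha> n < Re z" "Re z < \<beta> n" using z by (auto simp: U_def)
    have "\<bar>\<rho>\<bar> \<le> \<bar>Re z - m\<bar>" using i2 \<open>Im z = 0\<close> by (simp add: abs_le_square_iff)
    then show False using r rho mm by linarith
  qed
  have D2: "\<bar>t\<bar> > 2" if "z \<in> U" "Dz z = of_real t" for z t
  proof (cases "Im z" "0::real" rule: linorder_cases)
    case less
    have "Dz (cnj z) = of_real t" using that(2) by (simp add: Dz_cnj)
    then show ?thesis using Dz_level[of "cnj z" t] less by simp
  next
    case equal
    then have "z = of_real (Re z)" by (simp add: complex_eq_iff)
    then show ?thesis using gap[OF n, of "Re z"] that equal by (auto simp: U_def)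
  next
    case greater
    then show ?thesis using Dz_level that by blast
  qed
  then have D0: "Dz z \<noteq> 0" if "z \<in> U" for z using that by force
  \<comment> \<open>Its modulus is exp(q (t s - v)), so the maximum principle compares t s with v;
    taking t < 1 makes room on large circles.\<close>
  define \<Phi> where "\<Phi> t z = exp (of_real (real q * t) * csqrt (w z)) / joukowski_inv (Dz z)" for t z
  have j0: "joukowski_inv (Dz z) \<noteq> 0" if "z \<in> U" for z
    using norm_joukowski_inv_Dz[OF D0[OF that]] by (metis exp_not_eq_zero norm_zero)
  have jh: "(\<lambda>z. joukowski_inv (Dz z)) holomorphic_on U"
    by (rule joukowski_inv_holomorphic[OF Dz_holomorphic]) (use D2 in auto)
  have ch: "(\<lambda>z. csqrt (w z)) holomorphic_on U"
    unfolding w_def by (intro holomorphic_intros) (use slit in \<open>auto simp: w_def\<close>)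
  have \<Phi>h: "\<Phi> t holomorphic_on U" for t
    unfolding \<Phi>_def by (intro holomorphic_intros jh ch) (use j0 in auto)
  have \<Phi>n: "cmod (\<Phi> t z) = exp (real q * (t * s z - v z))" if "z \<in> U" for t z
    unfolding \<Phi>_def norm_divide norm_joukowski_inv_Dz[OF D0[OF that]] norm_exp_eq_Re
    by (simp add: sS right_diff_distrib exp_diff mult.assoc del: csqrt.simps)
  have s_cut: "s z = 0" if "z \<notin> U" for z
  proof -
    have i: "Im z = 0" "Re z \<le> \<alpha> n \<or> \<beta> n \<le> Re z" using that by (auto simp: U_def)
    then have "\<bar>\<rho>\<bar> \<le> \<bar>Re z - m\<bar>" using rho mm by linarith
    then have "\<rho>\<^sup>2 \<le> (Re z - m)\<^sup>2" by (simp add: abs_le_square_iff)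
    moreover have "w z = of_real (\<rho>\<^sup>2 - (Re z - m)\<^sup>2)"
      using i by (simp add: w_def complex_eq_iff power2_eq_square)
    ultimately show ?thesis unfolding s_def by (simp only: norm_of_real Re_complex_of_real) simp
  qed
  \<comment> \<open>Far away s is almost |Im z|: on the circle of radius R it exceeds it at most by
    a factor that tends to 1, and |Im z| <= v is already known.\<close>
  have s_sphere: "s z \<le> (1 + \<rho>\<^sup>2 / (R\<^sup>2 - \<rho>\<^sup>2)) * \<bar>Im z\<bar>" if z: "cmod (z - of_real m) = R" and R: "R > \<rho>" for z R
  proof -
    define \<eta> where "\<eta> = \<rho>\<^sup>2 / (R\<^sup>2 - \<rho>\<^sup>2)"
    have R2: "R\<^sup>2 > \<rho>\<^sup>2" using R rho by (intro power_strict_mono) auto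
    then have eta: "\<eta> * (R\<^sup>2 - \<rho>\<^sup>2) = \<rho>\<^sup>2" "\<eta> \<ge> 0" by (auto simp: \<eta>_def)
    define Z where "Z = (z - of_real m)\<^sup>2"
    define t where "t = Re Z"
    have N: "cmod Z = R\<^sup>2" using z by (simp add: Z_def norm_power)
    have y: "R\<^sup>2 - t = 2 * (Im z)\<^sup>2"
      unfolding z[symmetric] t_def Z_def by (simp add: cmod_power2) (simp add: power2_eq_square)
    then have tR: "R\<^sup>2 - t \<ge> 0" by simp
    have Z2: "(Re Z)\<^sup>2 + (Im Z)\<^sup>2 = (R\<^sup>2)\<^sup>2" using N by (metis cmod_power2)
    have "(cmod (w z))\<^sup>2 = (\<rho>\<^sup>2 - t)\<^sup>2 + (Im Z)\<^sup>2"
      unfolding w_def Z_def[symmetric] by (simp add: cmod_power2 t_def)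
    also have "\<dots> = (\<rho>\<^sup>2)\<^sup>2 - 2 * \<rho>\<^sup>2 * t + ((Re Z)\<^sup>2 + (Im Z)\<^sup>2)"
      by (simp add: power2_diff t_def)
    also have "\<dots> = (R\<^sup>2)\<^sup>2 - 2 * \<rho>\<^sup>2 * t + (\<rho>\<^sup>2)\<^sup>2"
      unfolding Z2 by simp
    also have "\<dots> = (R\<^sup>2 - \<rho>\<^sup>2)\<^sup>2 + 2 * \<rho>\<^sup>2 * (R\<^sup>2 - t)" by (simp add: power2_eq_square algebra_simps)
    also have "\<dots> = (R\<^sup>2 - \<rho>\<^sup>2)\<^sup>2 + 2 * (\<eta> * (R\<^sup>2 - \<rho>\<^sup>2)) * (R\<^sup>2 - t)" by (simp add: eta(1))
    also have "\<dots> \<le> (R\<^sup>2 - \<rho>\<^sup>2 + \<eta> * (R\<^sup>2 - t))\<^sup>2"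
    proof -
      have "G\<^sup>2 + 2 * (\<eta> * G) * T \<le> (G + \<eta> * T)\<^sup>2" for G T
        using zero_le_power2[of "\<eta> * T"] by (simp add: power2_sum)
      then show ?thesis .
    qed
    finally have "cmod (w z) \<le> R\<^sup>2 - \<rho>\<^sup>2 + \<eta> * (R\<^sup>2 - t)"
      by (rule power2_le_imp_le) (use R2 eta tR in \<open>auto intro!: add_nonneg_nonneg\<close>)
    then have "(cmod (w z) + Re (w z)) / 2 \<le> (1 + \<eta>) * (Im z)\<^sup>2"
      using y by (simp add: w_def Z_def[symmetric] t_def[symmetric] algebra_simps)
    also have "\<dots> \<le> ((1 + \<eta>) * \<bar>Im z\<bar>)\<^sup>2"
    proof -
      have "1 + \<eta> \<le> (1 + \<eta>)\<^sup>2" using eta(2) self_le_power[of "1 + \<eta>" 2] by simp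
      from mult_right_mono[OF this zero_le_power2[of "Im z"]] show ?thesis
        by (simp only: power_mult_distrib power2_abs)
    qed
    finally have "s z \<le> sqrt (((1 + \<eta>) * \<bar>Im z\<bar>)\<^sup>2)" unfolding s_def by (rule real_sqrt_le_mono)
    then show ?thesis using eta(2) by (simp add: \<eta>_def[symmetric])
  qed
  have le_R: "s z \<le> (1 + \<rho>\<^sup>2 / (R\<^sup>2 - \<rho>\<^sup>2)) * v z" if z: "z \<in> U" and R: "R > \<rho>" "R > cmod (z - of_real m)" for z R
  proof -
    define \<eta> where "\<eta> = \<rho>\<^sup>2 / (R\<^sup>2 - \<rho>\<^sup>2)"
    have "R\<^sup>2 > \<rho>\<^sup>2" using R rho by (intro power_strict_mono) auto
    then have eta: "\<eta> \<ge> 0" by (auto simp: \<eta>_def)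
    \<comment> \<open>The ball makes the domain bounded; the intersection is still star-shaped about
      the midpoint m, hence connected.\<close>
    define V where "V = U \<inter> ball (of_real m) R"
    have seg': "closed_segment (of_real m) y \<subseteq> V" if "y \<in> V" for y
    proof -
      have "closed_segment (of_real m) y \<subseteq> U" using that by (intro seg) (simp add: V_def)
      moreover have "closed_segment (of_real m) y \<subseteq> ball (of_real m) R"
        by (rule closed_segment_subset) (use that R(1) rho in \<open>auto simp: V_def\<close>)
      ultimately show ?thesis unfolding V_def by blast
    qed
    have "of_real m \<in> V" using m R(1) rho by (auto simp: V_def U_def)
    then have "starlike V" unfolding starlike_def using seg' by blast
    then have conn: "connected V" by (rule starlike_imp_connected)
    have "exp (real q * (1 / (1 + \<eta>) * s z - v z)) \<le> 1"
    proof (rule max_norm_principle[where f = "\<Phi> (1 / (1 + \<eta>))" and U = V])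
      show "\<Phi> (1 / (1 + \<eta>)) holomorphic_on V" by (rule holomorphic_on_subset[OF \<Phi>h]) (auto simp: V_def)
      show "open V" "bounded V" unfolding V_def using U_open by auto
      show "continuous_on (closure V) (\<lambda>z. exp (real q * (1 / (1 + \<eta>) * s z - v z)))"
        by (intro continuous_intros s_cont continuous_on_v)
      show "exp (real q * (1 / (1 + \<eta>) * s z - v z)) = cmod (\<Phi> (1 / (1 + \<eta>)) z)" if "z \<in> V" for z
        using that by (subst \<Phi>n) (auto simp: V_def)
      show "z \<in> V" using z R by (auto simp: V_def dist_norm norm_minus_commute)
      fix y assume y: "y \<in> frontier V"
      have "V \<subseteq> cball (of_real m) R" by (auto simp: V_def)
      then have yc: "cmod (y - of_real m) \<le> R" using y closure_minimal[of V "cball (of_real m) R"]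
        by (auto simp: frontier_def dist_norm norm_minus_commute)
      have "y \<notin> V" using y \<open>open V\<close> by (simp add: frontier_def interior_open)
      then have "y \<notin> U \<or> cmod (y - of_real m) = R" using yc by (auto simp: V_def dist_norm norm_minus_commute)
      then have "s y \<le> (1 + \<eta>) * v y"
      proof
        assume "y \<notin> U"
        then show ?thesis using s_cut v_nonneg[of y] eta by simp
      next
        assume "cmod (y - of_real m) = R"
        from s_sphere[OF this R(1)] have "s y \<le> (1 + \<eta>) * \<bar>Im y\<bar>" by (simp add: \<eta>_def)
        also have "\<dots> \<le> (1 + \<eta>) * v y" using v_ge_abs_Im eta by (intro mult_left_mono) auto
        finally show ?thesis .
      qed
      then have "1 / (1 + \<eta>) * s y - v y \<le> 0" using eta by (simp add: field_simps)
      then show "exp (real q * (1 / (1 + \<eta>) * s y - v y)) \<le> 1"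
        using q_pos by (simp add: mult_le_0_iff)
    qed (fact conn)
    then have "1 / (1 + \<eta>) * s z - v z \<le> 0" using q_pos by (simp add: mult_le_0_iff)
    then show ?thesis using eta by (simp add: field_simps \<eta>_def)
  qed
  have le: "s z \<le> v z" if z: "z \<in> U" for z
  proof (rule tendsto_le[of at_top])
    have "((\<lambda>R::real. \<rho>\<^sup>2 / (R\<^sup>2 - \<rho>\<^sup>2)) \<longlongrightarrow> 0) at_top"
      by (rule tendsto_divide_0[OF tendsto_const])
         (intro filterlim_at_top_imp_at_infinity filterlim_tendsto_add_at_top[OF tendsto_const, of _ _ "- \<rho>\<^sup>2", simplified]
           filterlim_pow_at_top filterlim_ident, simp)
    from tendsto_mult_right[OF tendsto_add[OF tendsto_const[of 1] this], of "v z"]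
    show "((\<lambda>R. (1 + \<rho>\<^sup>2 / (R\<^sup>2 - \<rho>\<^sup>2)) * v z) \<longlongrightarrow> v z) at_top"
      by simp
    show "\<forall>\<^sub>F R in at_top. s z \<le> (1 + \<rho>\<^sup>2 / (R\<^sup>2 - \<rho>\<^sup>2)) * v z"
      using eventually_gt_at_top[of "max \<rho> (cmod (z - of_real m))"]
      by eventually_elim (use le_R[OF z] in auto)
  qed auto
  have xU: "of_real x \<in> U" using x by (simp add: U_def)
  \<comment> \<open>Equality would spread over U by the strong maximum principle. It is refuted one
    period further, at m + 2 pi, where s vanishes but v does not.\<close>
  have "s (of_real x) \<noteq> v (of_real x)"
  proof
    assume eq: "s (of_real x) = v (of_real x)"
    have "of_real m \<in> U" using m by (auto simp: U_def)
    then have "starlike U" unfolding starlike_def using seg by blast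
    then have conn: "connected U" by (rule starlike_imp_connected)
    have "\<Phi> 1 constant_on U"
    proof (rule maximum_modulus_principle[OF \<Phi>h U_open conn U_open order.refl xU])
      fix z assume "z \<in> U"
      then show "cmod (\<Phi> 1 z) \<le> cmod (\<Phi> 1 (of_real x))"
        using le[of z] q_pos \<Phi>n[OF xU, of 1] \<Phi>n[of z 1] eq by (simp add: mult_le_0_iff)
    qed
    then have "cmod (\<Phi> 1 z) = cmod (\<Phi> 1 (of_real x))" if "z \<in> U" for z
      using that xU by (metis constant_on_def)
    then have sv: "s z - v z = 0" if "z \<in> U" for z
      using that \<Phi>n[OF xU, of 1] \<Phi>n[of z 1] eq q_pos by simp
    define p where "p = of_real m + 2 * complex_of_real pi"
    have "p \<in> closure U"
    proof -
      have "(\<lambda>k. p + \<i> * of_real (1 / real (Suc k))) \<longlonglongrightarrow> p + \<i> * of_real 0"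
        by (intro tendsto_intros LIMSEQ_Suc lim_1_over_n)
      moreover have "p + \<i> * of_real (1 / real (Suc k)) \<in> U" for k by (simp add: U_def p_def)
      ultimately show ?thesis unfolding closure_sequential
        by (intro exI[of _ "\<lambda>k. p + \<i> * of_real (1 / real (Suc k))"]) simp
    qed
    moreover have "continuous_on (closure U) (\<lambda>z. s z - v z)"
      by (intro continuous_intros s_cont continuous_on_v)
    ultimately have "s p - v p = 0" using continuous_constant_on_closure[of U "\<lambda>z. s z - v z", OF _ sv] by blast
    moreover have "p \<notin> U" using edge_bounds[OF n] x m by (auto simp: U_def p_def)
    then have "s p = 0" by (rule s_cut)
    ultimately have "v p = 0" by simp
    then have "v (of_real m) = 0" unfolding p_def by simp
    then show False using v_gap_pos[OF n m] by simp
  qed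
  then have "s (of_real x) < v (of_real x)" using le[OF xU] by simp
  moreover have "s (of_real x) = sqrt ((x - \<alpha> n) * (\<beta> n - x))"
  proof -
    have "(x - \<alpha> n) * (\<beta> n - x) = \<rho>\<^sup>2 - (x - m)\<^sup>2"
      by (simp add: m_def \<rho>_def power2_eq_square field_simps)
    moreover have "w (of_real x) = of_real (\<rho>\<^sup>2 - (x - m)\<^sup>2)" by (simp add: w_def)
    moreover have "(x - \<alpha> n) * (\<beta> n - x) > 0" using x by simp
    ultimately show ?thesis unfolding s_def by (simp only: norm_of_real Re_complex_of_real) simp
  qed
  ultimately show ?thesis by simp
qed

end

section \<open>The comb map\<close>

lemma joukowski_inv_plus_inverse:
  assumes "w \<noteq> 0"
  shows "joukowski_inv w \<noteq> 0" "joukowski_inv w + 1 / joukowski_inv w = w"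
proof -
  define s where "s = csqrt (1 - 4 / w\<^sup>2)"
  have s2: "s\<^sup>2 = 1 - 4 / w\<^sup>2" by (simp add: s_def)
  have "w\<^sup>2 * (1 - s\<^sup>2) = 4" unfolding s2 using assms by (simp add: field_simps)
  then have p: "joukowski_inv w * (w * (1 - s) / 2) = 1"
    unfolding joukowski_inv_def s_def[symmetric] by (simp add: power2_eq_square algebra_simps)
  then show "joukowski_inv w \<noteq> 0" by auto
  then have "1 / joukowski_inv w = w * (1 - s) / 2" using p by (simp add: field_simps)
  then show "joukowski_inv w + 1 / joukowski_inv w = w" unfolding joukowski_inv_def s_def[symmetric] by (simp add: field_simps)
qed

text \<open>1 - cis a = 2 sin(a/2) exp(i (a - pi)/2), whose argument stays within (-pi/2,
  pi/2).\<close>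

lemma Im_Ln_one_minus_cis:
  assumes "0 < a" "a < 2 * pi"
  shows "1 - cis a \<notin> \<real>\<^sub>\<le>\<^sub>0" "Im (Ln (1 - cis a)) = (a - pi) / 2"
proof -
  have s: "sin (a / 2) > 0" using assms by (intro sin_gt_zero) auto
  have ca: "cos a = 1 - 2 * (sin (a / 2))\<^sup>2" and sa: "sin a = 2 * sin (a / 2) * cos (a / 2)"
    using cos_double_sin[of "a / 2"] sin_double[of "a / 2"] by simp_all
  then have e: "1 - cis a = of_real (2 * sin (a / 2)) * exp (\<i> * of_real ((a - pi) / 2))"
  proof -
    have "cos ((a - pi) / 2) = sin (a / 2)" "sin ((a - pi) / 2) = - cos (a / 2)"
      by (simp_all add: diff_divide_distrib cos_diff sin_diff)
    then show ?thesis unfolding cis_conv_exp[symmetric] complex_eq_iff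
      by (simp add: ca sa power2_eq_square)
  qed
  have "Arg (1 - cis a) = (a - pi) / 2"
    by (rule Arg_unique[OF e[symmetric]]) (use s assms in auto)
  moreover have nz: "1 - cis a \<noteq> 0" using s unfolding e by simp
  ultimately show "Im (Ln (1 - cis a)) = (a - pi) / 2" by (simp add: Arg_eq_Im_Ln)
  have "Re (1 - cis a) > 0" using ca s by simp
  then show "1 - cis a \<notin> \<real>\<^sub>\<le>\<^sub>0" by (auto simp: complex_nonpos_Reals_iff)
qed

context comb
begin

definition upper_half :: "complex set" where "upper_half = {z. Im z > 0}"

definition half_strip :: "complex set" where "half_strip = {z. 0 < Re z \<and> Re z < pi \<and> Im z > 0}"

text \<open>The quasimomentum as a function of z. Since Re L = q (v - Im z), the added term changes
  the imaginary part from Im z to v.\<close>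

definition comb_map :: "complex \<Rightarrow> complex" where
  "comb_map z = z + \<i> / of_nat q * L (exp (\<i> * z))"

lemma upper_half: "open upper_half" "convex upper_half" "connected upper_half"
  unfolding upper_half_def using convex_halfspace_Im_gt[of 0] open_halfspace_Im_gt[of 0] convex_connected by auto

lemma half_strip: "open half_strip" "half_strip \<subseteq> upper_half"
proof -
  have e: "half_strip = {z. Re z > 0} \<inter> {z. Re z < pi} \<inter> {z. Im z > 0}" by (auto simp: half_strip_def)
  show "open half_strip" unfolding e by (intro open_Int open_halfspace_Im_gt open_halfspace_Re_gt open_halfspace_Re_lt)
qed (auto simp: half_strip_def upper_half_def)

lemma comb_map_holomorphic: "comb_map holomorphic_on upper_half"
proof -
  have "(\<lambda>z. L (exp (\<i> * z))) holomorphic_on upper_half"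
    by (rule holomorphic_on_compose_gen[OF _ L_holomorphic, unfolded o_def])
       (auto intro!: holomorphic_intros simp: upper_half_def)
  then show ?thesis unfolding comb_map_def[abs_def] using q2 by (intro holomorphic_intros) auto
qed

lemma comb_map_isCont: "z \<in> upper_half \<Longrightarrow> isCont comb_map z"
  using holomorphic_on_imp_continuous_on[OF comb_map_holomorphic] upper_half(1) continuous_on_eq_continuous_at by blast

lemma Im_comb_map: "z \<in> upper_half \<Longrightarrow> Im (comb_map z) = v z"
  using Re_L[of z] q_pos by (simp add: comb_map_def upper_half_def)

lemma Re_comb_map: "Re (comb_map z) = Re z - Im (L (exp (\<i> * z))) / real q"
  by (simp add: comb_map_def)

text \<open>exp(- i q k) is, up to sign, the outer root \<open>joukowski_inv (Dz z)\<close>, and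
  this root plus its inverse is \<open>Dz z\<close>. The sign comes from (- \<zeta>)^q.\<close>

lemma cos_comb_map:
  assumes "z \<in> upper_half"
  shows "2 * cos (of_nat q * comb_map z) = (-1) ^ q * Dz z"
proof -
  have z: "Im z > 0" using assms by (simp add: upper_half_def)
  define j where "j = joukowski_inv (Dz z)"
  have j: "j \<noteq> 0" "j + 1 / j = Dz z" using joukowski_inv_plus_inverse[OF Dz_nonzero[OF z]] by (auto simp: j_def)
  define \<zeta> where "\<zeta> = exp (\<i> * z)"
  have z1: "cmod \<zeta> < 1" "\<zeta> \<noteq> 0" using z by (auto simp: \<zeta>_def)
  have "exp (L \<zeta>) = (- \<zeta>) ^ q * j"
    unfolding exp_L[OF z1(1)] unfolding \<zeta>_def P_Dz W_Dz[OF Dz_nonzero[OF z]] joukowski_inv_def j_def by (simp only: mult.assoc)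
  then have eL: "exp (L \<zeta>) = \<zeta> ^ q * ((-1) ^ q * j)" by (simp add: power_minus[of \<zeta>])
  have "\<i> * (of_nat q * comb_map z) = of_nat q * (\<i> * z) + - L \<zeta>"
    using q2 by (simp add: comb_map_def \<zeta>_def algebra_simps)
  then have e1: "exp (\<i> * (of_nat q * comb_map z)) = \<zeta> ^ q / exp (L \<zeta>)"
    by (simp add: exp_add exp_diff exp_minus \<zeta>_def exp_of_nat_mult divide_inverse)
  have sq: "((-1) ^ q) * ((-1) ^ q) = (1::complex)" by (simp flip: power_mult_distrib)
  have e2: "exp (\<i> * (of_nat q * comb_map z)) = (-1) ^ q * (1 / j)"
    unfolding e1 eL using z1 j sq by (simp add: field_simps)
  have e3: "exp (- (\<i> * (of_nat q * comb_map z))) = (-1) ^ q * j"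
    unfolding exp_minus e2 using sq by (simp add: field_simps)
  have "2 * cos (of_nat q * comb_map z) = (-1) ^ q * (1 / j) + (-1) ^ q * j"
    unfolding cos_exp_eq by (simp add: e2 e3)
  also have "\<dots> = (-1) ^ q * (j + 1 / j)" by (simp add: algebra_simps)
  finally show ?thesis by (simp add: j)
qed

lemma comb_map_has_derivative: "z \<in> upper_half \<Longrightarrow> (comb_map has_field_derivative deriv comb_map z) (at z)"
  using comb_map_holomorphic upper_half(1) holomorphic_derivI by blast

lemma v_vertical_derivative:
  assumes "y > 0"
  shows "((\<lambda>y. v (Complex x y)) has_real_derivative Re (deriv comb_map (Complex x y))) (at y)"
proof -
  have z: "Complex x y \<in> upper_half" using assms by (simp add: upper_half_def)
  have d: "((\<lambda>t. Complex x t) has_vector_derivative \<i>) (at y)"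
  proof -
    have "((\<lambda>t. of_real x + of_real t * \<i>) has_vector_derivative \<i>) (at y)"
      by (auto intro!: derivative_eq_intros)
    then show ?thesis by (simp add: Complex_eq mult.commute)
  qed
  have "((comb_map \<circ> (\<lambda>t. Complex x t)) has_vector_derivative \<i> * deriv comb_map (Complex x y)) (at y)"
    using field_vector_diff_chain_at[OF d comb_map_has_derivative[OF z]] .
  from bounded_linear.has_vector_derivative[OF bounded_linear_Im this]
  have "((\<lambda>t. Im (comb_map (Complex x t))) has_real_derivative Re (deriv comb_map (Complex x y))) (at y)"
    by (simp add: has_real_derivative_iff_has_vector_derivative)
  then show ?thesis
    by (rule has_field_derivative_transform_within_open[of _ _ _ "{0<..}"])
       (use assms in \<open>auto simp: Im_comb_map upper_half_def\<close>)
qed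

text \<open>By the Cauchy-Riemann equations Re k' is the vertical derivative of v, and v increases
  upwards.\<close>

lemma Re_deriv_comb_map_nonneg:
  assumes "z \<in> upper_half"
  shows "Re (deriv comb_map z) \<ge> 0"
proof -
  have y: "Im z > 0" using assms by (simp add: upper_half_def)
  have "mono_on {0<..} (\<lambda>y. v (Complex (Re z) y))" by (rule mono_onI) (auto intro: v_mono)
  from mono_on_imp_deriv_nonneg[OF this v_vertical_derivative[OF y, of "Re z"]] y
  show ?thesis by (simp add: interior_open)
qed

text \<open>By the strong maximum principle for exp(- k') a single zero of Re k' would make it
  vanish identically; v would then be constant on a vertical line, contrary to v >= Im z.\<close>

lemma Re_deriv_comb_map_pos:
  assumes z: "z \<in> upper_half"
  shows "Re (deriv comb_map z) > 0"
proof (rule ccontr)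
  assume "\<not> ?thesis"
  then have 0: "Re (deriv comb_map z) = 0" using Re_deriv_comb_map_nonneg[OF z] by simp
  have h: "(\<lambda>z. exp (- deriv comb_map z)) holomorphic_on upper_half"
    by (intro holomorphic_intros holomorphic_deriv comb_map_holomorphic upper_half(1))
  have "(\<lambda>z. exp (- deriv comb_map z)) constant_on upper_half"
    by (rule maximum_modulus_principle[OF h upper_half(1,3,1) order.refl z])
       (use Re_deriv_comb_map_nonneg 0 in auto)
  then have "cmod (exp (- deriv comb_map w)) = cmod (exp (- deriv comb_map z))" if "w \<in> upper_half" for w
    using that z unfolding constant_on_def by metis
  then have 0: "Re (deriv comb_map w) = 0" if "w \<in> upper_half" for w using that 0 by auto
  have "\<exists>c. \<forall>y\<in>{0<..}. v (Complex 0 y) = c"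
  proof (rule has_field_derivative_zero_constant)
    show "convex {0::real<..}" by simp
    fix y :: real assume "y \<in> {0<..}"
    then show "((\<lambda>y. v (Complex 0 y)) has_real_derivative 0) (at y within {0<..})"
      using v_vertical_derivative[of y 0] 0[of "Complex 0 y"]
      by (auto simp: upper_half_def intro: has_field_derivative_at_within)
  qed
  then obtain c where c: "\<And>y. y > 0 \<Longrightarrow> v (Complex 0 y) = c" by auto
  define y where "y = \<bar>c\<bar> + 1"
  have "y > 0" by (simp add: y_def)
  then show False using c[of y] v_ge_Im[of "Complex 0 y"] by (simp add: y_def)
qed

text \<open>The Noshiro-Warschawski argument: on a convex domain a derivative with positive real
  part gives difference quotients with positive real part.\<close>

lemma comb_map_inj: "inj_on comb_map upper_half"
proof (rule inj_onI, rule ccontr)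
  fix a b assume ab: "a \<in> upper_half" "b \<in> upper_half" "comb_map a = comb_map b" "a \<noteq> b"
  define f where "f t = Re (comb_map (a + of_real t * (b - a)) / (b - a))" for t
  have d: "(f has_real_derivative Re (deriv comb_map (a + of_real t * (b - a)))) (at t)"
    if t: "0 \<le> t" "t \<le> 1" for t
  proof -
    have "(1 - t) *\<^sub>R a + t *\<^sub>R b \<in> upper_half" by (rule convexD[OF upper_half(2)]) (use ab t in auto)
    moreover have "(1 - t) *\<^sub>R a + t *\<^sub>R b = a + of_real t * (b - a)" by (simp add: scaleR_conv_of_real algebra_simps)
    ultimately have z: "a + of_real t * (b - a) \<in> upper_half" by simp
    have "((\<lambda>t. a + of_real t * (b - a)) has_vector_derivative (b - a)) (at t)"
      by (auto intro!: derivative_eq_intros)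
    from field_vector_diff_chain_at[OF this comb_map_has_derivative[OF z]]
    have "((\<lambda>t. comb_map (a + of_real t * (b - a))) has_vector_derivative (b - a) * deriv comb_map (a + of_real t * (b - a))) (at t)"
      by (simp add: o_def)
    from bounded_linear.has_vector_derivative[OF bounded_linear_Re has_vector_derivative_divide[OF this, of "b - a"]]
    show ?thesis using ab(4) by (simp add: f_def[abs_def] has_real_derivative_iff_has_vector_derivative)
  qed
  have "f 0 < f 1"
  proof (rule DERIV_pos_imp_increasing[of 0 1 f])
    fix t :: real assume t: "0 \<le> t" "t \<le> 1"
    have "(1 - t) *\<^sub>R a + t *\<^sub>R b \<in> upper_half" by (rule convexD[OF upper_half(2)]) (use ab t in auto)
    moreover have "(1 - t) *\<^sub>R a + t *\<^sub>R b = a + of_real t * (b - a)" by (simp add: scaleR_conv_of_real algebra_simps)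
    ultimately have z: "a + of_real t * (b - a) \<in> upper_half" by simp
    show "\<exists>y. (f has_real_derivative y) (at t) \<and> y > 0" using d[OF t] Re_deriv_comb_map_pos[OF z] by blast
  qed simp
  then show False using ab(3) by (simp add: f_def)
qed

section \<open>The image of the half strip covers the strips between neighbouring slits\<close>

definition strip :: "nat \<Rightarrow> complex set" where
  "strip n = {\<kappa>. pi * real n / real q < Re \<kappa> \<and> Re \<kappa> < pi * real (Suc n) / real q \<and> Im \<kappa> > 0}"

lemma strip: "open (strip n)" "connected (strip n)"
proof -
  have e: "strip n = {z. Re z > pi * real n / real q} \<inter> {z. Re z < pi * real (Suc n) / real q} \<inter> {z. Im z > 0}"
    by (auto simp: strip_def)
  show "open (strip n)" unfolding e by (intro open_Int open_halfspace_Im_gt open_halfspace_Re_gt open_halfspace_Re_lt)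
  show "connected (strip n)" unfolding e
    by (intro convex_connected convex_Int convex_halfspace_Im_gt convex_halfspace_Re_gt convex_halfspace_Re_lt)
qed

lemma cos_strip_nonreal:
  assumes "\<kappa> \<in> strip n"
  shows "Im (2 * cos (of_nat q * \<kappa>)) \<noteq> 0"
proof -
  define x where "x = real q * Re \<kappa> - real n * pi"
  have "pi * real n < real q * Re \<kappa>" "real q * Re \<kappa> < pi * real (Suc n)"
    using assms q_pos by (auto simp: strip_def field_simps)
  then have "0 < x" "x < pi" by (auto simp: x_def algebra_simps)
  then have "sin x > 0" by (rule sin_gt_zero)
  moreover have "sin (real q * Re \<kappa>) = (-1) ^ n * sin x"
  proof -
    have "real q * Re \<kappa> = x + real n * pi" by (simp add: x_def)
    then show ?thesis by (simp add: sin_add mult.commute)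
  qed
  ultimately have s: "sin (real q * Re \<kappa>) \<noteq> 0" by simp
  then show ?thesis using assms q_pos by (auto simp: Im_cos strip_def)
qed

lemma Dz_boundary_real:
  assumes "Im z = 0 \<or> Re z = 0 \<or> Re z = pi"
  shows "Im (Dz z) = 0"
proof -
  have "Im (cos z) = 0" using assms by (auto simp: Im_cos)
  then have "cos z = of_real (Re (cos z))" by (simp add: complex_eq_iff)
  then have "Dz z = of_real ((2 * K) ^ q * (\<Prod>j<q. cos (\<psi> j) - Re (cos z)))"
    unfolding Dz by simp
  then show ?thesis by (simp only: Im_complex_of_real)
qed

text \<open>Because Im z <= v = Im k, bounded images have preimages in a compact rectangle.\<close>

lemma comb_map_sequence_limit:
  assumes z: "\<And>j::nat. zs j \<in> half_strip" and lim: "(\<lambda>j. comb_map (zs j)) \<longlonglongrightarrow> \<kappa>"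
  obtains z0 r where "strict_mono (r :: nat \<Rightarrow> nat)" "(\<lambda>j. zs (r j)) \<longlonglongrightarrow> z0"
    "0 \<le> Re z0" "Re z0 \<le> pi" "0 \<le> Im z0"
proof -
  have "bounded (range (\<lambda>j. comb_map (zs j)))" using lim convergent_imp_bounded by blast
  then obtain B where B: "\<And>j. cmod (comb_map (zs j)) \<le> B" by (auto simp: bounded_iff)
  have "zs j \<in> cbox 0 (Complex pi B)" for j
  proof -
    have "zs j \<in> upper_half" using z[of j] half_strip(2) by blast
    then have "Im (zs j) \<le> Im (comb_map (zs j))" using Im_comb_map v_ge_Im by (simp add: upper_half_def)
    also have "\<dots> \<le> B" using B[of j] abs_Im_le_cmod[of "comb_map (zs j)"] by linarith
    finally show ?thesis using z[of j] by (auto simp: half_strip_def in_cbox_complex_iff)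
  qed
  then obtain z0 r where z0: "z0 \<in> cbox 0 (Complex pi B)" "strict_mono (r :: nat \<Rightarrow> nat)" "(zs \<circ> r) \<longlonglongrightarrow> z0"
    using compact_cbox[of 0 "Complex pi B"] unfolding compact_def by metis
  then show ?thesis by (intro that[of r z0]) (auto simp: in_cbox_complex_iff o_def)
qed

text \<open>High above the real line L is close to the real number L(0), so k moves points almost
  vertically, and a high point over the middle of the strip stays over it.\<close>

lemma strip_meets_image:
  assumes n: "n < q"
  shows "comb_map ` half_strip \<inter> strip n \<noteq> {}"
proof -
  have "isCont L 0"
    using holomorphic_on_imp_continuous_on[OF L_holomorphic] by (simp add: continuous_on_eq_continuous_at)
  then obtain d where d: "d > 0" "\<And>\<zeta>. cmod \<zeta> < d \<Longrightarrow> cmod (L \<zeta> - L 0) < pi / 4"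
    unfolding continuous_at_eps_delta by (metis dist_norm diff_zero pi_gt_zero zero_less_divide_iff zero_less_numeral)
  define x where "x = pi * (real n + 1 / 2) / real q"
  define y where "y = max 1 (1 - ln d)"
  define z where "z = Complex x y"
  have "exp (- y) < d"
  proof -
    have "- y < ln d" by (auto simp: y_def max_def)
    then show ?thesis using d(1) by (metis exp_less_mono exp_ln)
  qed
  then have "cmod (exp (\<i> * z)) < d" by (simp add: z_def)
  then have "cmod (L (exp (\<i> * z)) - L 0) < pi / 4" by (rule d)
  moreover have "\<bar>Im (L (exp (\<i> * z)) - L 0)\<bar> \<le> cmod (L (exp (\<i> * z)) - L 0)" by (rule abs_Im_le_cmod)
  moreover have "Im (L 0) = 0" by (simp add: L_0)
  ultimately have l: "\<bar>Im (L (exp (\<i> * z)))\<bar> < pi / 4" by simp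
  have "x > 0" "x < pi"
  proof -
    show "x > 0" using q_pos by (simp add: x_def)
    have "real n + 1 / 2 < real q" using n by linarith
    then have "pi * (real n + 1 / 2) < pi * real q" by (intro mult_strict_left_mono) auto
    then show "x < pi" using q_pos by (simp add: x_def divide_less_eq)
  qed
  moreover have "y > 0" by (simp add: y_def)
  ultimately have zO: "z \<in> half_strip" by (simp add: half_strip_def z_def)
  then have zU: "z \<in> upper_half" using half_strip by blast
  have "real q * Re (comb_map z) = pi * (real n + 1 / 2) - Im (L (exp (\<i> * z)))"
    unfolding Re_comb_map using q_pos by (simp add: z_def x_def field_simps)
  then have "pi * real n < real q * Re (comb_map z)" "real q * Re (comb_map z) < pi * real (Suc n)"
    using l by (auto simp: algebra_simps abs_less_iff)
  moreover have "Im (comb_map z) > 0" using Im_comb_map[OF zU] v_ge_Im[of z] \<open>y > 0\<close> by (simp add: z_def)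
  ultimately have "comb_map z \<in> strip n" using q_pos by (simp add: strip_def field_simps)
  then show ?thesis using zO by blast
qed

text \<open>The part of the strip covered by the image is open by injectivity and also relatively
  closed: preimages tending to the boundary of the half strip would give \<open>Dz\<close> a real
  limit, whereas cos(q \<kappa>) is not real in the open strip. Connectedness concludes.\<close>

lemma strip_subset_image:
  assumes n: "n < q"
  shows "strip n \<subseteq> comb_map ` half_strip"
proof -
  define T where "T = strip n \<inter> comb_map ` half_strip"
  have "open (comb_map ` half_strip)"
    by (rule open_mapping_thm3) (use half_strip comb_map_holomorphic comb_map_inj holomorphic_on_subset inj_on_subset in blast)+
  then have o: "openin (top_of_set (strip n)) T"
    unfolding T_def by (auto simp: openin_open)
  have "strip n \<inter> closure T \<subseteq> T"
  proof
    fix \<kappa> assume \<kappa>: "\<kappa> \<in> strip n \<inter> closure T"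
    then obtain xs where xs: "\<And>j. xs j \<in> T" "xs \<longlonglongrightarrow> \<kappa>" by (auto simp: closure_sequential)
    then have "\<forall>j. \<exists>z\<in>half_strip. xs j = comb_map z" by (auto simp: T_def)
    then obtain zs where zs: "\<And>j. zs j \<in> half_strip" "\<And>j. xs j = comb_map (zs j)" by metis
    then have "xs = (\<lambda>j. comb_map (zs j))" by auto
    then have lim: "(\<lambda>j. comb_map (zs j)) \<longlonglongrightarrow> \<kappa>" using xs(2) by simp
    obtain z0 r where z0: "strict_mono (r :: nat \<Rightarrow> nat)" "(\<lambda>j. zs (r j)) \<longlonglongrightarrow> z0"
      "0 \<le> Re z0" "Re z0 \<le> pi" "0 \<le> Im z0" using comb_map_sequence_limit[OF zs(1) lim] .
    have lim': "(\<lambda>j. comb_map (zs (r j))) \<longlonglongrightarrow> \<kappa>"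
      using LIMSEQ_subseq_LIMSEQ[OF lim z0(1)] by (simp add: o_def)
    have "(\<lambda>j. 2 * cos (of_nat q * comb_map (zs (r j)))) \<longlonglongrightarrow> 2 * cos (of_nat q * \<kappa>)"
      by (intro tendsto_intros lim')
    moreover have "(\<lambda>j. (-1) ^ q * Dz (zs (r j))) \<longlonglongrightarrow> (-1) ^ q * Dz z0"
      by (intro tendsto_intros continuous_on_tendsto_compose[OF Dz_continuous z0(2), of UNIV]) auto
    moreover have "2 * cos (of_nat q * comb_map (zs (r j))) = (-1) ^ q * Dz (zs (r j))" for j
      using zs(1) half_strip(2) by (intro cos_comb_map) blast
    ultimately have "2 * cos (of_nat q * \<kappa>) = (-1) ^ q * Dz z0"
      using LIMSEQ_unique by (metis (no_types, lifting) ext)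
    moreover have "Im (2 * cos (of_nat q * \<kappa>)) \<noteq> 0" using \<kappa> cos_strip_nonreal by blast
    ultimately have "Im ((-1) ^ q * Dz z0) \<noteq> 0" by simp
    then have "Im (Dz z0) \<noteq> 0" by (cases "even q") auto
    then have "z0 \<in> half_strip" using Dz_boundary_real[of z0] z0 unfolding half_strip_def by force
    moreover from this have "(\<lambda>j. comb_map (zs (r j))) \<longlonglongrightarrow> comb_map z0"
      using comb_map_isCont[of z0] half_strip(2) isCont_tendsto_compose[OF _ z0(2)] by blast
    then have "comb_map z0 = \<kappa>" using lim' LIMSEQ_unique by blast
    ultimately show "\<kappa> \<in> T" using \<kappa> by (auto simp: T_def)
  qed
  then have "T = strip n \<inter> closure T" using closure_subset[of T] by (auto simp: T_def)
  then have "closedin (top_of_set (strip n)) T" by (metis closed_closure closedin_closed_Int)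
  then have "T = {} \<or> T = strip n" using o strip(2)[of n] connected_clopen by blast
  then show ?thesis using strip_meets_image[OF n] by (auto simp: T_def)
qed

end

section \<open>The inverse map, boundary values on the gaps and behaviour near the slits\<close>

context comb
begin

definition comb_inv :: "complex \<Rightarrow> complex" where "comb_inv = inv_into upper_half comb_map"

lemma comb_inv_comb_map: "z \<in> upper_half \<Longrightarrow> comb_inv (comb_map z) = z"
  unfolding comb_inv_def by (rule inv_into_f_f[OF comb_map_inj])

lemma comb_inv_holomorphic: "comb_inv holomorphic_on comb_map ` upper_half"
  and comb_inv_deriv: "z \<in> upper_half \<Longrightarrow> deriv comb_map z * deriv comb_inv (comb_map z) = 1"
proof -
  obtain g where g: "g holomorphic_on comb_map ` upper_half" "\<And>z. z \<in> upper_half \<Longrightarrow> deriv comb_map z * deriv g (comb_map z) = 1"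
      "\<And>z. z \<in> upper_half \<Longrightarrow> g (comb_map z) = z"
    using holomorphic_has_inverse[OF comb_map_holomorphic upper_half(1) comb_map_inj] by metis
  have o: "open (comb_map ` upper_half)" by (rule open_mapping_thm3[OF comb_map_holomorphic upper_half(1) comb_map_inj])
  have eq: "g w = comb_inv w" if "w \<in> comb_map ` upper_half" for w using that g(3) comb_inv_comb_map by auto
  show "comb_inv holomorphic_on comb_map ` upper_half" using g(1) eq by (rule holomorphic_transform) auto
  assume z: "z \<in> upper_half"
  have "deriv comb_inv (comb_map z) = deriv g (comb_map z)"
    by (rule deriv_cong_ev) (use eq o z in \<open>auto intro!: eventually_nhds_in_open elim: eventually_mono simp: eventually_nhds\<close>)
  then show "deriv comb_map z * deriv comb_inv (comb_map z) = 1" using g(2)[OF z] by simp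
qed

lemma strip_comb_inv:
  assumes "n < q" "\<kappa> \<in> strip n"
  shows "comb_inv \<kappa> \<in> half_strip" "comb_map (comb_inv \<kappa>) = \<kappa>"
proof -
  obtain z where z: "z \<in> half_strip" "comb_map z = \<kappa>" using strip_subset_image[OF assms(1)] assms(2) by blast
  then have "comb_inv \<kappa> = z" using comb_inv_comb_map[of z] half_strip(2) by blast
  then show "comb_inv \<kappa> \<in> half_strip" "comb_map (comb_inv \<kappa>) = \<kappa>" using z by auto
qed

text \<open>On a gap no logarithm meets its cut and the arguments add up explicitly: each zero
  contributes x, less pi if it lies to the left of x. Counting those zeros yields the foot point of
  the n-th slit.\<close>

lemma L_isCont_gap:
  assumes n: "1 \<le> n" "n < q" and x: "\<alpha> n < x" "x < \<beta> n"
  shows "isCont L (exp (\<i> * of_real x))"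
    and "Im (L (exp (\<i> * of_real x))) = real q * x - pi * real n"
proof -
  define \<zeta> where "\<zeta> = exp (\<i> * complex_of_real x)"
  have \<zeta>: "\<zeta> = cis x" by (simp add: \<zeta>_def cis_conv_exp)
  have x0: "0 < x" "x < pi" using x edge_bounds[OF n] by auto
  obtain d where d: "Dz (of_real x) = of_real d" using Dz_real by blast
  have d2: "\<bar>d\<bar> > 2" using gap[OF n x] by (simp add: d)
  then have D0: "Dz (of_real x) \<noteq> 0" by (auto simp: d)
  have "P \<zeta> \<noteq> 0" unfolding \<zeta>_def P_Dz using D0 by simp
  then have f0: "1 - \<zeta> * cis (\<psi> j) \<noteq> 0" "1 - \<zeta> * cis (- \<psi> j) \<noteq> 0" if "j < q" for j
    using that by (auto simp: P_def)
  have ne: "\<psi> j \<noteq> x" if "j < q" for j using f0(2)[OF that] by (auto simp: \<zeta> cis_mult)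
  define a1 where "a1 j = x + \<psi> j" for j
  \<comment> \<open>The angle x - \<psi> j brought into (0, 2 pi), where the argument formula for 1
    - cis holds. The extra turn is what distinguishes zeros on the right of x from those on the
    left.\<close>
  define a2 where "a2 j = (if \<psi> j < x then x - \<psi> j else x - \<psi> j + 2 * pi)" for j
  have c1: "\<zeta> * cis (\<psi> j) = cis (a1 j)" for j by (simp add: \<zeta> cis_mult a1_def)
  have c2: "\<zeta> * cis (- \<psi> j) = cis (a2 j)" for j
  proof -
    have "cis (x - \<psi> j + 2 * pi) = cis (x - \<psi> j)" by (simp add: complex_eq_iff cos_add sin_add)
    then show ?thesis by (simp add: \<zeta> cis_mult a2_def)
  qed
  have b1: "0 < a1 j" "a1 j < 2 * pi" if "j < q" for j using \<psi>[OF that] x0 by (auto simp: a1_def)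
  have b2: "0 < a2 j" "a2 j < 2 * pi" if "j < q" for j
    using \<psi>[OF that] x0 ne[OF that] by (auto simp: a2_def)
  have s1: "1 - \<zeta> * cis (\<psi> j) \<notin> \<real>\<^sub>\<le>\<^sub>0" and s2: "1 - \<zeta> * cis (- \<psi> j) \<notin> \<real>\<^sub>\<le>\<^sub>0" if "j < q" for j
    unfolding c1 c2 using Im_Ln_one_minus_cis(1) b1[OF that] b2[OF that] by auto
  define r where "r = 1 - 4 / d\<^sup>2"
  have W: "W \<zeta> = of_real r" unfolding \<zeta>_def W_Dz[OF D0] d r_def by simp
  have "d\<^sup>2 > 2\<^sup>2" using d2 by (metis abs_numeral power2_less_imp_less power2_abs power_strict_mono zero_le_numeral pos2)
  then have r: "r > 0" by (auto simp: r_def divide_less_eq)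
  then have Wr: "W \<zeta> \<notin> \<real>\<^sub>\<le>\<^sub>0" unfolding W by simp
  have "isCont P \<zeta>" unfolding P_def[abs_def] by (intro continuous_intros)
  then have "isCont W \<zeta>" unfolding W_def[abs_def] using \<open>P \<zeta> \<noteq> 0\<close> by (intro continuous_intros) auto
  then have "isCont (\<lambda>z. csqrt (W z)) \<zeta>"
    by (rule isCont_o2) (rule continuous_at_csqrt[OF Wr])
  then show "isCont L (exp (\<i> * of_real x))"
    unfolding L_def[abs_def] \<zeta>_def[symmetric]
    by (intro continuous_intros) (use s1 s2 one_plus_csqrt_slit in auto)
  have "csqrt (W \<zeta>) = of_real (sqrt r)" unfolding W using r by simp
  then have e: "(1 + csqrt (W \<zeta>)) / 2 = of_real ((1 + sqrt r) / 2)" by simp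
  have pos: "(1 + sqrt r) / 2 > 0" using r by (simp add: add_pos_pos)
  have "Im (Ln ((1 + csqrt (W \<zeta>)) / 2)) = 0"
    unfolding e by (simp only: Ln_of_real[OF pos] Im_complex_of_real)
  then have "Im (L \<zeta>) = (\<Sum>j<q. Im (Ln (1 - cis (a1 j))) + Im (Ln (1 - cis (a2 j))))"
    unfolding L_def by (simp add: c1 c2)
  also have "\<dots> = (\<Sum>j<q. (a1 j - pi) / 2 + (a2 j - pi) / 2)"
    by (intro sum.cong refl arg_cong2[of _ _ _ _ "(+)"] Im_Ln_one_minus_cis(2)) (use b1 b2 in auto)
  also have "\<dots> = (\<Sum>j<q. x - (if \<psi> j < x then pi else 0))"
    by (intro sum.cong refl) (auto simp: a1_def a2_def field_simps)
  also have "\<dots> = real q * x - pi * real (card {j. j < q \<and> \<psi> j < x})"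
  proof -
    have "(\<Sum>j<q. if \<psi> j < x then pi else 0) = (\<Sum>j\<in>{..<q} \<inter> {j. \<psi> j < x}. pi)"
      by (subst sum.inter_restrict) auto
    also have "{..<q} \<inter> {j. \<psi> j < x} = {j. j < q \<and> \<psi> j < x}" by auto
    finally show ?thesis by (simp add: sum_subtractf)
  qed
  finally show "Im (L (exp (\<i> * of_real x))) = real q * x - pi * real n"
    using count[OF n x] by (simp add: \<zeta>_def)
qed

text \<open>Approach from above identifies the imaginary part with v. The real part is constant on
  the gap, so the gap is folded onto a vertical slit.\<close>

lemma comb_map_gap:
  assumes n: "1 \<le> n" "n < q" and x: "\<alpha> n < x" "x < \<beta> n"
  shows "isCont comb_map (of_real x)" "comb_map (of_real x) = Complex (pi * real n / real q) (v (of_real x))"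
proof -
  have "isCont (\<lambda>z. exp (\<i> * z)) (of_real x)" by (intro continuous_intros)
  from isCont_o2[OF this L_isCont_gap(1)[OF n x]]
  show c: "isCont comb_map (of_real x)"
    unfolding comb_map_def[abs_def] using q2 by (intro continuous_intros) auto
  have lim: "((\<lambda>t. Complex x t) \<longlongrightarrow> of_real x) (at_right 0)"
  proof -
    have "((\<lambda>t. Complex x t) \<longlongrightarrow> Complex x 0) (at_right 0)"
      by (intro tendsto_Complex tendsto_intros)
    then show ?thesis by (simp add: complex_of_real_def)
  qed
  have "((\<lambda>t. Im (comb_map (Complex x t))) \<longlongrightarrow> Im (comb_map (of_real x))) (at_right 0)"
    by (intro tendsto_Im isCont_tendsto_compose[OF c lim])
  moreover have "((\<lambda>t. v (Complex x t)) \<longlongrightarrow> v (of_real x)) (at_right 0)"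
    by (rule continuous_on_tendsto_compose[OF continuous_on_v[of UNIV] lim]) auto
  moreover have "\<forall>\<^sub>F t in at_right 0. Im (comb_map (Complex x t)) = v (Complex x t)"
    using eventually_at_right_less[of "0::real"] by eventually_elim (simp add: Im_comb_map upper_half_def)
  ultimately have "Im (comb_map (of_real x)) = v (of_real x)"
    using tendsto_unique[OF trivial_limit_at_right_real] tendsto_cong by metis
  moreover have "Re (comb_map (of_real x)) = pi * real n / real q"
    unfolding Re_comb_map L_isCont_gap(2)[OF n x] using q_pos by (simp add: field_simps)
  ultimately show "comb_map (of_real x) = Complex (pi * real n / real q) (v (of_real x))"
    by (simp add: complex_eq_iff)
qed

text \<open>The comb map omits the slits: near a gap point the map is open and injective.\<close>
lemma comb_map_omits_slit:
  assumes n: "1 \<le> n" "n < q" and x: "\<alpha> n < x" "x < \<beta> n" and z: "z \<in> upper_half"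
  shows "comb_map z \<noteq> comb_map (of_real x)"
proof
  assume eq: "comb_map z = comb_map (of_real x)"
  define \<epsilon> where "\<epsilon> = Im z / 2"
  have e: "\<epsilon> > 0" using z by (simp add: \<epsilon>_def upper_half_def)
  have im: "Im w > \<epsilon>" if "w \<in> ball z \<epsilon>" for w
    using that abs_Im_le_cmod[of "z - w"] by (auto simp: dist_norm \<epsilon>_def)
  have sub: "ball z \<epsilon> \<subseteq> upper_half" using im e by (fastforce simp: upper_half_def)
  have "open (comb_map ` ball z \<epsilon>)"
    by (rule open_mapping_thm3) (use sub comb_map_holomorphic comb_map_inj holomorphic_on_subset inj_on_subset in blast)+
  moreover have "comb_map (of_real x) \<in> comb_map ` ball z \<epsilon>" using eq e by (metis centre_in_ball image_eqI)
  moreover have "((\<lambda>t. comb_map (Complex x t)) \<longlongrightarrow> comb_map (of_real x)) (at_right 0)"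
  proof (rule isCont_tendsto_compose[OF comb_map_gap(1)[OF n x]])
    have "((\<lambda>t. Complex x t) \<longlongrightarrow> Complex x 0) (at_right 0)"
      by (intro tendsto_Complex tendsto_intros)
    then show "((\<lambda>t. Complex x t) \<longlongrightarrow> of_real x) (at_right 0)" by (simp add: complex_of_real_def)
  qed
  ultimately have "\<forall>\<^sub>F t in at_right 0. comb_map (Complex x t) \<in> comb_map ` ball z \<epsilon>"
    using topological_tendstoD by blast
  moreover have "\<forall>\<^sub>F t in at_right 0. 0 < t \<and> t < \<epsilon>"
    using e by (auto simp: eventually_at_right_field)
  ultimately have "\<forall>\<^sub>F t in at_right 0. comb_map (Complex x t) \<in> comb_map ` ball z \<epsilon> \<and> 0 < t \<and> t < \<epsilon>"
    by eventually_elim auto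
  then obtain t where t: "comb_map (Complex x t) \<in> comb_map ` ball z \<epsilon>" "0 < t" "t < \<epsilon>"
    using eventually_happens'[OF trivial_limit_at_right_real] by blast
  then obtain w where w: "w \<in> ball z \<epsilon>" "comb_map (Complex x t) = comb_map w" by auto
  have "Complex x t = w"
    by (rule inj_onD[OF comb_map_inj w(2)]) (use w sub t in \<open>auto simp: upper_half_def\<close>)
  then show False using im[OF w(1)] t by auto
qed

text \<open>Compactness away from foot and tip: otherwise some point of the upper half plane would
  be mapped into the slit. By the intermediate value theorem for v that image also belongs to a
  point of the gap, which \<open>comb_map_omits_slit\<close> forbids.\<close>

lemma comb_inv_near_slit:
  assumes n: "1 \<le> n" "n < q" and x: "\<alpha> n < x" "x < \<beta> n" "v (of_real x) = H"
    and t: "0 < t1" "t2 < H" and \<epsilon>: "\<epsilon> > 0"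
  obtains \<delta> where "\<delta> > 0"
    "\<And>z t. z \<in> half_strip \<Longrightarrow> t1 \<le> t \<Longrightarrow> t \<le> t2 \<Longrightarrow> cmod (comb_map z - Complex (pi * real n / real q) t) < \<delta> \<Longrightarrow> Im z < \<epsilon>"
proof (rule ccontr)
  assume no: "\<not> thesis"
  let ?p = "\<lambda>t. Complex (pi * real n / real q) t"
  have "\<exists>z t. z \<in> half_strip \<and> t1 \<le> t \<and> t \<le> t2 \<and> cmod (comb_map z - ?p t) < 1 / real (Suc j) \<and> \<not> Im z < \<epsilon>" for j
  proof (rule ccontr)
    assume "\<not> ?thesis"
    then show False using no that[of "1 / real (Suc j)"] by fastforce
  qed
  then obtain zs ts where zt: "\<And>j. zs j \<in> half_strip" "\<And>j. t1 \<le> ts j" "\<And>j. ts j \<le> t2"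
      "\<And>j. cmod (comb_map (zs j) - ?p (ts j)) < 1 / real (Suc j)" "\<And>j. \<epsilon> \<le> Im (zs j)"
    unfolding not_less by metis
  have "\<forall>j. ts j \<in> {t1..t2}" using zt by auto
  then obtain t0 r where t0: "t0 \<in> {t1..t2}" "strict_mono (r :: nat \<Rightarrow> nat)" "(ts \<circ> r) \<longlonglongrightarrow> t0"
    using compact_Icc[of t1 t2] unfolding compact_def by metis
  have small: "(\<lambda>j. comb_map (zs j) - ?p (ts j)) \<longlonglongrightarrow> 0"
  proof (rule Lim_null_comparison)
    show "\<forall>\<^sub>F j in sequentially. norm (comb_map (zs j) - ?p (ts j)) \<le> 1 / real (Suc j)"
      using zt(4) by (intro always_eventually allI less_imp_le)
    show "(\<lambda>j. 1 / real (Suc j)) \<longlonglongrightarrow> 0" by (intro LIMSEQ_Suc lim_1_over_n)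
  qed
  have "(\<lambda>j. comb_map (zs (r j)) - ?p (ts (r j)) + ?p (ts (r j))) \<longlonglongrightarrow> 0 + ?p t0"
    using LIMSEQ_subseq_LIMSEQ[OF small t0(2)] t0(3)
    by (intro tendsto_add tendsto_Complex tendsto_const) (auto simp: o_def)
  then have lim: "(\<lambda>j. comb_map (zs (r j))) \<longlonglongrightarrow> ?p t0" by simp
  obtain z0 r' where z0: "strict_mono (r' :: nat \<Rightarrow> nat)" "(\<lambda>j. zs (r (r' j))) \<longlonglongrightarrow> z0"
    using comb_map_sequence_limit[of "\<lambda>j. zs (r j)", OF zt(1) lim] by metis
  have "\<epsilon> \<le> Im z0"
    by (rule LIMSEQ_le_const[OF tendsto_Im[OF z0(2)]]) (use zt(5) in auto)
  then have zU: "z0 \<in> upper_half" using \<epsilon> by (simp add: upper_half_def)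
  have "(\<lambda>j. comb_map (zs (r (r' j)))) \<longlonglongrightarrow> comb_map z0"
    by (rule isCont_tendsto_compose[OF comb_map_isCont[OF zU] z0(2)])
  moreover have "(\<lambda>j. comb_map (zs (r (r' j)))) \<longlonglongrightarrow> ?p t0"
    using LIMSEQ_subseq_LIMSEQ[OF lim z0(1)] by (simp add: o_def)
  ultimately have k0: "comb_map z0 = ?p t0" using LIMSEQ_unique by blast
  have t0H: "0 < t0" "t0 < H" using t0(1) t by auto
  have "\<exists>y\<ge>\<alpha> n. y \<le> x \<and> v (of_real y) = t0"
  proof (rule IVT')
    show "v (of_real (\<alpha> n)) \<le> t0" "t0 \<le> v (of_real x)" using v_edge[OF n] t0H x by auto
    show "continuous_on {\<alpha> n..x} (\<lambda>y. v (of_real y))"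
      by (intro continuous_on_compose2[OF continuous_on_v[of UNIV]] continuous_intros) auto
  qed (use x in auto)
  then obtain y where y: "\<alpha> n \<le> y" "y \<le> x" "v (of_real y) = t0" by blast
  have "\<alpha> n \<noteq> y" using y v_edge(1)[OF n] t0H by auto
  then have yg: "\<alpha> n < y" "y < \<beta> n" using y x by auto
  have "comb_map z0 = comb_map (of_real y)" using k0 comb_map_gap(2)[OF n yg] y by simp
  then show False using comb_map_omits_slit[OF n yg zU] by simp
qed

end

section \<open>The Dirichlet integral of the comb map\<close>

context comb
begin

text \<open>The derivative of k - z; its squared modulus is the density of the Dirichlet integral of
  v - Im z.\<close>

definition comb_dev :: "complex \<Rightarrow> complex" where "comb_dev z = deriv comb_map z - 1"

lemma comb_dev_holomorphic: "comb_dev holomorphic_on upper_half"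
  unfolding comb_dev_def by (intro holomorphic_intros holomorphic_deriv comb_map_holomorphic upper_half(1))

lemma Complex_upper_half: "y > 0 \<Longrightarrow> Complex x y \<in> upper_half"
  by (simp add: upper_half_def)

lemma vertical_derivative:
  assumes "h holomorphic_on upper_half" "y > 0"
  shows "((\<lambda>t. h (Complex x t)) has_vector_derivative \<i> * deriv h (Complex x y)) (at y)"
proof -
  have d: "((\<lambda>t. Complex x t) has_vector_derivative \<i>) (at y)"
  proof -
    have "((\<lambda>t. of_real x + of_real t * \<i>) has_vector_derivative \<i>) (at y)"
      by (auto intro!: derivative_eq_intros)
    then show ?thesis by (simp add: Complex_eq mult.commute)
  qed
  from field_vector_diff_chain_at[OF d holomorphic_derivI[OF assms(1) upper_half(1) Complex_upper_half[OF assms(2)]]]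
  show ?thesis by (simp add: o_def)
qed

lemma horizontal_derivative:
  assumes "h holomorphic_on upper_half" "y > 0"
  shows "((\<lambda>t. h (Complex t y)) has_vector_derivative deriv h (Complex x y)) (at x)"
proof -
  have d: "((\<lambda>t. Complex t y) has_vector_derivative 1) (at x)"
  proof -
    have "((\<lambda>t. of_real t + \<i> * of_real y) has_vector_derivative 1) (at x)"
      by (auto intro!: derivative_eq_intros)
    then show ?thesis by (simp add: Complex_eq)
  qed
  from field_vector_diff_chain_at[OF d holomorphic_derivI[OF assms(1) upper_half(1) Complex_upper_half[OF assms(2)]]]
  show ?thesis by (simp add: o_def)
qed

lemma v_minus_Im_dy: "y > 0 \<Longrightarrow> ((\<lambda>y. v (Complex x y) - y) has_real_derivative Re (comb_dev (Complex x y))) (at y)"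
  using v_vertical_derivative[of y x] by (auto intro!: derivative_eq_intros simp: comb_dev_def)

lemma v_minus_Im_dx:
  assumes "y > 0"
  shows "((\<lambda>x. v (Complex x y) - y) has_real_derivative Im (comb_dev (Complex x y))) (at x)"
proof -
  have "((\<lambda>t. Im (comb_map (Complex t y))) has_real_derivative Im (deriv comb_map (Complex x y))) (at x)"
    using bounded_linear.has_vector_derivative[OF bounded_linear_Im horizontal_derivative[OF comb_map_holomorphic assms, of x]]
    by (simp add: has_real_derivative_iff_has_vector_derivative)
  then show ?thesis
    using assms by (auto intro!: derivative_eq_intros simp: comb_dev_def Im_comb_map upper_half_def)
qed

lemma v_minus_Im_dyy: "y > 0 \<Longrightarrow> ((\<lambda>y. Re (comb_dev (Complex x y))) has_real_derivative - Im (deriv comb_dev (Complex x y))) (at y)"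
  using bounded_linear.has_vector_derivative[OF bounded_linear_Re vertical_derivative[OF comb_dev_holomorphic, of y x]]
  by (simp add: has_real_derivative_iff_has_vector_derivative)

lemma v_minus_Im_dxx: "y > 0 \<Longrightarrow> ((\<lambda>x. Im (comb_dev (Complex x y))) has_real_derivative Im (deriv comb_dev (Complex x y))) (at x)"
  using bounded_linear.has_vector_derivative[OF bounded_linear_Im horizontal_derivative[OF comb_dev_holomorphic, of y x]]
  by (simp add: has_real_derivative_iff_has_vector_derivative)

lemma symmetric_derivative_zero:
  fixes g :: "real \<Rightarrow> real"
  assumes "(g has_real_derivative d) (at c)" "\<And>x. g (2 * c - x) = g x"
  shows "d = 0"
proof -
  have "((\<lambda>x. g (2 * c - x)) has_real_derivative d * (- 1)) (at c)"
    by (rule DERIV_chain2) (use assms(1) in \<open>auto intro!: derivative_eq_intros\<close>)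
  then have "(g has_real_derivative d * (- 1)) (at c)" using assms(2) by simp
  then have "d = d * (- 1)" using assms(1) DERIV_unique by blast
  then show ?thesis by simp
qed

text \<open>v is even about both vertical sides, so its horizontal derivative vanishes there. This
  Neumann condition removes the side terms from Green's identity.\<close>

lemma comb_dev_sides:
  assumes "y > 0"
  shows "Im (comb_dev (Complex 0 y)) = 0" "Im (comb_dev (Complex pi y)) = 0"
proof -
  have "v (Complex (2 * 0 - x) y) = v (Complex x y)" for x
  proof -
    have "Complex (2 * pi - x) y = Complex (- x) y + 2 * of_real pi" by (simp add: complex_eq_iff)
    then show ?thesis using v_Complex_sym[of x y] v_periodic[of "Complex (- x) y"] by simp
  qed
  then show "Im (comb_dev (Complex 0 y)) = 0"
    by (intro symmetric_derivative_zero[OF v_minus_Im_dx[OF assms]]) auto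
  show "Im (comb_dev (Complex pi y)) = 0"
    by (intro symmetric_derivative_zero[OF v_minus_Im_dx[OF assms]]) (simp add: v_Complex_sym)
qed

lemma continuous_on_box:
  assumes "h holomorphic_on upper_half" "y1 > 0"
  shows "continuous_on (cbox (x1, y1) (x2, y2)) (\<lambda>p. h (Complex (fst p) (snd p)))"
proof (rule continuous_on_compose2[OF holomorphic_on_imp_continuous_on[OF assms(1)]])
  show "continuous_on (cbox (x1, y1) (x2, y2)) (\<lambda>p. Complex (fst p) (snd p))"
    by (intro continuous_intros)
  show "(\<lambda>p. Complex (fst p) (snd p)) ` cbox (x1, y1) (x2, y2) \<subseteq> upper_half"
    using assms(2) by (auto simp: upper_half_def cbox_Pair_eq)
qed

text \<open>The integral of f f_y along the horizontal segment at height y, where f = v - Im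
  z.\<close>

definition boundary_term :: "real \<Rightarrow> real" where
  "boundary_term y = integral (cbox 0 pi) (\<lambda>x. (v (Complex x y) - y) * Re (comb_dev (Complex x y)))"

lemma boundary_term_integrable:
  assumes "y > 0"
  shows "(\<lambda>x. (v (Complex x y) - y) * Re (comb_dev (Complex x y))) integrable_on cbox 0 pi"
proof -
  have "continuous_on (cbox 0 pi) (\<lambda>x. comb_dev (Complex x y))"
    using horizontal_derivative[OF comb_dev_holomorphic assms]
    by (intro continuous_at_imp_continuous_on ballI) (rule has_vector_derivative_continuous)
  moreover have "continuous_on (cbox 0 pi) (\<lambda>x. v (Complex x y) - y)"
    using v_minus_Im_dx[OF assms] by (intro continuous_at_imp_continuous_on ballI DERIV_isCont)
  ultimately show ?thesis by (intro integrable_continuous continuous_on_mult continuous_on_Re)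
qed

text \<open>Green's identity for the harmonic function f = v - Im z. The integrands
  \<open>g1\<close> and \<open>g2\<close> are the y-derivative of f f_y and the x-derivative of f
  f_x; in their sum the second derivatives cancel.\<close>

lemma energy_box:
  assumes y: "0 < y1" "y1 \<le> y2"
  shows "integral (cbox (0, y1) (pi, y2)) (\<lambda>p. (cmod (comb_dev (Complex (fst p) (snd p))))\<^sup>2) = boundary_term y2 - boundary_term y1"
proof -
  let ?B = "cbox (0, y1) (pi, y2)"
  define f where "f x y = v (Complex x y) - y" for x y
  define g1 where "g1 x y = (Re (comb_dev (Complex x y)))\<^sup>2 + f x y * (- Im (deriv comb_dev (Complex x y)))" for x y
  define g2 where "g2 x y = (Im (comb_dev (Complex x y)))\<^sup>2 + f x y * Im (deriv comb_dev (Complex x y))" for x y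
  have E': "deriv comb_dev holomorphic_on upper_half" by (intro holomorphic_deriv comb_dev_holomorphic upper_half(1))
  have cf: "continuous_on ?B (\<lambda>p. f (fst p) (snd p))"
    unfolding f_def
    by (intro continuous_on_diff continuous_on_compose2[OF continuous_on_v[of UNIV]] continuous_intros) auto
  have c1: "continuous_on ?B (\<lambda>p. g1 (fst p) (snd p))"
    unfolding g1_def by (intro continuous_intros cf continuous_on_box comb_dev_holomorphic E' y)
  have c2: "continuous_on ?B (\<lambda>p. g2 (fst p) (snd p))"
    unfolding g2_def by (intro continuous_intros cf continuous_on_box comb_dev_holomorphic E' y)
  have i1: "integral ?B (\<lambda>p. g1 (fst p) (snd p)) = boundary_term y2 - boundary_term y1"
  proof -
    have "integral (cbox y1 y2) (\<lambda>y. g1 x y) = f x y2 * Re (comb_dev (Complex x y2)) - f x y1 * Re (comb_dev (Complex x y1))" for x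
    proof -
      have "((\<lambda>y. g1 x y) has_integral f x y2 * Re (comb_dev (Complex x y2)) - f x y1 * Re (comb_dev (Complex x y1))) {y1..y2}"
      proof (rule fundamental_theorem_of_calculus[OF y(2)])
        fix t assume "t \<in> {y1..y2}"
        then have t: "t > 0" using y by simp
        have "((\<lambda>y. f x y * Re (comb_dev (Complex x y))) has_real_derivative g1 x t) (at t)"
          unfolding f_def g1_def
          by (rule DERIV_cong[OF DERIV_mult[OF v_minus_Im_dy[OF t] v_minus_Im_dyy[OF t]]]) (simp add: power2_eq_square algebra_simps)
        then show "((\<lambda>y. f x y * Re (comb_dev (Complex x y))) has_vector_derivative g1 x t) (at t within {y1..y2})"
          by (auto simp: has_real_derivative_iff_has_vector_derivative intro: has_vector_derivative_at_within)
      qed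
      then show ?thesis by (simp add: integral_unique)
    qed
    then have "integral ?B (\<lambda>p. g1 (fst p) (snd p)) = integral (cbox 0 pi) (\<lambda>x. f x y2 * Re (comb_dev (Complex x y2)) - f x y1 * Re (comb_dev (Complex x y1)))"
      using integral_prod_continuous[OF c1] by simp
    also have "\<dots> = boundary_term y2 - boundary_term y1"
      unfolding boundary_term_def f_def using y by (intro integral_diff boundary_term_integrable) auto
    finally show ?thesis .
  qed
  have i2: "integral ?B (\<lambda>p. g2 (fst p) (snd p)) = 0"
  proof -
    have z: "integral (cbox 0 pi) (\<lambda>x. g2 x t) = 0" if "t \<in> cbox y1 y2" for t
    proof -
      have t: "t > 0" using that y by simp
      have "((\<lambda>x. g2 x t) has_integral f pi t * Im (comb_dev (Complex pi t)) - f 0 t * Im (comb_dev (Complex 0 t))) {0..pi}"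
      proof (rule fundamental_theorem_of_calculus)
        fix x :: real
        have "((\<lambda>x. f x t * Im (comb_dev (Complex x t))) has_real_derivative g2 x t) (at x)"
          unfolding f_def g2_def
          by (rule DERIV_cong[OF DERIV_mult[OF v_minus_Im_dx[OF t] v_minus_Im_dxx[OF t]]]) (simp add: power2_eq_square algebra_simps)
        then show "((\<lambda>x. f x t * Im (comb_dev (Complex x t))) has_vector_derivative g2 x t) (at x within {0..pi})"
          by (auto simp: has_real_derivative_iff_has_vector_derivative intro: has_vector_derivative_at_within)
      qed simp
      then show ?thesis using comb_dev_sides[OF t] by (simp add: integral_unique)
    qed
    have "integral ?B (\<lambda>p. g2 (fst p) (snd p)) = integral (cbox 0 pi) (\<lambda>x. integral (cbox y1 y2) (g2 x))"
      using integral_prod_continuous[OF c2] by simp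
    also have "\<dots> = integral (cbox y1 y2) (\<lambda>y. integral (cbox 0 pi) (\<lambda>x. g2 x y))"
      by (rule integral_swap_continuous) (use c2 in \<open>simp add: case_prod_beta'\<close>)
    also have "\<dots> = integral (cbox y1 y2) (\<lambda>y. 0)" by (rule integral_cong) (rule z)
    finally show ?thesis by simp
  qed
  have "(cmod (comb_dev (Complex x y)))\<^sup>2 = g1 x y + g2 x y" for x y
    by (simp add: g1_def g2_def cmod_power2)
  then have "integral ?B (\<lambda>p. (cmod (comb_dev (Complex (fst p) (snd p))))\<^sup>2) =
     integral ?B (\<lambda>p. g1 (fst p) (snd p)) + integral ?B (\<lambda>p. g2 (fst p) (snd p))"
    using integral_add[OF integrable_continuous[OF c1] integrable_continuous[OF c2]] by simp
  then show ?thesis using i1 i2 by simp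
qed

lemma comb_dev_exp:
  assumes "z \<in> upper_half"
  shows "comb_dev z = - (exp (\<i> * z) * deriv L (exp (\<i> * z))) / of_nat q"
proof -
  have "cmod (exp (\<i> * z)) < 1" using assms by (simp add: upper_half_def)
  then have "(L has_field_derivative deriv L (exp (\<i> * z))) (at (exp (\<i> * z)))"
    by (intro holomorphic_derivI[OF L_holomorphic]) auto
  moreover have "((\<lambda>z. exp (\<i> * z)) has_field_derivative \<i> * exp (\<i> * z)) (at z)"
    by (auto intro!: derivative_eq_intros)
  ultimately have "((\<lambda>z. L (exp (\<i> * z))) has_field_derivative deriv L (exp (\<i> * z)) * (\<i> * exp (\<i> * z))) (at z)"
    by (rule DERIV_chain2)
  then have "(comb_map has_field_derivative 1 + \<i> / of_nat q * (deriv L (exp (\<i> * z)) * (\<i> * exp (\<i> * z)))) (at z)"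
    unfolding comb_map_def[abs_def] by (intro DERIV_add DERIV_cmult DERIV_ident)
  then have "deriv comb_map z = 1 + \<i> / of_nat q * (deriv L (exp (\<i> * z)) * (\<i> * exp (\<i> * z)))"
    by (rule DERIV_imp_deriv)
  then show ?thesis by (simp add: comb_dev_def algebra_simps)
qed

text \<open>At the lower side f >= 0 and f_y = Re k' - 1 >= -1, so - f f_y is at most f, whose
  integral is the same at every height.\<close>

lemma boundary_term_lower:
  assumes "y > 0"
  shows "- boundary_term y \<le> pi * ln K"
proof -
  have "- boundary_term y = integral (cbox 0 pi) (\<lambda>x. - ((v (Complex x y) - y) * Re (comb_dev (Complex x y))))"
    unfolding boundary_term_def by simp
  also have "\<dots> \<le> integral (cbox 0 pi) (\<lambda>x. v (Complex x y) - y)"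
  proof (rule integral_le)
    show "(\<lambda>x. - ((v (Complex x y) - y) * Re (comb_dev (Complex x y)))) integrable_on cbox 0 pi"
      by (intro integrable_neg boundary_term_integrable assms)
    show "(\<lambda>x. v (Complex x y) - y) integrable_on cbox 0 pi"
      using v_mean(1)[OF assms] by auto
    fix x :: real
    have "v (Complex x y) - y \<ge> 0" using v_ge_Im[of "Complex x y"] assms by simp
    moreover have "Re (comb_dev (Complex x y)) \<ge> -1"
      using Re_deriv_comb_map_nonneg[OF Complex_upper_half[OF assms, of x]] by (simp add: comb_dev_def)
    ultimately show "- ((v (Complex x y) - y) * Re (comb_dev (Complex x y))) \<le> v (Complex x y) - y"
      using mult_left_mono[of "-1" "Re (comb_dev (Complex x y))" "v (Complex x y) - y"] by simp
  qed
  also have "\<dots> = pi * ln K" using v_mean(1)[OF assms] by (simp add: integral_unique)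
  finally show ?thesis .
qed

text \<open>The upper side is pushed to infinity: k' - 1 = - \<zeta> L'(\<zeta>) / q tends to 0 with
  \<zeta>, and the term at the top drops below any \<epsilon>.\<close>

lemma energy_box_le:
  assumes y: "0 < y1" "y1 \<le> y2"
  shows "integral (cbox (0, y1) (pi, y2)) (\<lambda>p. (cmod (comb_dev (Complex (fst p) (snd p))))\<^sup>2) \<le> pi * ln K"
proof (rule field_le_epsilon)
  fix \<epsilon> :: real assume \<epsilon>: "\<epsilon> > 0"
  have Q: "pi * ln K \<ge> 0"
    using has_integral_nonneg[OF v_mean(1)[of 1]] v_ge_Im[of "Complex _ 1"] by auto
  define e where "e = \<epsilon> / (pi * ln K + 1)"
  have e: "e > 0" "e * (pi * ln K) \<le> \<epsilon>" using \<epsilon> Q by (auto simp: e_def divide_simps mult_left_mono)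
  have "isCont (\<lambda>\<zeta>. \<zeta> * deriv L \<zeta>) 0"
    using holomorphic_on_imp_continuous_on[OF holomorphic_deriv[OF L_holomorphic open_ball]]
    by (intro continuous_intros) (simp add: continuous_on_eq_continuous_at)
  then obtain d where d: "d > 0" "\<And>\<zeta>. cmod \<zeta> < d \<Longrightarrow> cmod (\<zeta> * deriv L \<zeta>) < e"
    using e(1) unfolding continuous_at_eps_delta by (metis dist_norm diff_zero mult_zero_left)
  define Y where "Y = max y2 (1 - ln d)"
  have Y: "0 < Y" "y1 \<le> Y" "y2 \<le> Y" using y by (auto simp: Y_def)
  have small: "cmod (comb_dev (Complex x Y)) \<le> e" for x
  proof -
    have "- Y < ln d" by (auto simp: Y_def max_def)
    then have "exp (- Y) < d" using d(1) by (metis exp_less_mono exp_ln)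
    then have "cmod (exp (\<i> * Complex x Y)) < d" by simp
    from d(2)[OF this] have "cmod (comb_dev (Complex x Y)) * real q \<le> e"
      unfolding comb_dev_exp[OF Complex_upper_half[OF Y(1)]] using q_pos by (simp add: norm_divide norm_mult)
    moreover have "cmod (comb_dev (Complex x Y)) * 1 \<le> cmod (comb_dev (Complex x Y)) * real q"
      using q2 by (intro mult_left_mono) auto
    ultimately show ?thesis by simp
  qed
  have "boundary_term Y \<le> integral (cbox 0 pi) (\<lambda>x. e * (v (Complex x Y) - Y))"
    unfolding boundary_term_def
  proof (rule integral_le[OF boundary_term_integrable[OF Y(1)]])
    show "(\<lambda>x. e * (v (Complex x Y) - Y)) integrable_on cbox 0 pi"
      using has_integral_mult_right[OF v_mean(1)[OF Y(1)], of e] by auto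
    fix x :: real
    have "v (Complex x Y) - Y \<ge> 0" using v_ge_Im[of "Complex x Y"] Y by simp
    moreover have "Re (comb_dev (Complex x Y)) \<le> e" using small[of x] complex_Re_le_cmod[of "comb_dev (Complex x Y)"] by linarith
    ultimately show "(v (Complex x Y) - Y) * Re (comb_dev (Complex x Y)) \<le> e * (v (Complex x Y) - Y)"
      using mult_left_mono[of "Re (comb_dev (Complex x Y))" e "v (Complex x Y) - Y"] by (simp add: mult.commute)
  qed
  also have "\<dots> = e * (pi * ln K)" using v_mean(1)[OF Y(1)] by (simp add: integral_unique)
  finally have PY: "boundary_term Y \<le> \<epsilon>" using e(2) by simp
  have c: "continuous_on (cbox (0, y1) (pi, Y)) (\<lambda>p. (cmod (comb_dev (Complex (fst p) (snd p))))\<^sup>2)"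
    by (intro continuous_intros continuous_on_box comb_dev_holomorphic y)
  have sub: "cbox (0::real, y1) (pi, y2) \<subseteq> cbox (0, y1) (pi, Y)" using Y by (auto simp: cbox_Pair_eq)
  have "integral (cbox (0, y1) (pi, y2)) (\<lambda>p. (cmod (comb_dev (Complex (fst p) (snd p))))\<^sup>2)
    \<le> integral (cbox (0, y1) (pi, Y)) (\<lambda>p. (cmod (comb_dev (Complex (fst p) (snd p))))\<^sup>2)"
    by (rule integral_subset_le[OF sub]) (use c sub in \<open>auto intro!: integrable_continuous intro: continuous_on_subset\<close>)
  also have "\<dots> = boundary_term Y - boundary_term y1" by (rule energy_box[OF y(1) Y(2)])
  also have "\<dots> \<le> pi * ln K + \<epsilon>" using PY boundary_term_lower[OF y(1)] by simp
  finally show "integral (cbox (0, y1) (pi, y2)) (\<lambda>p. (cmod (comb_dev (Complex (fst p) (snd p))))\<^sup>2) \<le> pi * ln K + \<epsilon>" .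
qed

end

section \<open>Plane change of variables and a length-area estimate beside a slit\<close>

no_notation fps_nth (infixl \<open>$\<close> 75)

text \<open>Iterated integration is done on pairs, the Jacobian formula on \<open>real^2\<close>;
  this carries integrals over boxes from the one to the other.\<close>

lemma has_integral_real2:
  fixes F :: "real \<times> real \<Rightarrow> real"
  assumes "(F has_integral I) (cbox (a, c) (b, d))"
  shows "((\<lambda>z::real^2. F (z $ 1, z $ 2)) has_integral I) (cbox (vector [a, c]) (vector [b, d]))"
proof -
  define g :: "real^2 \<Rightarrow> real \<times> real" where "g z = (z $ 1, z $ 2)" for z
  define h :: "real \<times> real \<Rightarrow> real^2" where "h p = vector [fst p, snd p]" for p
  have hg: "h (g z) = z" for z by (simp add: h_def g_def vec_eq_iff forall_2)
  have gh: "g (h p) = p" for p by (simp add: h_def g_def)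
  have comb_inv: "g ` cbox u v = cbox (u $ 1, u $ 2) (v $ 1, v $ 2)" for u v
  proof -
    have "p \<in> g ` cbox u v" if "p \<in> cbox (u $ 1, u $ 2) (v $ 1, v $ 2)" for p
      by (rule image_eqI[of _ _ "h p"]) (use that gh in \<open>auto simp: h_def mem_box_cart forall_2 cbox_Pair_eq\<close>)
    then show ?thesis by (auto simp: g_def mem_box_cart forall_2 cbox_Pair_eq)
  qed
  have hi: "h ` cbox (a, c) (b, d) = cbox (vector [a, c]) (vector [b, d])" for a b c d
  proof -
    have "g ` cbox (vector [a, c]) (vector [b, d]) = cbox (a, c) (b, d)" unfolding comb_inv by simp
    then have "h ` g ` cbox (vector [a, c]) (vector [b, d]) = h ` cbox (a, c) (b, d)" by simp
    then show ?thesis by (simp add: image_image hg)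
  qed
  have "((\<lambda>x. F (g x)) has_integral (1 / 1) *\<^sub>R I) (h ` cbox (a, c) (b, d))"
  proof (rule has_integral_twiddle)
    show "continuous (at x) g" for x unfolding g_def by (intro continuous_intros)
    show "\<exists>w z. g ` cbox u v = cbox w z" for u v using comb_inv by blast
    show "\<exists>w z. h ` cbox u v = cbox w z" for u v using hi[of "fst u" "snd u" "fst v" "snd v"] by auto
    show "measure lborel (g ` cbox u v) = 1 * measure lborel (cbox u v)" for u v :: "real^2"
    proof (cases "cbox u v = {}")
      case True
      then show ?thesis by simp
    next
      case False
      then have le: "u $ 1 \<le> v $ 1" "u $ 2 \<le> v $ 2" unfolding interval_ne_empty_cart by auto
      have "measure lborel (cbox u v) = (v $ 1 - u $ 1) * (v $ 2 - u $ 2)"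
        unfolding content_cbox_cart[OF False] by (simp add: UNIV_2)
      then show ?thesis unfolding comb_inv content_Pair using le by simp
    qed
  qed (use assms hg gh in auto)
  then show ?thesis by (simp add: hi g_def)
qed

lemma change_of_variables_real2:
  fixes f :: "real^2 \<Rightarrow> real" and g :: "real^2 \<Rightarrow> real^2"
  assumes "S \<in> sets lebesgue" and "\<And>x. x \<in> S \<Longrightarrow> (g has_derivative g' x) (at x within S)" and "inj_on g S"
    and "(\<lambda>x. \<bar>det (matrix (g' x))\<bar> * f (g x)) absolutely_integrable_on S"
    and "((\<lambda>x. \<bar>det (matrix (g' x))\<bar> * f (g x)) has_integral b) S"
  shows "(f has_integral b) (g ` S)"
proof -
  have "(\<lambda>x. \<bar>det (matrix (g' x))\<bar> *\<^sub>R vec (f (g x)) :: real ^ 1) absolutely_integrable_on S \<and>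
           integral S (\<lambda>x. \<bar>det (matrix (g' x))\<bar> *\<^sub>R vec (f (g x))) = (vec b :: real ^ 1)
         \<longleftrightarrow> (\<lambda>x. vec (f x) :: real ^ 1) absolutely_integrable_on (g ` S) \<and>
           integral (g ` S) (\<lambda>x. vec (f x)) = (vec b :: real ^ 1)"
    by (intro has_absolute_integral_change_of_variables assms(1,2,3)) auto
  then have "f absolutely_integrable_on (g ` S) \<and> integral (g ` S) f = b"
    using assms(4,5) by (simp add: absolutely_integrable_on_1_iff integral_on_1_eq integral_unique)
  then show ?thesis
    using set_lebesgue_integral_eq_integral(1) has_integral_integrable_integral by blast
qed

text \<open>The Jacobian of a plane map whose two partial derivatives are the complex numbers
  \<alpha> and \<beta>.\<close>

lemma det_matrix_complex_linear:
  "det (matrix (\<lambda>w::real^2. vector [Re (\<alpha> * of_real (w $ 1) + \<beta> * of_real (w $ 2)),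
      Im (\<alpha> * of_real (w $ 1) + \<beta> * of_real (w $ 2))] :: real^2)) = Re \<alpha> * Im \<beta> - Re \<beta> * Im \<alpha>"
  by (simp add: det_2 matrix_def axis_def)

text \<open>Cauchy-Schwarz on an interval of length at most 1, in the form 2 \<Delta> m - \<Delta>^2
  <= m^2, integrated.\<close>

lemma integral_square_lower:
  fixes \<phi> :: "real \<Rightarrow> real"
  assumes ab: "a < b" "b - a \<le> 1" and d: "\<And>t. t \<in> {a..b} \<Longrightarrow> (\<phi> has_real_derivative \<phi>' t) (at t)"
    and le: "\<And>t. t \<in> {a..b} \<Longrightarrow> \<bar>\<phi>' t\<bar> \<le> C * m t" and C: "C > 0" and m: "continuous_on {a..b} m"
  shows "(\<phi> a - \<phi> b)\<^sup>2 / C\<^sup>2 \<le> integral {a..b} (\<lambda>t. (m t)\<^sup>2)"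
proof -
  define \<Delta> where "\<Delta> = \<bar>\<phi> a - \<phi> b\<bar> / C"
  have hi: "(\<phi>' has_integral (\<phi> b - \<phi> a)) {a..b}"
    using ab d by (intro fundamental_theorem_of_calculus)
      (auto simp: has_real_derivative_iff_has_vector_derivative intro: has_vector_derivative_at_within)
  have mi: "m integrable_on {a..b}" "(\<lambda>t. (m t)\<^sup>2) integrable_on {a..b}"
    using m by (auto intro!: integrable_continuous_real continuous_intros)
  have "norm (integral {a..b} \<phi>') \<le> integral {a..b} (\<lambda>t. C * m t)"
    by (rule integral_norm_bound_integral) (use hi has_integral_mult_right[OF integrable_integral[OF mi(1)], of C] le in auto)
  then have "\<bar>\<phi> a - \<phi> b\<bar> \<le> C * integral {a..b} m"
    using hi has_integral_mult_right[OF integrable_integral[OF mi(1)], of C]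
    by (simp add: integral_unique abs_minus_commute)
  then have D: "\<Delta> \<le> integral {a..b} m" using C by (simp add: \<Delta>_def field_simps)
  have D0: "\<Delta> \<ge> 0" using C by (simp add: \<Delta>_def)
  have "((\<lambda>t. 2 * \<Delta> * m t - \<Delta>\<^sup>2) has_integral (2 * \<Delta> * integral {a..b} m - (b - a) * \<Delta>\<^sup>2)) {a..b}"
    using has_integral_diff[OF has_integral_mult_right[OF integrable_integral[OF mi(1)]] has_integral_const_real[of "\<Delta>\<^sup>2" a b]] ab
    by simp
  moreover have "2 * \<Delta> * m t - \<Delta>\<^sup>2 \<le> (m t)\<^sup>2" for t
    using zero_le_power2[of "m t - \<Delta>"] by (simp add: power2_diff algebra_simps)
  ultimately have "2 * \<Delta> * integral {a..b} m - (b - a) * \<Delta>\<^sup>2 \<le> integral {a..b} (\<lambda>t. (m t)\<^sup>2)"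
    using mi(2) by (meson has_integral_le integrable_integral)
  moreover have "\<Delta> * \<Delta> \<le> \<Delta> * integral {a..b} m" using D D0 by (intro mult_left_mono)
  moreover have "(b - a) * \<Delta>\<^sup>2 \<le> 1 * \<Delta>\<^sup>2" using ab by (intro mult_right_mono) auto
  ultimately have "\<Delta>\<^sup>2 \<le> integral {a..b} (\<lambda>t. (m t)\<^sup>2)" by (simp add: power2_eq_square)
  then show ?thesis by (simp add: \<Delta>_def power_divide)
qed

context comb
begin

definition of_vec2 :: "real^2 \<Rightarrow> complex" where "of_vec2 z = Complex (z $ 1) (z $ 2)"

lemma of_vec2_vector [simp]: "of_vec2 (vector [Re z, Im z]) = z"
  by (simp add: of_vec2_def)

text \<open>The triangle has as vertices the foot of the slit, its tip and foot + \<sigma> d. On a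
  segment parallel to the hypotenuse, from slit to base, Im \<kappa> - Im z falls from about the
  starting height to about zero or less, since Im z is nearly 0 at the slit. So |1 - dz/d\<kappa>|^2
  has mean at least about H^2 / (H^2 + d^2) >= 4/5 there, and conformal invariance turns this into
  energy of k - z on the preimage.\<close>

lemma triangle_energy:
  assumes n: "1 \<le> n" "n < q" and x: "\<alpha> n < x" "x < \<beta> n" "v (of_real x) = H"
    and \<sigma>: "\<sigma> = 1 \<or> \<sigma> = -1" and d: "0 < d" "d \<le> H / 2" "d \<le> pi / real q / 2"
  obtains S I where "compact S" "S \<noteq> {}" "\<And>z. z \<in> S \<Longrightarrow> of_vec2 z \<in> half_strip"
    "\<And>z. z \<in> S \<Longrightarrow> 0 < \<sigma> * (Re (comb_map (of_vec2 z)) - pi * real n / real q) \<and>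
       \<sigma> * (Re (comb_map (of_vec2 z)) - pi * real n / real q) < pi / real q / 2"
    "((\<lambda>z. (cmod (comb_dev (of_vec2 z)))\<^sup>2) has_integral I) S" "I \<ge> d * H / 3"
proof -
  have H: "H > 0" using v_gap_pos[OF n x(1,2)] x(3) by simp
  define u0 where "u0 = pi * real n / real q"
  \<comment> \<open>Margin by which the triangle is shrunk to a compact piece. Without truncation
    the estimate would be 2/5 d H; one per cent leaves d H / 3.\<close>
  define \<eta> :: real where "\<eta> = 1 / 100"
  have \<eta>: "\<eta> > 0" by (simp add: \<eta>_def)
  obtain \<delta>' where \<delta>': "\<delta>' > 0" "\<And>z t. z \<in> half_strip \<Longrightarrow> \<eta> * H / 2 \<le> t \<Longrightarrow> t \<le> (1 - \<eta>) * H \<Longrightarrow>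
      cmod (comb_map z - Complex u0 t) < \<delta>' \<Longrightarrow> Im z < \<eta> * H / 100"
    unfolding u0_def
    by (rule comb_inv_near_slit[OF n x, of "\<eta> * H / 2" "(1 - \<eta>) * H" "\<eta> * H / 100"]) (use H \<eta> in auto)
  \<comment> \<open>The truncated segments start at horizontal distance at most \<delta> d from the
    slit, which \<delta>' makes close enough to control Im z.\<close>
  define \<delta> where "\<delta> = min (1 / 100) (\<delta>' / (2 * d))"
  have \<delta>: "0 < \<delta>" "\<delta> \<le> 1 / 100" "\<delta> * d < \<delta>'"
  proof -
    show "0 < \<delta>" "\<delta> \<le> 1 / 100" using \<delta>' d by (auto simp: \<delta>_def)
    have "\<delta> \<le> \<delta>' / (2 * d)" by (simp add: \<delta>_def)
    then have "\<delta> * d \<le> \<delta>' / 2" using d by (simp add: field_simps)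
    then show "\<delta> * d < \<delta>'" using \<delta>'(1) by simp
  qed
  \<comment> \<open>The triangle on the right of slit n lies in strip n, the one on the left in
    strip n - 1.\<close>
  define m where "m = (if \<sigma> = 1 then n else n - 1)"
  have m: "m < q" using n by (auto simp: m_def)
  \<comment> \<open>Coordinates of the triangle: r is the scale measured from the foot, and t runs
    along the segment from the slit (t = 0) to the base (t = 1).\<close>
  define p where "p r t = Complex (u0 + \<sigma> * (r * t * d)) (r * (1 - t) * H)" for r t
  have rt: "0 < r * t * d" "r * t * d < pi / real q / 2" if "0 < r" "r < 1" "0 < t" "t < 1" for r t
  proof -
    show "0 < r * t * d" using that d by simp
    have "r * t < 1" using that mult_strict_mono[of r 1 t 1] by simp
    then have "r * t * d < 1 * d" using d(1) by (intro mult_strict_right_mono)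
    then show "r * t * d < pi / real q / 2" using d(3) by simp
  qed
  have p_side: "\<sigma> * (Re (p r t) - u0) = r * t * d" for r t using \<sigma> by (auto simp: p_def)
  have p_strip: "p r t \<in> strip m" if "0 < r" "r < 1" "0 < t" "t < 1" for r t
  proof -
    have "u0 = pi * real (n - 1) / real q + pi / real q"
      using n by (simp add: u0_def of_nat_diff field_simps)
    moreover have "pi * real (Suc n) / real q = u0 + pi / real q" by (simp add: u0_def distrib_left add_divide_distrib)
    moreover have "pi * real (Suc (n - 1)) / real q = u0" using n by (simp add: u0_def)
    moreover have "pi / real q > 0" using q_pos by simp
    ultimately show ?thesis
      using rt[OF that] that H \<sigma> by (auto simp: strip_def m_def p_def u0_def[symmetric])
  qed
  have gOm: "comb_inv (p r t) \<in> half_strip" and kg: "comb_map (comb_inv (p r t)) = p r t" if "0 < r" "r < 1" "0 < t" "t < 1" for r t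
    using strip_comb_inv[OF m p_strip[OF that]] by auto
  define K where "K = cbox (vector [\<eta>, \<delta>]) (vector [1 - \<eta>, 1 - \<delta>] :: real^2)"
  have K: "\<eta> \<le> z $ 1 \<and> z $ 1 \<le> 1 - \<eta> \<and> \<delta> \<le> z $ 2 \<and> z $ 2 \<le> 1 - \<delta>" if "z \<in> K" for z
    using that by (auto simp: K_def mem_box_cart forall_2)
  have K': "0 < z $ 1 \<and> z $ 1 < 1 \<and> 0 < z $ 2 \<and> z $ 2 < 1" if "z \<in> K" for z
    using K[OF that] \<eta> \<delta> by auto
  define G :: "real^2 \<Rightarrow> real^2" where "G z = vector [Re (comb_inv (p (z $ 1) (z $ 2))), Im (comb_inv (p (z $ 1) (z $ 2)))]" for z
  have c2G: "of_vec2 (G z) = comb_inv (p (z $ 1) (z $ 2))" for z by (simp add: G_def)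
  define g1 where "g1 r t = deriv comb_inv (p r t)" for r t
  define pr where "pr r t = Complex (\<sigma> * t * d) ((1 - t) * H)" for r t :: real
  define pt where "pt r t = Complex (\<sigma> * r * d) (- r * H)" for r t :: real
  define G' :: "real^2 \<Rightarrow> real^2 \<Rightarrow> real^2" where
    "G' z w = vector [Re (g1 (z$1) (z$2) * pr (z$1) (z$2) * of_real (w $ 1) + g1 (z$1) (z$2) * pt (z$1) (z$2) * of_real (w $ 2)),
      Im (g1 (z$1) (z$2) * pr (z$1) (z$2) * of_real (w $ 1) + g1 (z$1) (z$2) * pt (z$1) (z$2) * of_real (w $ 2))]" for z w
  have op: "open (comb_map ` upper_half)" by (rule open_mapping_thm3[OF comb_map_holomorphic upper_half(1) comb_map_inj])
  have p_im: "p r t \<in> comb_map ` upper_half" if "0 < r" "r < 1" "0 < t" "t < 1" for r t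
    using gOm[OF that] kg[OF that] half_strip(2) by (metis image_eqI subsetD)
  have gd: "(comb_inv has_field_derivative g1 r t) (at (p r t))" if "0 < r" "r < 1" "0 < t" "t < 1" for r t
    unfolding g1_def by (rule holomorphic_derivI[OF comb_inv_holomorphic op p_im[OF that]])
  have der: "(G has_derivative G' z) (at z within K)" if z: "z \<in> K" for z
  proof -
    have pd: "((\<lambda>w. p (w $ 1) (w $ 2)) has_derivative (\<lambda>w. pr (z$1) (z$2) * of_real (w $ 1) + pt (z$1) (z$2) * of_real (w $ 2))) (at z within K)"
    proof -
      have e: "p (w $ 1) (w $ 2) = of_real (u0 + \<sigma> * (w $ 1 * w $ 2 * d)) + \<i> * of_real (w $ 1 * (1 - w $ 2) * H)" for w :: "real^2"
        by (simp add: p_def complex_eq_iff)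
      have dn: "((\<lambda>x::real^2. x $ i) has_derivative (\<lambda>x. x $ i)) (at z within K)" for i
        by (rule bounded_linear_imp_has_derivative[OF bounded_linear_vec_nth])
      show ?thesis unfolding e pr_def pt_def
        by (auto intro!: derivative_eq_intros dn simp: fun_eq_iff complex_eq_iff algebra_simps)
    qed
    have "(comb_inv has_derivative (\<lambda>w. g1 (z$1) (z$2) * w)) (at (p (z$1) (z$2)) within (\<lambda>w. p (w $ 1) (w $ 2)) ` K)"
      using gd[of "z$1" "z$2"] K'[OF z] has_derivative_at_withinI unfolding has_field_derivative_def by blast
    from has_derivative_in_compose[OF pd this]
    have gp: "((\<lambda>w. comb_inv (p (w $ 1) (w $ 2))) has_derivative (\<lambda>w. g1 (z$1) (z$2) * pr (z$1) (z$2) * of_real (w $ 1) + g1 (z$1) (z$2) * pt (z$1) (z$2) * of_real (w $ 2))) (at z within K)"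
      by (simp add: algebra_simps)
    show ?thesis
    proof (rule has_derivative_componentwise_within[THEN iffD2], rule ballI)
      fix i :: "real^2" assume "i \<in> Basis"
      then obtain j where i: "i = axis j 1" by (auto simp: Basis_vec_def)
      have "j = 1 \<or> j = 2" by (rule exhaust_2)
      then show "((\<lambda>x. G x \<bullet> i) has_derivative (\<lambda>x. G' z x \<bullet> i)) (at z within K)"
        using has_derivative_Re[OF gp] has_derivative_Im[OF gp]
        by (auto simp: i G_def G'_def inner_axis)
    qed
  qed
  have inj: "inj_on G K"
  proof (rule inj_onI)
    fix z w assume zw: "z \<in> K" "w \<in> K" "G z = G w"
    then have "comb_inv (p (z$1) (z$2)) = comb_inv (p (w$1) (w$2))" using c2G by metis
    then have "p (z$1) (z$2) = p (w$1) (w$2)" using kg K'[OF zw(1)] K'[OF zw(2)] by metis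
    then have 1: "z $ 1 * z $ 2 * d = w $ 1 * w $ 2 * d" and 2: "z $ 1 * (1 - z $ 2) * H = w $ 1 * (1 - w $ 2) * H"
      using \<sigma> by (auto simp: p_def)
    then have "z $ 1 * z $ 2 = w $ 1 * w $ 2" "z $ 1 * (1 - z $ 2) = w $ 1 * (1 - w $ 2)" using d H by auto
    then have "z $ 1 = w $ 1" by (simp add: algebra_simps)
    moreover from this have "z $ 2 = w $ 2" using \<open>z $ 1 * z $ 2 = w $ 1 * w $ 2\<close> K'[OF zw(1)] by auto
    ultimately show "z = w" by (simp add: vec_eq_iff forall_2)
  qed
  define F where "F = (\<lambda>(r, t). r * (d * H) * (cmod (1 - g1 r t))\<^sup>2)"
  have g1k: "g1 r t * deriv comb_map (comb_inv (p r t)) = 1" if "0 < r" "r < 1" "0 < t" "t < 1" for r t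
    using comb_inv_deriv[of "comb_inv (p r t)"] gOm[OF that] half_strip(2) kg[OF that] by (auto simp: g1_def mult.commute)
  \<comment> \<open>Conformal invariance: |g'|^2 |k' - 1|^2 = |1 - g'|^2 for the inverse map g,
    while r d H is the Jacobian of the triangle coordinates.\<close>
  have detF: "\<bar>det (matrix (G' z))\<bar> * (cmod (comb_dev (of_vec2 (G z))))\<^sup>2 = F (z $ 1, z $ 2)" if z: "z \<in> K" for z
  proof -
    let ?r = "z $ 1" and ?t = "z $ 2"
    have k: "0 < ?r" "?r < 1" "0 < ?t" "?t < 1" using K'[OF z] by auto
    have "det (matrix (G' z)) = (cmod (g1 ?r ?t))\<^sup>2 * (Re (pr ?r ?t) * Im (pt ?r ?t) - Re (pt ?r ?t) * Im (pr ?r ?t))"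
      unfolding G'_def det_matrix_complex_linear by (simp add: cmod_power2) (simp add: power2_eq_square algebra_simps)
    also have "Re (pr ?r ?t) * Im (pt ?r ?t) - Re (pt ?r ?t) * Im (pr ?r ?t) = - \<sigma> * (?r * (d * H))"
      by (simp add: pr_def pt_def algebra_simps)
    finally have "\<bar>det (matrix (G' z))\<bar> = (cmod (g1 ?r ?t))\<^sup>2 * (?r * (d * H))"
      using \<sigma> k d H by (auto simp: abs_mult)
    moreover have "g1 ?r ?t * comb_dev (of_vec2 (G z)) = 1 - g1 ?r ?t"
      unfolding c2G comb_dev_def using g1k[OF k] by (simp add: algebra_simps)
    then have "cmod (g1 ?r ?t) * cmod (comb_dev (of_vec2 (G z))) = cmod (1 - g1 ?r ?t)" by (metis norm_mult)
    then have "(cmod (g1 ?r ?t))\<^sup>2 * (cmod (comb_dev (of_vec2 (G z))))\<^sup>2 = (cmod (1 - g1 ?r ?t))\<^sup>2"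
      by (metis power_mult_distrib)
    ultimately show ?thesis by (simp add: F_def algebra_simps)
  qed
  let ?C = "cbox (\<eta>, \<delta>) (1 - \<eta>, 1 - \<delta>)"
  have g1c: "continuous_on ?C (\<lambda>x. g1 (fst x) (snd x))"
    unfolding g1_def
  proof (rule continuous_on_compose2[OF holomorphic_on_imp_continuous_on[OF holomorphic_deriv[OF comb_inv_holomorphic op]]])
    show "continuous_on ?C (\<lambda>x. p (fst x) (snd x))" unfolding p_def by (intro continuous_intros)
    show "(\<lambda>x. p (fst x) (snd x)) ` ?C \<subseteq> comb_map ` upper_half"
      using \<eta> \<delta> by (auto simp: cbox_Pair_eq intro!: p_im)
  qed
  have Fc: "continuous_on ?C F"
    unfolding F_def case_prod_beta' by (intro continuous_intros g1c)
  define I where "I = integral ?C F"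
  have FI: "((\<lambda>z::real^2. F (z $ 1, z $ 2)) has_integral I) K"
    unfolding K_def I_def by (rule has_integral_real2) (rule integrable_integral[OF integrable_continuous[OF Fc]])
  have Fabs: "(\<lambda>z::real^2. F (z $ 1, z $ 2)) absolutely_integrable_on K"
    unfolding K_def
  proof (rule absolutely_integrable_continuous)
    show "continuous_on (cbox (vector [\<eta>, \<delta>]) (vector [1 - \<eta>, 1 - \<delta>])) (\<lambda>z::real^2. F (z $ 1, z $ 2))"
      by (rule continuous_on_compose2[OF Fc])
         (auto intro!: continuous_intros simp: mem_box_cart forall_2 cbox_Pair_eq)
  qed
  have res: "((\<lambda>z. (cmod (comb_dev (of_vec2 z)))\<^sup>2) has_integral I) (G ` K)"
  proof (rule change_of_variables_real2[OF _ der inj])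
    show "K \<in> sets lebesgue" by (simp add: K_def)
    show "(\<lambda>x. \<bar>det (matrix (G' x))\<bar> * (cmod (comb_dev (of_vec2 (G x))))\<^sup>2) absolutely_integrable_on K"
      using Fabs by (rule set_integrable_cong[THEN iffD1, rotated 3]) (use detF in auto)
    show "((\<lambda>x. \<bar>det (matrix (G' x))\<bar> * (cmod (comb_dev (of_vec2 (G x))))\<^sup>2) has_integral I) K"
      using FI by (rule has_integral_eq[rotated]) (simp add: detF)
  qed
  have comp: "compact (G ` K)"
  proof (rule compact_continuous_image)
    show "continuous_on K G" using der has_derivative_continuous_on by blast
  qed (simp add: K_def)
  have ne: "G ` K \<noteq> {}"
    using \<eta> \<delta> by (auto simp: K_def interval_ne_empty_cart forall_2 \<eta>_def)
  define lsq where "lsq = d\<^sup>2 + H\<^sup>2"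
  have lsq: "lsq > 0" "lsq \<le> 5 / 4 * H\<^sup>2"
  proof -
    show "lsq > 0" using H by (simp add: lsq_def sum_power2_gt_zero_iff)
    have "d\<^sup>2 \<le> (H / 2)\<^sup>2" using d by (intro power_mono) auto
    then show "lsq \<le> 5 / 4 * H\<^sup>2" by (simp add: lsq_def power_divide)
  qed
  have inner: "3 / 4 \<le> integral (cbox \<delta> (1 - \<delta>)) (\<lambda>t. (cmod (1 - g1 r t))\<^sup>2)" if r: "\<eta> \<le> r" "r \<le> 1 - \<eta>" for r
  proof -
    have r1: "0 < r" "r < 1" using r \<eta> by auto
    define \<phi> where "\<phi> t = Im (p r t) - Im (comb_inv (p r t))" for t
    define \<phi>' where "\<phi>' t = Im ((1 - g1 r t) * pt r t)" for t
    have ptn: "cmod (pt r t) = r * sqrt lsq" for t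
    proof -
      have "cmod (pt r t) = sqrt (r\<^sup>2 * lsq)"
        using \<sigma> by (auto simp: pt_def cmod_def lsq_def power_mult_distrib algebra_simps)
      then show ?thesis using r1 by (simp add: real_sqrt_mult)
    qed
    have sq: "(\<phi> \<delta> - \<phi> (1 - \<delta>))\<^sup>2 / (r * sqrt lsq)\<^sup>2 \<le> integral {\<delta>..1 - \<delta>} (\<lambda>t. (cmod (1 - g1 r t))\<^sup>2)"
    proof (rule integral_square_lower)
      show "\<delta> < 1 - \<delta>" "1 - \<delta> - \<delta> \<le> 1" using \<delta> by auto
      show "r * sqrt lsq > 0" using r1 lsq by simp
      fix t assume "t \<in> {\<delta>..1 - \<delta>}"
      then have t: "0 < t" "t < 1" using \<delta> by auto
      have pd: "((\<lambda>t. p r t) has_vector_derivative pt r t) (at t)"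
      proof -
        have e: "p r t = of_real (u0 + \<sigma> * (r * t * d)) + \<i> * of_real (r * (1 - t) * H)" for t
          by (simp add: p_def complex_eq_iff)
        show ?thesis unfolding e pt_def
          by (auto intro!: derivative_eq_intros simp: complex_eq_iff algebra_simps)
      qed
      from field_vector_diff_chain_at[OF pd gd[OF r1 t]]
      have "((\<lambda>t. comb_inv (p r t)) has_vector_derivative pt r t * g1 r t) (at t)" by (simp add: o_def)
      from bounded_linear.has_vector_derivative[OF bounded_linear_Im has_vector_derivative_diff[OF pd this]]
      show "(\<phi> has_real_derivative \<phi>' t) (at t)"
        by (simp add: \<phi>_def[abs_def] \<phi>'_def has_real_derivative_iff_has_vector_derivative algebra_simps)
      have "\<bar>\<phi>' t\<bar> \<le> cmod ((1 - g1 r t) * pt r t)" unfolding \<phi>'_def by (rule abs_Im_le_cmod)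
      then show "\<bar>\<phi>' t\<bar> \<le> r * sqrt lsq * cmod (1 - g1 r t)" by (simp add: norm_mult ptn mult.commute)
    next
      have "continuous_on {\<delta>..1 - \<delta>} (\<lambda>t. g1 r t)"
      proof -
        have "Pair r ` {\<delta>..1 - \<delta>} \<subseteq> ?C" using r by (auto simp: cbox_Pair_eq)
        then show ?thesis
          using continuous_on_compose2[OF g1c continuous_on_Pair[OF continuous_on_const continuous_on_id], of r "{\<delta>..1 - \<delta>}"]
          by simp
      qed
      then show "continuous_on {\<delta>..1 - \<delta>} (\<lambda>t. cmod (1 - g1 r t))" by (intro continuous_intros)
    qed
    have \<delta>1: "\<delta> < 1" "0 < 1 - \<delta>" "1 - \<delta> < 1" using \<delta> by auto
    have small: "Im (comb_inv (p r \<delta>)) < \<eta> * H / 100"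
    proof (rule \<delta>'(2))
      show "comb_inv (p r \<delta>) \<in> half_strip" by (rule gOm[OF r1 \<delta>(1) \<delta>1(1)])
      have "\<eta> * (1 / 2) \<le> r * (1 - \<delta>)" using r \<eta> \<delta> by (intro mult_mono) auto
      from mult_right_mono[OF this, of H] show "\<eta> * H / 2 \<le> r * (1 - \<delta>) * H" using H by (simp add: mult_ac)
      have "r * (1 - \<delta>) \<le> (1 - \<eta>) * 1" using r \<eta> \<delta> by (intro mult_mono) auto
      from mult_right_mono[OF this, of H] show "r * (1 - \<delta>) * H \<le> (1 - \<eta>) * H" using H by simp
      have "cmod (p r \<delta> - Complex u0 (r * (1 - \<delta>) * H)) = \<bar>\<sigma> * (r * \<delta> * d)\<bar>"
        by (simp add: p_def cmod_def)
      also have "\<dots> = r * (\<delta> * d)" using \<sigma> r1 \<delta> d by (auto simp: abs_mult)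
      also have "\<dots> \<le> 1 * (\<delta> * d)" using r1 \<delta> d by (intro mult_right_mono) auto
      finally show "cmod (comb_map (comb_inv (p r \<delta>)) - Complex u0 (r * (1 - \<delta>) * H)) < \<delta>'"
        unfolding kg[OF r1 \<delta>(1) \<delta>1(1)] using \<delta>(3) by simp
    qed
    have "Im (comb_inv (p r (1 - \<delta>))) > 0" using gOm[OF r1 \<delta>1(2,3)] by (simp add: half_strip_def)
    then have "\<phi> \<delta> - \<phi> (1 - \<delta>) \<ge> r * (1 - \<delta>) * H - \<eta> * H / 100 - r * \<delta> * H"
      using small by (simp add: \<phi>_def p_def)
    moreover have "\<eta> * H / 100 \<le> r * H / 100" using r H by (simp add: mult_right_mono)
    moreover have "r * \<delta> * H \<le> r * (1 / 100) * H" using r1 \<delta> H by (intro mult_right_mono mult_left_mono) auto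
    \<comment> \<open>One hundredth of r H is lost to \<delta> at each end and one to the height of
      the preimage near the slit.\<close>
    ultimately have \<Delta>: "\<phi> \<delta> - \<phi> (1 - \<delta>) \<ge> r * (97 / 100 * H)" by (simp add: algebra_simps)
    then have "(r * (97 / 100 * H))\<^sup>2 \<le> (\<phi> \<delta> - \<phi> (1 - \<delta>))\<^sup>2" using r1 H by (intro power_mono) auto
    then have "(r * (97 / 100 * H))\<^sup>2 / (r * sqrt lsq)\<^sup>2 \<le> (\<phi> \<delta> - \<phi> (1 - \<delta>))\<^sup>2 / (r * sqrt lsq)\<^sup>2"
      by (intro divide_right_mono) auto
    moreover have "3 / 4 \<le> (r * (97 / 100 * H))\<^sup>2 / (r * sqrt lsq)\<^sup>2"
    proof -
      have e: "(r * (c * H))\<^sup>2 / (r * sqrt lsq)\<^sup>2 = c\<^sup>2 * H\<^sup>2 / lsq" for c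
        using r1 lsq by (simp add: power_mult_distrib)
      have sq: "(97 / 100)\<^sup>2 = (9409 / 10000 :: real)" by (simp add: power2_eq_square)
      \<comment> \<open>d <= H / 2 bounds the squared length by 5/4 H^2, and 15/16 is just below
        0.9409.\<close>
      have "3 / 4 * lsq \<le> 9409 / 10000 * H\<^sup>2"
        using lsq(2) zero_le_power2[of H] by linarith
      then have "3 / 4 * lsq \<le> (97 / 100)\<^sup>2 * H\<^sup>2" by (simp only: sq)
      then show ?thesis unfolding e using lsq(1) by (simp add: pos_le_divide_eq)
    qed
    ultimately show ?thesis unfolding box_real using sq by (meson order_trans)
  qed
  have Ibound: "I \<ge> d * H / 3"
  proof -
    have I2: "I = integral (cbox \<eta> (1 - \<eta>)) (\<lambda>r. integral (cbox \<delta> (1 - \<delta>)) (\<lambda>t. F (r, t)))"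
      unfolding I_def by (rule integral_prod_continuous[OF Fc])
    have lo: "((\<lambda>r. 3 / 4 * (d * H) * r) has_integral (3 / 4 * (d * H) * ((1 - \<eta>)\<^sup>2 / 2) - 3 / 4 * (d * H) * (\<eta>\<^sup>2 / 2))) {\<eta>..1 - \<eta>}"
      by (rule fundamental_theorem_of_calculus)
         (auto simp: \<eta>_def has_real_derivative_iff_has_vector_derivative[symmetric] intro!: derivative_eq_intros)
    have up: "((\<lambda>r. integral (cbox \<delta> (1 - \<delta>)) (\<lambda>t. F (r, t))) has_integral I) {\<eta>..1 - \<eta>}"
      using integrable_integral[OF integral_integrable_2dim[OF Fc]] unfolding I2 by (simp only: box_real)
    have "3 / 4 * (d * H) * r \<le> integral (cbox \<delta> (1 - \<delta>)) (\<lambda>t. F (r, t))" if "r \<in> {\<eta>..1 - \<eta>}" for r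
    proof -
      have r: "\<eta> \<le> r" "r \<le> 1 - \<eta>" using that by auto
      have "integral (cbox \<delta> (1 - \<delta>)) (\<lambda>t. F (r, t)) = r * (d * H) * integral (cbox \<delta> (1 - \<delta>)) (\<lambda>t. (cmod (1 - g1 r t))\<^sup>2)"
        unfolding F_def by simp
      moreover have "r * (d * H) * (3 / 4) \<le> r * (d * H) * integral (cbox \<delta> (1 - \<delta>)) (\<lambda>t. (cmod (1 - g1 r t))\<^sup>2)"
        using r \<eta> d H by (intro mult_left_mono inner) auto
      ultimately show ?thesis by (simp add: algebra_simps)
    qed
    then have "3 / 4 * (d * H) * ((1 - \<eta>)\<^sup>2 / 2) - 3 / 4 * (d * H) * (\<eta>\<^sup>2 / 2) \<le> I"
      by (rule has_integral_le[OF lo up])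
    moreover have "d * H > 0" using d H by simp
    ultimately show ?thesis by (simp add: \<eta>_def power2_eq_square field_simps)
  qed
  show ?thesis
  proof (rule that[OF comp ne _ _ res Ibound])
    fix z assume "z \<in> G ` K"
    then obtain y where y: "y \<in> K" "z = G y" by auto
    have k: "0 < y$1" "y$1 < 1" "0 < y$2" "y$2 < 1" using K'[OF y(1)] by auto
    show "of_vec2 z \<in> half_strip" unfolding y(2) c2G by (rule gOm[OF k])
    show "0 < \<sigma> * (Re (comb_map (of_vec2 z)) - pi * real n / real q) \<and>
       \<sigma> * (Re (comb_map (of_vec2 z)) - pi * real n / real q) < pi / real q / 2"
      unfolding y(2) c2G kg[OF k] u0_def[symmetric] p_side using rt[OF k] by simp
  qed
qed

end

section \<open>From the energy and the integrals of \<open>v\<close> to the gap lengths\<close>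

context comb
begin

lemma lnK_nonneg: "pi * ln K \<ge> 0"
  using has_integral_nonneg[OF v_integral] v_nonneg by auto

lemma band_width_pos: "pi / real q > 0"
  using q_pos by simp

text \<open>Each chosen slit carries two triangles, of width at most half the distance pi/q between
  feet, so all preimages are disjoint and their energies are bounded together by that of one box.
  With d = min(pi/q, H) / 2 the two triangles of a slit give min(pi/q, H) H / 3.\<close>

lemma energy_sum:
  assumes N: "N \<subseteq> {1..<q}" and X: "\<And>n. n \<in> N \<Longrightarrow> \<alpha> n < X n \<and> X n < \<beta> n"
  shows "(\<Sum>n\<in>N. min (pi / real q) (v (of_real (X n))) * v (of_real (X n))) \<le> 3 * (pi * ln K)"
proof (cases "N = {}")
  case True
  then show ?thesis using lnK_nonneg by simp
next
  case False
  define w where "w = pi / real q"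
  define H where "H n = v (of_real (X n))" for n
  define d where "d n = min w (H n) / 2" for n
  have H: "H n > 0" if "n \<in> N" for n
    unfolding H_def by (rule v_gap_pos[of n]) (use N X[OF that] that in auto)
  have fin: "finite N" using N finite_subset by blast
  define J where "J = N \<times> {1, -1 :: real}"
  have Jfin: "finite J" and J0: "J \<noteq> {}" using fin False by (auto simp: J_def)
  define good where "good i S I \<longleftrightarrow> compact S \<and> S \<noteq> {} \<and> (\<forall>z\<in>S. of_vec2 z \<in> half_strip) \<and>
    (\<forall>z\<in>S. 0 < snd i * (Re (comb_map (of_vec2 z)) - pi * real (fst i) / real q) \<and>
       snd i * (Re (comb_map (of_vec2 z)) - pi * real (fst i) / real q) < w / 2) \<and>
    ((\<lambda>z. (cmod (comb_dev (of_vec2 z)))\<^sup>2) has_integral I) S \<and> I \<ge> d (fst i) * H (fst i) / 3"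
    for i :: "nat \<times> real" and S :: "(real^2) set" and I :: real
  have "\<exists>S I. good i S I" if "i \<in> J" for i
  proof -
    obtain n \<sigma> where i: "i = (n, \<sigma>)" "n \<in> N" "\<sigma> = 1 \<or> \<sigma> = -1" using \<open>i \<in> J\<close> by (auto simp: J_def)
    have n: "1 \<le> n" "n < q" using N i by auto
    have d: "0 < d n" "d n \<le> H n / 2" "d n \<le> pi / real q / 2"
      using H[OF i(2)] band_width_pos by (auto simp: d_def w_def)
    have HX: "v (of_real (X n)) = H n" by (simp add: H_def)
    obtain S I where "compact S" "S \<noteq> {}" "\<And>z. z \<in> S \<Longrightarrow> of_vec2 z \<in> half_strip"
      "\<And>z. z \<in> S \<Longrightarrow> 0 < \<sigma> * (Re (comb_map (of_vec2 z)) - pi * real n / real q) \<and>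
         \<sigma> * (Re (comb_map (of_vec2 z)) - pi * real n / real q) < pi / real q / 2"
      "((\<lambda>z. (cmod (comb_dev (of_vec2 z)))\<^sup>2) has_integral I) S" "I \<ge> d n * H n / 3"
      using triangle_energy[OF n _ _ HX i(3) d] X[OF i(2)] by metis
    then have "good i S I" unfolding good_def i w_def by simp
    then show ?thesis by blast
  qed
  then obtain S I where g: "\<And>i. i \<in> J \<Longrightarrow> good i (S i) (I i)" by metis
  have disj: "S i \<inter> S j = {}" if ij: "i \<in> J" "j \<in> J" "i \<noteq> j" for i j
  proof (rule ccontr)
    assume "S i \<inter> S j \<noteq> {}"
    then obtain z where z: "z \<in> S i" "z \<in> S j" by blast
    obtain n \<sigma> where i: "i = (n, \<sigma>)" "\<sigma> = 1 \<or> \<sigma> = -1" using ij(1) by (auto simp: J_def)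
    obtain m \<tau> where j: "j = (m, \<tau>)" "\<tau> = 1 \<or> \<tau> = -1" using ij(2) by (auto simp: J_def)
    have w0: "w > 0" using band_width_pos by (simp only: w_def)
    have wl: "0 < s \<and> s < 1 / 2" if "0 < w * s \<and> w * s < w * (1 / 2)" for s
      using that w0 mult_less_cancel_left_pos[OF w0, of s "1 / 2"] by (simp only: zero_less_mult_iff) auto
    define R where "R = Re (comb_map (of_vec2 z)) / w"
    have wn: "pi * real k / real q = real k * w" for k by (simp add: w_def)
    have Rw: "Re (comb_map (of_vec2 z)) = R * w" using q2 by (simp add: R_def w_def)
    have "0 < \<sigma> * (R * w - real n * w) \<and> \<sigma> * (R * w - real n * w) < w / 2"
      using g[OF ij(1)] z(1) unfolding good_def wn Rw[symmetric] i by auto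
    then have "0 < w * (\<sigma> * (R - real n)) \<and> w * (\<sigma> * (R - real n)) < w * (1 / 2)" by (simp add: algebra_simps)
    then have a: "0 < \<sigma> * (R - real n)" "\<sigma> * (R - real n) < 1 / 2"
      using wl by blast+
    have "0 < \<tau> * (R * w - real m * w) \<and> \<tau> * (R * w - real m * w) < w / 2"
      using g[OF ij(2)] z(2) unfolding good_def wn Rw[symmetric] j by auto
    then have "0 < w * (\<tau> * (R - real m)) \<and> w * (\<tau> * (R - real m)) < w * (1 / 2)" by (simp add: algebra_simps)
    then have b: "0 < \<tau> * (R - real m)" "\<tau> * (R - real m) < 1 / 2"
      using wl by blast+
    have "\<bar>R - real n\<bar> < 1 / 2" "\<bar>R - real m\<bar> < 1 / 2" using a b i j by auto
    then have "n = m" by linarith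
    then have "\<sigma> = \<tau>" using a b i j by auto
    then show False using \<open>n = m\<close> i j ij(3) by simp
  qed
  have UN: "((\<lambda>z. (cmod (comb_dev (of_vec2 z)))\<^sup>2) has_integral (\<Sum>i\<in>J. I i)) (\<Union>i\<in>J. S i)"
    using g disj by (intro has_integral_UN Jfin) (auto simp: good_def pairwise_def)
  have comp: "compact (\<Union>i\<in>J. S i)" using g Jfin by (auto simp: good_def)
  have ne: "(\<Union>i\<in>J. S i) \<noteq> {}" using g J0 by (auto simp: good_def)
  have ci: "continuous_on (\<Union>i\<in>J. S i) (\<lambda>z. Im (of_vec2 z))" by (simp add: of_vec2_def) (intro continuous_intros)
  \<comment> \<open>Finitely many compact preimages stay away from the real line and from infinity,
    so one box contains them all.\<close>
  obtain z1 where z1: "z1 \<in> (\<Union>i\<in>J. S i)" "\<And>z. z \<in> (\<Union>i\<in>J. S i) \<Longrightarrow> Im (of_vec2 z1) \<le> Im (of_vec2 z)"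
    using continuous_attains_inf[OF comp ne ci] by blast
  obtain z2 where z2: "z2 \<in> (\<Union>i\<in>J. S i)" "\<And>z. z \<in> (\<Union>i\<in>J. S i) \<Longrightarrow> Im (of_vec2 z) \<le> Im (of_vec2 z2)"
    using continuous_attains_sup[OF comp ne ci] by blast
  define y1 y2 where "y1 = Im (of_vec2 z1)" and "y2 = Im (of_vec2 z2)"
  have UOm: "of_vec2 z \<in> half_strip" if "z \<in> (\<Union>i\<in>J. S i)" for z using g that by (auto simp: good_def)
  have y: "0 < y1" "y1 \<le> y2" using UOm[OF z1(1)] z2(2)[OF z1(1)] by (auto simp: y1_def y2_def half_strip_def)
  have sub: "(\<Union>i\<in>J. S i) \<subseteq> cbox (vector [0, y1]) (vector [pi, y2])"
  proof
    fix z assume z: "z \<in> (\<Union>i\<in>J. S i)"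
    show "z \<in> cbox (vector [0, y1]) (vector [pi, y2])"
      using UOm[OF z] z1(2)[OF z] z2(2)[OF z]
      by (auto simp: mem_box_cart forall_2 y1_def y2_def half_strip_def of_vec2_def)
  qed
  have cb: "continuous_on (cbox (0, y1) (pi, y2)) (\<lambda>p. (cmod (comb_dev (Complex (fst p) (snd p))))\<^sup>2)"
    by (intro continuous_intros continuous_on_box comb_dev_holomorphic y)
  have "((\<lambda>z. (cmod (comb_dev (of_vec2 z)))\<^sup>2) has_integral integral (cbox (0, y1) (pi, y2)) (\<lambda>p. (cmod (comb_dev (Complex (fst p) (snd p))))\<^sup>2))
      (cbox (vector [0, y1]) (vector [pi, y2]))"
    using has_integral_real2[OF integrable_integral[OF integrable_continuous[OF cb]]] by (simp add: of_vec2_def)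
  then have "(\<Sum>i\<in>J. I i) \<le> integral (cbox (0, y1) (pi, y2)) (\<lambda>p. (cmod (comb_dev (Complex (fst p) (snd p))))\<^sup>2)"
    by (intro has_integral_subset_le[OF sub UN]) auto
  also have "\<dots> \<le> pi * ln K" by (rule energy_box_le[OF y])
  finally have le: "(\<Sum>i\<in>J. I i) \<le> pi * ln K" .
  have "(\<Sum>n\<in>N. min w (H n) * H n) / 3 = (\<Sum>n\<in>N. \<Sum>\<sigma>\<in>{1, -1::real}. d n * H n / 3)"
    unfolding sum_divide_distrib by (intro sum.cong refl) (simp add: d_def)
  also have "\<dots> = (\<Sum>i\<in>J. d (fst i) * H (fst i) / 3)"
    unfolding J_def sum.cartesian_product by (simp add: case_prod_beta')
  also have "\<dots> \<le> (\<Sum>i\<in>J. I i)" using g by (intro sum_mono) (simp add: good_def)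
  finally show ?thesis using le by (simp add: w_def H_def)
qed

text \<open>\<open>f\<close> vanishes wherever v does, hence on the bands, and only the intervals of
  the gaps contribute.\<close>

lemma gap_decomposition:
  fixes f :: "real \<Rightarrow> real"
  assumes J: "(f has_integral J) {0..pi}" and f: "continuous_on {0..pi} f"
    and z: "\<And>x. 0 \<le> x \<Longrightarrow> x \<le> pi \<Longrightarrow> v (of_real x) = 0 \<Longrightarrow> f x = 0"
  shows "J = (\<Sum>n = 1..q - 1. integral {\<alpha> n..\<beta> n} f)"
proof -
  let ?T = "\<Union>n\<in>{1..q - 1}. {\<alpha> n..\<beta> n}"
  have nq: "1 \<le> n \<and> n < q" if "n \<in> {1..q - 1}" for n using that q2 by auto
  have sub: "{\<alpha> n..\<beta> n} \<subseteq> {0..pi}" if "n \<in> {1..q - 1}" for n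
    using edge_bounds[of n] nq[OF that] by auto
  have "(f has_integral (\<Sum>n = 1..q - 1. integral {\<alpha> n..\<beta> n} f)) ?T"
  proof (rule has_integral_UN)
    show "(f has_integral integral {\<alpha> n..\<beta> n} f) {\<alpha> n..\<beta> n}" if "n \<in> {1..q - 1}" for n
      by (intro integrable_integral integrable_continuous_real continuous_on_subset[OF f sub[OF that]])
    have "{\<alpha> n..\<beta> n} \<inter> {\<alpha> m..\<beta> m} = {}" if "n \<in> {1..q - 1}" "m \<in> {1..q - 1}" "n \<noteq> m" for n m
      using edge_order[of n m] edge_order[of m n] nq[OF that(1)] nq[OF that(2)] that(3)
      by (cases n m rule: linorder_cases) auto
    then show "pairwise (\<lambda>i i'. negligible ({\<alpha> i..\<beta> i} \<inter> {\<alpha> i'..\<beta> i'})) {1..q - 1}"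
      by (auto simp: pairwise_def)
  qed simp
  then have "((\<lambda>x. if x \<in> ?T then f x else 0) has_integral (\<Sum>n = 1..q - 1. integral {\<alpha> n..\<beta> n} f)) {0..pi}"
    by (subst has_integral_restrict[OF UN_least[OF sub]])
  then have "(f has_integral (\<Sum>n = 1..q - 1. integral {\<alpha> n..\<beta> n} f)) {0..pi}"
  proof (rule has_integral_eq[rotated])
    fix x assume x: "x \<in> {0..pi}"
    show "(if x \<in> ?T then f x else 0) = f x"
    proof (cases "x \<in> ?T")
      case False
      have "\<not> (\<alpha> n < x \<and> x < \<beta> n)" if "1 \<le> n" "n < q" for n
      proof -
        have "n \<in> {1..q - 1}" using that by auto
        then show ?thesis using False by fastforce
      qed
      then have "v (of_real x) = 0" using v_band[of x] x by auto
      then show ?thesis using z[of x] x False by auto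
    qed simp
  qed
  then show ?thesis using J has_integral_unique by blast
qed

lemma continuous_on_v_real: "continuous_on A (\<lambda>x. v (of_real x))"
  by (intro continuous_on_compose2[OF continuous_on_v[of UNIV]] continuous_intros) auto

lemma v_gap_sum: "pi * ln K = (\<Sum>n = 1..q - 1. integral {\<alpha> n..\<beta> n} (\<lambda>x. v (of_real x)))"
  by (rule gap_decomposition[OF v_integral continuous_on_v_real])

text \<open>cos^2 x = (1 + cos 2x) / 2 combines the two integrals of v. The same formula at the
  points \<psi> j splits their cosine sum into the term 1/4 and the sum of squares.\<close>

lemma v_cos_gap_sum:
  "pi * (ln K / 2 + 1 / 4 - (\<Sum>j<q. (cos (\<psi> j))\<^sup>2) / (2 * real q))
    = (\<Sum>n = 1..q - 1. integral {\<alpha> n..\<beta> n} (\<lambda>x. v (of_real x) * (cos x)\<^sup>2))"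
proof (rule gap_decomposition)
  have c: "v (of_real x) * (cos x)\<^sup>2 = 1 / 2 * (v (of_real x) + v (of_real x) * cos (2 * x))" for x
    by (simp only: cos_double_cos) (simp add: algebra_simps)
  have e: "(\<Sum>j<q. cos (2 * \<psi> j)) = 2 * (\<Sum>j<q. (cos (\<psi> j))\<^sup>2) - real q"
    by (simp add: cos_double_cos sum_subtractf sum_distrib_left)
  have "1 / 2 * (pi * ln K + - (pi / (2 * real q)) * (\<Sum>j<q. cos (2 * \<psi> j)))
      = pi * (ln K / 2 + 1 / 4 - (\<Sum>j<q. (cos (\<psi> j))\<^sup>2) / (2 * real q))"
    unfolding e using q_pos by (simp add: field_simps)
  then show "((\<lambda>x. v (of_real x) * (cos x)\<^sup>2) has_integral
      pi * (ln K / 2 + 1 / 4 - (\<Sum>j<q. (cos (\<psi> j))\<^sup>2) / (2 * real q))) {0..pi}"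
    unfolding c using has_integral_mult_right[OF has_integral_add[OF v_integral v_cos_integral], of "1 / 2"] by simp
  show "continuous_on {0..pi} (\<lambda>x. v (of_real x) * (cos x)\<^sup>2)"
    by (intro continuous_intros continuous_on_v_real)
qed simp

lemma integral_pos_continuous:
  fixes f :: "real \<Rightarrow> real"
  assumes "a < b" "continuous_on {a..b} f" "\<And>x. x \<in> {a..b} \<Longrightarrow> f x \<ge> 0" "x \<in> {a..b}" "f x > 0"
  shows "integral {a..b} f > 0"
proof -
  have hi: "(f has_integral integral {a..b} f) {a..b}"
    using assms(2) by (intro integrable_integral integrable_continuous_real)
  have "integral {a..b} f \<ge> 0" using has_integral_nonneg[OF hi] assms(3) by auto
  moreover have "integral {a..b} f \<noteq> 0"
  proof
    assume "integral {a..b} f = 0"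
    then have "f x = 0"
      using has_integral_0_cbox_imp_0[of a b f x] hi assms by (auto simp: box_real)
    then show False using assms(5) by simp
  qed
  ultimately show ?thesis by simp
qed

lemma gap_index: "n \<in> {1..q - 1} \<longleftrightarrow> 1 \<le> n \<and> n < q"
  using q2 by auto

context
  fixes n0 :: nat
  assumes n0: "1 \<le> n0" "n0 < q" "\<alpha> n0 < \<beta> n0"
begin

lemma lnK_pos: "ln K > 0"
proof -
  have "0 < (\<Sum>n = 1..q - 1. integral {\<alpha> n..\<beta> n} (\<lambda>x. v (of_real x)))"
  proof (rule sum_pos2[of _ n0])
    show "0 < integral {\<alpha> n0..\<beta> n0} (\<lambda>x. v (of_real x))"
      by (rule integral_pos_continuous[OF n0(3) continuous_on_v_real, where x = "(\<alpha> n0 + \<beta> n0) / 2"])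
         (use v_nonneg n0 v_gap_pos[OF n0(1,2), of "(\<alpha> n0 + \<beta> n0) / 2"] in auto)
  qed (use n0 v_nonneg in \<open>auto intro: integral_nonneg integrable_continuous_real continuous_on_v_real\<close>)
  then show ?thesis unfolding v_gap_sum[symmetric] by (simp add: zero_less_mult_iff)
qed

text \<open>The semicircle bound is integrated over every gap; strictness is taken from the midpoint
  of the open gap n0.\<close>

lemma gap_length_squares: "(\<Sum>n = 1..q - 1. (\<beta> n - \<alpha> n)\<^sup>2) < 8 * ln K"
proof -
  have sc: "continuous_on A (\<lambda>x. sqrt ((x - a) * (b - x)))" for A and a b :: real
    by (intro continuous_intros)
  have le: "sqrt ((x - \<alpha> n) * (\<beta> n - x)) \<le> v (of_real x)" if "1 \<le> n" "n < q" "x \<in> {\<alpha> n..\<beta> n}" for n x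
  proof (cases "\<alpha> n < x \<and> x < \<beta> n")
    case True
    then show ?thesis using v_gap_lower[of n x] that by simp
  next
    case False
    then have "x = \<alpha> n \<or> x = \<beta> n" using that by auto
    then show ?thesis using v_nonneg[of "of_real x"] by auto
  qed
  have I: "integral {\<alpha> n..\<beta> n} (\<lambda>x. v (of_real x) - sqrt ((x - \<alpha> n) * (\<beta> n - x)))
      = integral {\<alpha> n..\<beta> n} (\<lambda>x. v (of_real x)) - pi * (\<beta> n - \<alpha> n)\<^sup>2 / 8" if "1 \<le> n" "n < q" for n
    using integral_unique[OF has_integral_semicircle[of "\<alpha> n" "\<beta> n"]] edge_bounds[OF that]
    by (subst integral_diff) (auto intro!: integrable_continuous_real continuous_on_v_real sc)
  have "0 < (\<Sum>n = 1..q - 1. integral {\<alpha> n..\<beta> n} (\<lambda>x. v (of_real x) - sqrt ((x - \<alpha> n) * (\<beta> n - x))))"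
  proof (rule sum_pos2[of _ n0])
    show "0 < integral {\<alpha> n0..\<beta> n0} (\<lambda>x. v (of_real x) - sqrt ((x - \<alpha> n0) * (\<beta> n0 - x)))"
      by (rule integral_pos_continuous[OF n0(3), where x = "(\<alpha> n0 + \<beta> n0) / 2"])
         (use le n0 v_gap_lower[of n0 "(\<alpha> n0 + \<beta> n0) / 2"] in \<open>auto intro!: continuous_on_diff continuous_on_v_real sc\<close>)
    show "0 \<le> integral {\<alpha> n..\<beta> n} (\<lambda>x. v (of_real x) - sqrt ((x - \<alpha> n) * (\<beta> n - x)))" if "n \<in> {1..q - 1}" for n
      by (rule integral_nonneg)
         (use le that gap_index in \<open>auto intro!: integrable_continuous_real continuous_on_diff continuous_on_v_real sc\<close>)
  qed (use n0 in auto)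
  also have "\<dots> = (\<Sum>n = 1..q - 1. integral {\<alpha> n..\<beta> n} (\<lambda>x. v (of_real x)) - pi * (\<beta> n - \<alpha> n)\<^sup>2 / 8)"
    by (intro sum.cong refl I) (use gap_index in auto)
  also have "\<dots> = pi * ln K - pi / 8 * (\<Sum>n = 1..q - 1. (\<beta> n - \<alpha> n)\<^sup>2)"
    unfolding sum_subtractf v_gap_sum by (simp add: sum_distrib_left)
  finally have "pi * (\<Sum>n = 1..q - 1. (\<beta> n - \<alpha> n)\<^sup>2) < pi * (8 * ln K)" by simp
  then show ?thesis by (simp only: mult_less_cancel_left_pos[OF pi_gt_zero])
qed

context
  fixes hp :: real
  assumes hp: "\<And>n x. 1 \<le> n \<Longrightarrow> n < q \<Longrightarrow> \<alpha> n < x \<Longrightarrow> x < \<beta> n \<Longrightarrow> v (of_real x) \<le> hp"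
begin

lemma hp_pos: "hp > 0"
  using v_gap_pos[of n0 "(\<alpha> n0 + \<beta> n0) / 2"] hp[of n0 "(\<alpha> n0 + \<beta> n0) / 2"] n0 by simp

lemma hp_ge: "1 \<le> n \<Longrightarrow> n < q \<Longrightarrow> x \<in> {\<alpha> n..\<beta> n} \<Longrightarrow> v (of_real x) \<le> hp"
  using hp[of n x] v_edge[of n] hp_pos by (cases "x = \<alpha> n \<or> x = \<beta> n") auto

text \<open>Follows from v <= hp on the gaps. It is strict because at an edge of the open gap v = 0
  while hp w > 0.\<close>

lemma weighted_gap_sum:
  assumes w: "continuous_on UNIV w" "\<And>x. w x \<ge> 0" "w (\<alpha> n0) > 0 \<or> w (\<beta> n0) > (0::real)"
  shows "(\<Sum>n = 1..q - 1. integral {\<alpha> n..\<beta> n} (\<lambda>x. v (of_real x) * w x))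
    < hp * (\<Sum>n = 1..q - 1. integral {\<alpha> n..\<beta> n} w)"
proof -
  have wc: "continuous_on A w" for A using w(1) continuous_on_subset by blast
  have I: "integral {\<alpha> n..\<beta> n} (\<lambda>x. hp * w x - v (of_real x) * w x)
      = hp * integral {\<alpha> n..\<beta> n} w - integral {\<alpha> n..\<beta> n} (\<lambda>x. v (of_real x) * w x)" for n
    by (subst integral_diff) (auto intro!: integrable_continuous_real continuous_intros wc continuous_on_v_real)
  have nn: "0 \<le> hp * w x - v (of_real x) * w x" if "1 \<le> n" "n < q" "x \<in> {\<alpha> n..\<beta> n}" for n x
    using mult_right_mono[OF hp_ge[OF that] w(2)[of x]] by simp
  have "0 < (\<Sum>n = 1..q - 1. integral {\<alpha> n..\<beta> n} (\<lambda>x. hp * w x - v (of_real x) * w x))"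
  proof (rule sum_pos2[of _ n0])
    obtain x where x: "x = \<alpha> n0 \<or> x = \<beta> n0" "w x > 0" using w(3) by auto
    then have "v (of_real x) = 0" using v_edge[OF n0(1,2)] by auto
    then show "0 < integral {\<alpha> n0..\<beta> n0} (\<lambda>x. hp * w x - v (of_real x) * w x)"
      by (intro integral_pos_continuous[OF n0(3), where x = x])
         (use nn n0 x hp_pos in \<open>auto intro!: continuous_intros wc continuous_on_v_real\<close>)
    show "0 \<le> integral {\<alpha> n..\<beta> n} (\<lambda>x. hp * w x - v (of_real x) * w x)" if "n \<in> {1..q - 1}" for n
      by (rule integral_nonneg)
         (use nn that gap_index in \<open>auto intro!: integrable_continuous_real continuous_intros wc continuous_on_v_real\<close>)
  qed (use n0 in auto)
  then show ?thesis unfolding I sum_subtractf by (simp add: sum_distrib_left)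
qed

lemma gap_length_lower: "pi * ln K < hp * (\<Sum>n = 1..q - 1. \<beta> n - \<alpha> n)"
proof -
  have "(\<Sum>n = 1..q - 1. integral {\<alpha> n..\<beta> n} (\<lambda>x. 1::real)) = (\<Sum>n = 1..q - 1. \<beta> n - \<alpha> n)"
    by (intro sum.cong refl) (use edge_bounds gap_index in auto)
  then show ?thesis using weighted_gap_sum[of "\<lambda>x. 1"] by (simp add: v_gap_sum)
qed

lemma gap_cos_lower:
  "pi * (ln K / 2 + 1 / 4 - (\<Sum>j<q. (cos (\<psi> j))\<^sup>2) / (2 * real q))
    < hp * (\<Sum>n = 1..q - 1. integral {\<alpha> n..\<beta> n} (\<lambda>x. (cos x)\<^sup>2))"
  unfolding v_cos_gap_sum
proof (rule weighted_gap_sum)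
  \<comment> \<open>cos is strictly decreasing on [0, pi], so the weight cannot vanish at both ends
    of the open gap.\<close>
  have "cos (\<alpha> n0) \<noteq> cos (\<beta> n0)"
    using cos_monotone_0_pi[of "\<alpha> n0" "\<beta> n0"] edge_bounds[OF n0(1,2)] n0(3) by auto
  then show "(cos (\<alpha> n0))\<^sup>2 > 0 \<or> (cos (\<beta> n0))\<^sup>2 > 0" by auto
qed (auto intro!: continuous_intros)

lemma gap_max:
  assumes n: "1 \<le> n" "n < q" and "\<alpha> n < \<beta> n"
  obtains x where "\<alpha> n < x" "x < \<beta> n" "\<And>y. y \<in> {\<alpha> n..\<beta> n} \<Longrightarrow> v (of_real y) \<le> v (of_real x)"
proof -
  obtain x where x: "x \<in> {\<alpha> n..\<beta> n}" "\<And>y. y \<in> {\<alpha> n..\<beta> n} \<Longrightarrow> v (of_real y) \<le> v (of_real x)"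
    using continuous_attains_sup[OF compact_Icc _ continuous_on_v_real, of "\<alpha> n" "\<beta> n"] assms(3) by auto
  have "v (of_real ((\<alpha> n + \<beta> n) / 2)) > 0" by (rule v_gap_pos[OF n]) (use assms(3) in auto)
  then have "v (of_real x) > 0" using x(2)[of "(\<alpha> n + \<beta> n) / 2"] assms(3) by simp
  then have "x \<noteq> \<alpha> n" "x \<noteq> \<beta> n" using v_edge[OF n] by auto
  then show ?thesis using that[of x] x by auto
qed

text \<open>With H n the maximum of v on gap n, pi ln K is at most the sum of the lengths times H n.
  Cauchy-Schwarz leaves the sum of the squares of H n, which \<open>energy_sum\<close> bounds by a
  multiple of pi ln K itself, so one factor pi ln K cancels.\<close>

lemma gap_squares_lower: "ln K < max 1 (real q * hp / pi) * (\<Sum>n = 1..q - 1. (\<beta> n - \<alpha> n)\<^sup>2)"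
proof -
  define M1 where "M1 = max 1 (real q * hp / pi)"
  have M1: "M1 \<ge> 1" "M1 * pi \<ge> real q * hp" by (auto simp: M1_def max_def field_simps)
  define N where "N = {n \<in> {1..q - 1}. \<alpha> n < \<beta> n}"
  have "\<exists>X. \<forall>n\<in>N. \<alpha> n < X n \<and> X n < \<beta> n \<and> (\<forall>y\<in>{\<alpha> n..\<beta> n}. v (of_real y) \<le> v (of_real (X n)))"
    by (rule bchoice) (metis (no_types, lifting) N_def gap_index gap_max mem_Collect_eq)
  then obtain X where X: "\<And>n. n \<in> N \<Longrightarrow> \<alpha> n < X n \<and> X n < \<beta> n"
      "\<And>n y. n \<in> N \<Longrightarrow> y \<in> {\<alpha> n..\<beta> n} \<Longrightarrow> v (of_real y) \<le> v (of_real (X n))" by blast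
  define H where "H n = (if n \<in> N then v (of_real (X n)) else 0)" for n
  have Nq: "1 \<le> n \<and> n < q" if "n \<in> N" for n using that gap_index by (auto simp: N_def)
  have H0: "H n \<ge> 0" for n by (simp add: H_def v_nonneg)
  have Hhp: "H n \<le> hp" for n using hp Nq X hp_pos by (auto simp: H_def)
  have b: "integral {\<alpha> n..\<beta> n} (\<lambda>x. v (of_real x)) \<le> (\<beta> n - \<alpha> n) * H n" if "n \<in> {1..q - 1}" for n
  proof (cases "n \<in> N")
    case True
    have "integral {\<alpha> n..\<beta> n} (\<lambda>x. v (of_real x)) \<le> integral {\<alpha> n..\<beta> n} (\<lambda>x. H n)"
      by (rule integral_le) (use X(2)[OF True] True in \<open>auto intro!: integrable_continuous_real continuous_on_v_real simp: H_def\<close>)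
    then show ?thesis using X(1)[OF True] by simp
  next
    case False
    then have "\<alpha> n = \<beta> n" using that edge_bounds[of n] gap_index[of n] by (auto simp: N_def)
    then show ?thesis by simp
  qed
  have "pi * ln K \<le> (\<Sum>n = 1..q - 1. (\<beta> n - \<alpha> n) * H n)"
    unfolding v_gap_sum by (rule sum_mono) (rule b)
  then have "(pi * ln K)\<^sup>2 \<le> (\<Sum>n = 1..q - 1. (\<beta> n - \<alpha> n) * H n)\<^sup>2"
    using lnK_pos by (intro power_mono) auto
  also have "\<dots> \<le> (\<Sum>n = 1..q - 1. (\<beta> n - \<alpha> n)\<^sup>2) * (\<Sum>n = 1..q - 1. (H n)\<^sup>2)"
    by (rule Cauchy_Schwarz_ineq_sum)
  also have "\<dots> \<le> (\<Sum>n = 1..q - 1. (\<beta> n - \<alpha> n)\<^sup>2) * (M1 * (3 * (pi * ln K)))"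
  proof (intro mult_left_mono sum_nonneg)
    have "(H n)\<^sup>2 \<le> M1 * (min (pi / real q) (H n) * H n)" for n
    proof (cases "H n \<le> pi / real q")
      case True
      then show ?thesis using M1(1) by (simp add: min_absorb2 power2_eq_square mult_right_mono[of 1 M1 "H n * H n", simplified])
    next
      case False
      \<comment> \<open>For slits higher than pi/q the energy bound is only linear in H n;
        \<open>M1\<close> pays for replacing one factor H n by pi/q.\<close>
      have "real q * H n \<le> M1 * pi" using M1(2) mult_left_mono[OF Hhp[of n], of "real q"] by simp
      then have "H n \<le> M1 * (pi / real q)" using q_pos by (simp add: field_simps)
      then have "H n * H n \<le> M1 * (pi / real q) * H n" using H0 by (intro mult_right_mono)
      then show ?thesis using False by (simp add: power2_eq_square mult.assoc)
    qed
    then have "(\<Sum>n = 1..q - 1. (H n)\<^sup>2) \<le> M1 * (\<Sum>n = 1..q - 1. min (pi / real q) (H n) * H n)"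
      unfolding sum_distrib_left by (rule sum_mono)
    also have "(\<Sum>n = 1..q - 1. min (pi / real q) (H n) * H n) = (\<Sum>n\<in>N. min (pi / real q) (H n) * H n)"
      by (rule sum.mono_neutral_right) (auto simp: N_def H_def)
    also have "\<dots> \<le> 3 * (pi * ln K)"
    proof -
      have "N \<subseteq> {1..<q}" using Nq by auto
      from energy_sum[OF this X(1)] show ?thesis by (simp add: H_def)
    qed
    finally show "(\<Sum>n = 1..q - 1. (H n)\<^sup>2) \<le> M1 * (3 * (pi * ln K))" using M1(1) by simp
  qed auto
  finally have "(pi * ln K) * (pi * ln K) \<le> (3 * (M1 * (\<Sum>n = 1..q - 1. (\<beta> n - \<alpha> n)\<^sup>2))) * (pi * ln K)"
    by (simp add: power2_eq_square mult_ac)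
  then have "pi * ln K \<le> 3 * (M1 * (\<Sum>n = 1..q - 1. (\<beta> n - \<alpha> n)\<^sup>2))"
    using lnK_pos by (simp add: mult_le_cancel_right)
  \<comment> \<open>The constant 3 of the energy estimate is absorbed by pi, which also makes the
    final inequality strict.\<close>
  moreover have "3 * ln K < pi * ln K" using lnK_pos pi_gt3 by simp
  ultimately show ?thesis by (simp add: M1_def)
qed

end

end

end

section \<open>From the Jacobi operator to the comb\<close>

text \<open>Let k be the index of the first edge beyond x. If k is odd, x lies in a band; if it is
  even, x lies in a gap, which is excluded.\<close>

lemma (in band_poly) outside_gaps:
  assumes x: "edges ! 0 \<le> x" "x \<le> edges ! (2 * q - 1)"
    and no: "\<And>n. 1 \<le> n \<Longrightarrow> n < q \<Longrightarrow> \<not> (edges ! (2 * n - 1) < x \<and> x < edges ! (2 * n))"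
  shows "\<bar>poly D x\<bar> \<le> 2"
proof (cases "x \<in> set edges")
  case True
  then show ?thesis using edge_iff[of x] by simp
next
  case False
  then have ne: "edges ! i \<noteq> x" if "i < 2 * q" for i using that length_edges nth_mem by metis
  have last: "x < edges ! (2 * q - 1)" using ne[of "2 * q - 1"] x(2) q1 by fastforce
  define k where "k = (LEAST i. x < edges ! i)"
  have k1: "x < edges ! k" unfolding k_def by (rule LeastI[of _ "2 * q - 1"]) (rule last)
  have k2: "k \<le> 2 * q - 1" unfolding k_def by (rule Least_le) (rule last)
  have below: "edges ! i < x" if "i < k" for i
  proof -
    have "\<not> x < edges ! i" using not_less_Least[of i "\<lambda>i. x < edges ! i"] that by (simp add: k_def)
    then show ?thesis using ne[of i] that k2 q1 by fastforce
  qed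
  have above: "x < edges ! i" if "k \<le> i" "i < 2 * q" for i
    using edge_mono[OF that] k1 by simp
  have k0: "k \<noteq> 0" using k1 x(1) by (intro notI) simp
  show ?thesis
  proof (cases "odd k")
    case True
    then show ?thesis using band_gap_sign(1)[of k x] below above k2 by (simp add: less_imp_le)
  next
    case False
    then obtain n where n: "k = 2 * n" by (auto elim: evenE)
    then have "1 \<le> n" "n < q" using k0 k2 q1 by auto
    then show ?thesis using no[of n] below[of "2 * n - 1"] k1 n by auto
  qed
qed

lemma (in band_poly) large_outside:
  assumes "x < edges ! 0 \<or> edges ! (2 * q - 1) < x"
  shows "\<bar>poly D x\<bar> > 2"
  using assms
proof
  assume "x < edges ! 0"
  then have "x < edges ! i" if "i < 2 * q" for i using edge_mono[of 0 i] that by simp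
  then show ?thesis using band_gap_sign(2)[of 0 x] by simp
next
  assume x: "edges ! (2 * q - 1) < x"
  have "edges ! i < x" if "i < 2 * q" for i
  proof -
    have "edges ! i \<le> edges ! (2 * q - 1)" using that q1 by (intro edge_mono) auto
    then show ?thesis using x by simp
  qed
  then show ?thesis using band_gap_sign(2)[of "2 * q" x] by simp
qed

lemma (in band_poly) band_edges_unique:
  "(THE e. sorted e \<and> (\<forall>x. count (mset e) x = order x (D\<^sup>2 - [:4:]))) = edges"
proof (rule the_equality)
  have nz: "D\<^sup>2 - [:4:] \<noteq> 0" unfolding edge_factor using D_nonzero by (auto simp: prod_zero_iff)
  have e: "count (mset edges) x = order x (D\<^sup>2 - [:4:])" for x
    unfolding edges_def mset_sorted_list_of_multiset by (rule count_proots[OF nz])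
  show "sorted edges \<and> (\<forall>x. count (mset edges) x = order x (D\<^sup>2 - [:4:]))"
    using sorted_edges e by blast
  fix e' assume e': "sorted e' \<and> (\<forall>x. count (mset e') x = order x (D\<^sup>2 - [:4:]))"
  then have "mset e' = mset edges" by (intro multiset_eqI) (simp only: e)
  then show "e' = edges" using e' sorted_edges by (metis properties_for_sort)
qed

lemma (in band_poly) cpoly_factor:
  assumes "D - [:t:] = smult (lead_coeff D) (\<Prod>i<q. [:- r i, 1:])"
  shows "cpoly D l - of_real t = of_real (lead_coeff D) * (\<Prod>i<q. l - of_real (r i))"
proof -
  have p: "cpoly (\<Prod>i<n. [:- r i, 1:]) l = (\<Prod>i<n. l - of_real (r i))" for n
    by (induction n) (simp_all del: mult_pCons_left mult_pCons_right add: algebra_simps)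
  have "cpoly (D - [:t:]) l = cpoly (smult (lead_coeff D) (\<Prod>i<q. [:- r i, 1:])) l" using assms by simp
  then show ?thesis by (simp add: p)
qed

locale symmetric_band_poly = band_poly +
  fixes c :: real
  assumes q2': "q \<ge> 2" and first_edge: "edges ! 0 = - c" and last_edge: "edges ! (2 * q - 1) = c"
begin

text \<open>Inverts - c cos x on [0, pi]; the minus sign makes it increasing, so the order of the
  edges is preserved.\<close>

definition lift :: "real \<Rightarrow> real" where "lift u = arccos (- u / c)"

text \<open>With leading coefficient 1 / A^q this is c / (2 A).\<close>

definition K :: real where "K = c * root q (lead_coeff D) / 2"

definition psi :: "nat \<Rightarrow> real" where "psi j = lift (bzero j)"

definition al :: "nat \<Rightarrow> real" where "al n = lift (edges ! (2 * n - 1))"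

definition be :: "nat \<Rightarrow> real" where "be n = lift (edges ! (2 * n))"

definition Dz :: "complex \<Rightarrow> complex" where "Dz z = cpoly D (- of_real c * cos z)"

lemma last_edge_Suc: "edges ! (2 * q - Suc 0) = c"
  using last_edge by simp

lemma c_pos: "c > 0"
proof -
  have "edges ! 0 < edges ! 1" using band_nondegenerate[of 0] q1 by simp
  also have "\<dots> \<le> edges ! (2 * q - 1)" using q2' by (intro edge_mono) auto
  finally show ?thesis by (simp add: first_edge last_edge_Suc)
qed

lemma edge_range: "i < 2 * q \<Longrightarrow> \<bar>edges ! i\<bar> \<le> c"
  using edge_mono[of 0 i] edge_mono[of i "2 * q - 1"] by (simp add: first_edge last_edge_Suc abs_le_iff)

lemma bzero_range: "j < q \<Longrightarrow> \<bar>bzero j\<bar> < c"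
  using bzero[of j] edge_range[of "2 * j"] edge_range[of "2 * j + 1"] by (simp add: abs_less_iff abs_le_iff)

lemma cos_lift: "\<bar>u\<bar> \<le> c \<Longrightarrow> cos (lift u) = - u / c"
  unfolding lift_def using c_pos by (intro cos_arccos) (auto simp: field_simps abs_le_iff)

lemma lift_bounds: "\<bar>u\<bar> \<le> c \<Longrightarrow> 0 \<le> lift u \<and> lift u \<le> pi"
  unfolding lift_def using c_pos by (intro conjI arccos_lbound arccos_ubound) (auto simp: field_simps abs_le_iff)

lemma lift_less: "\<bar>u\<bar> \<le> c \<Longrightarrow> 0 \<le> x \<Longrightarrow> x \<le> pi \<Longrightarrow> lift u < x \<longleftrightarrow> u < - c * cos x"
  using cos_mono_less_eq[of x "lift u"] lift_bounds[of u] cos_lift[of u] c_pos by (auto simp: field_simps)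

lemma less_lift: "\<bar>u\<bar> \<le> c \<Longrightarrow> 0 \<le> x \<Longrightarrow> x \<le> pi \<Longrightarrow> x < lift u \<longleftrightarrow> - c * cos x < u"
  using cos_mono_less_eq[of "lift u" x] lift_bounds[of u] cos_lift[of u] c_pos by (auto simp: field_simps)

lemma lift_mono: "\<bar>u\<bar> \<le> c \<Longrightarrow> \<bar>w\<bar> \<le> c \<Longrightarrow> lift u < lift w \<longleftrightarrow> u < w"
  using lift_less[of u "lift w"] lift_bounds[of w] cos_lift[of w] c_pos by simp

lemma lift_mono_le: "\<bar>u\<bar> \<le> c \<Longrightarrow> \<bar>w\<bar> \<le> c \<Longrightarrow> lift u \<le> lift w \<longleftrightarrow> u \<le> w"
  using lift_mono[of w u] by (simp add: not_less[symmetric])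

lemma K_pos: "K > 0"
  using c_pos lead q1 by (simp add: K_def)

lemma lead_K: "lead_coeff D * c ^ q = (2 * K) ^ q"
  using lead q1 by (simp add: K_def power_mult_distrib)

lemma Dz_factor:
  assumes f: "D - [:t:] = smult (lead_coeff D) (\<Prod>i<q. [:- r i, 1:])" and r: "\<And>i. i < q \<Longrightarrow> \<bar>r i\<bar> \<le> c"
  shows "Dz z - of_real t = (2 * of_real K) ^ q * (\<Prod>i<q. of_real (cos (lift (r i))) - cos z)"
proof -
  have "(\<Prod>i<q. - of_real c * cos z - of_real (r i)) = (\<Prod>i<q. of_real c * (of_real (cos (lift (r i))) - cos z))"
  proof (intro prod.cong refl)
    fix i assume "i \<in> {..<q}"
    then have "r i = - (c * cos (lift (r i)))" using cos_lift r c_pos by (simp add: field_simps)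
    then have "complex_of_real (r i) = - (of_real c * of_real (cos (lift (r i))))"
      by (metis of_real_minus of_real_mult)
    then show "- of_real c * cos z - of_real (r i) = of_real c * (of_real (cos (lift (r i))) - cos z)"
      by (simp add: algebra_simps)
  qed
  then have "Dz z - of_real t = of_real (lead_coeff D * c ^ q) * (\<Prod>i<q. of_real (cos (lift (r i))) - cos z)"
    unfolding Dz_def cpoly_factor[OF f] by (simp add: prod.distrib)
  then show ?thesis unfolding lead_K by simp
qed

lemma Dz_of_real: "Dz (of_real x) = of_real (poly D (- c * cos x))"
  unfolding Dz_def by (metis cos_of_real cpoly_of_real of_real_minus of_real_mult)

lemma level2_Dz:
  assumes "\<bar>t\<bar> = 2"
  shows "\<exists>s. \<forall>z. Dz z - of_real t = (2 * of_real K) ^ q * (\<Prod>j<q. of_real (cos (s j)) - cos z)"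
proof -
  obtain r where r: "D - [:t:] = smult (lead_coeff D) (\<Prod>i<q. [:- r i, 1:])"
    "\<And>i. i < q \<Longrightarrow> edges ! 0 \<le> r i \<and> r i \<le> edges ! (2 * q - 1)"
    using level2_factor[OF assms] by metis
  have "\<bar>r i\<bar> \<le> c" if "i < q" for i using r(2)[OF that] by (simp add: first_edge last_edge_Suc abs_le_iff)
  then show ?thesis using Dz_factor[OF r(1)] by (intro exI[of _ "\<lambda>i. lift (r i)"] allI) blast
qed

text \<open>\<open>level2_Dz\<close> only asserts that suitable points exist; the choice turns them
  into a parameter for the locale \<open>comb\<close>.\<close>

definition s1 :: "nat \<Rightarrow> real" where
  "s1 = (SOME s. \<forall>z. Dz z - of_real 2 = (2 * of_real K) ^ q * (\<Prod>j<q. of_real (cos (s j)) - cos z))"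

definition s2 :: "nat \<Rightarrow> real" where
  "s2 = (SOME s. \<forall>z. Dz z - of_real (- 2) = (2 * of_real K) ^ q * (\<Prod>j<q. of_real (cos (s j)) - cos z))"

lemma s1: "Dz z - of_real 2 = (2 * of_real K) ^ q * (\<Prod>j<q. of_real (cos (s1 j)) - cos z)"
  unfolding s1_def by (rule spec[OF someI_ex[OF level2_Dz]]) simp

lemma s2: "Dz z - of_real (- 2) = (2 * of_real K) ^ q * (\<Prod>j<q. of_real (cos (s2 j)) - cos z)"
  unfolding s2_def by (rule spec[OF someI_ex[OF level2_Dz]]) simp

lemma gap_edges:
  assumes "1 \<le> n" "n < q"
  shows "- c < edges ! (2 * n - 1)" "edges ! (2 * n - 1) \<le> edges ! (2 * n)" "edges ! (2 * n) < c"
    "\<bar>edges ! (2 * n - 1)\<bar> \<le> c" "\<bar>edges ! (2 * n)\<bar> \<le> c"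
proof -
  have "edges ! 0 < edges ! 1" using band_nondegenerate[of 0] q1 by simp
  also have "\<dots> \<le> edges ! (2 * n - 1)" using assms by (intro edge_mono) auto
  finally show "- c < edges ! (2 * n - 1)" by (simp add: first_edge)
  have "edges ! (2 * n) \<le> edges ! (2 * (q - 1))" using assms by (intro edge_mono) auto
  also have "\<dots> < edges ! (2 * (q - 1) + 1)" using band_nondegenerate[of "q - 1"] q1 by simp
  also have "2 * (q - 1) + 1 = 2 * q - 1" using q1 by simp
  finally show "edges ! (2 * n) < c" by (simp add: last_edge_Suc)
  show "edges ! (2 * n - 1) \<le> edges ! (2 * n)" using assms by (intro edge_mono) auto
  show "\<bar>edges ! (2 * n - 1)\<bar> \<le> c" "\<bar>edges ! (2 * n)\<bar> \<le> c" using assms by (auto intro: edge_range)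
qed

lemma in_gap_iff:
  assumes "1 \<le> n" "n < q" "0 \<le> x" "x \<le> pi"
  shows "al n < x \<and> x < be n \<longleftrightarrow> edges ! (2 * n - 1) < - c * cos x \<and> - c * cos x < edges ! (2 * n)"
  unfolding al_def be_def using lift_less less_lift gap_edges[OF assms(1,2)] assms(3,4) by auto

lemma alpha_beta_bounds:
  assumes "1 \<le> n" "n < q"
  shows "0 < al n \<and> al n \<le> be n \<and> be n < pi"
proof -
  note g = gap_edges[OF assms]
  have "0 < al n" unfolding al_def using less_lift[of "edges ! (2 * n - 1)" 0] g by simp
  moreover have "al n \<le> be n" unfolding al_def be_def using lift_mono_le g by simp
  moreover have "be n < pi" unfolding be_def using lift_less[of "edges ! (2 * n)" pi] g by simp
  ultimately show ?thesis by simp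
qed

sublocale comb q K psi s1 s2 al be Dz
proof
  show "q \<ge> 2" by (rule q2')
  show "K > 0" by (rule K_pos)
  show "0 < psi j \<and> psi j < pi" if "j < q" for j
    unfolding psi_def using lift_less[of "bzero j" pi] less_lift[of "bzero j" 0] bzero_range[OF that] by (simp add: abs_less_iff)
  show "Dz z = (2 * of_real K) ^ q * (\<Prod>j<q. of_real (cos (psi j)) - cos z)" for z
    using Dz_factor[of 0 bzero z] discr_factor bzero_range by (simp add: psi_def less_imp_le)
  show "Dz z - 2 = (2 * of_real K) ^ q * (\<Prod>j<q. of_real (cos (s1 j)) - cos z)" for z
    using s1[of z] by simp
  show "Dz z + 2 = (2 * of_real K) ^ q * (\<Prod>j<q. of_real (cos (s2 j)) - cos z)" for z
    using s2[of z] by simp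
  \<comment> \<open>A value in [-2, 2] would make - c cos z a real point between the outermost
    edges, so cos z would lie in [-1, 1] and z would be real.\<close>
  show "\<bar>t\<bar> > 2" if z: "Im z > 0" "Dz z = of_real t" for z t
  proof (rule ccontr)
    assume "\<not> ?thesis"
    then have t: "\<bar>t\<bar> \<le> 2" by simp
    then have "- of_real c * cos z \<in> \<real>" using level_real[OF _ t] z(2) unfolding Dz_def by blast
    then obtain x where x: "- of_real c * cos z = of_real x" by (auto elim: Reals_cases)
    then have "poly D x = t" using z(2) by (simp add: Dz_def)
    then have "\<bar>x\<bar> \<le> c" using t large_outside[of x] by (force simp: first_edge last_edge_Suc abs_le_iff)
    have "of_real c * cos z = - (- of_real c * cos z)" by simp
    also have "\<dots> = - of_real x" by (simp only: x)
    finally have "cos z = of_real (- x / c)" using c_pos by (simp add: field_simps)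
    also have "\<dots> = of_real (cos (lift x))" by (simp only: cos_lift[OF \<open>\<bar>x\<bar> \<le> c\<close>])
    also have "\<dots> = cos (of_real (lift x))" by (simp only: cos_of_real)
    finally have "cos z = cos (of_real (lift x))" .
    then have "Im z = 0" unfolding complex_cos_eq by auto
    then show False using z(1) by simp
  qed
  show "0 < al n \<and> al n \<le> be n \<and> be n < pi" if "1 \<le> n" "n < q" for n
    by (rule alpha_beta_bounds[OF that])
  show "be m < al n" if mn: "1 \<le> m" "m < n" "n < q" for m n
  proof -
    have "edges ! (2 * m) < edges ! (2 * m + 1)" using band_nondegenerate mn by simp
    also have "\<dots> \<le> edges ! (2 * n - 1)" using mn by (intro edge_mono) auto
    finally show ?thesis unfolding al_def be_def using lift_mono gap_edges mn by simp
  qed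
  show "cmod (Dz (of_real x)) \<le> 2"
    if x: "0 \<le> x" "x \<le> pi" and no: "\<And>n. 1 \<le> n \<Longrightarrow> n < q \<Longrightarrow> \<not> (al n < x \<and> x < be n)" for x
    unfolding Dz_of_real norm_of_real
  proof (rule outside_gaps)
    have "\<bar>c * cos x\<bar> \<le> c * 1" unfolding abs_mult using c_pos by (intro mult_mono) auto
    then show "edges ! 0 \<le> - c * cos x" "- c * cos x \<le> edges ! (2 * q - 1)"
      by (auto simp: first_edge last_edge_Suc abs_le_iff)
  qed (use no in_gap_iff x in blast)
  show "cmod (Dz (of_real x)) > 2" if n: "1 \<le> n" "n < q" "al n < x" "x < be n" for n x
  proof -
    have "0 \<le> x" "x \<le> pi" using alpha_beta_bounds[OF n(1,2)] n by auto
    then show ?thesis unfolding Dz_of_real norm_of_real using in_gap_iff[OF n(1,2)] n in_gap[OF n(1,2)] by blast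
  qed
  \<comment> \<open>The zeros left of gap n are those of the first n bands, with indices 0 to n -
    1.\<close>
  show "card {j. j < q \<and> psi j < x} = n" if n: "1 \<le> n" "n < q" "al n < x" "x < be n" for n x
  proof -
    have x: "0 \<le> x" "x \<le> pi" using alpha_beta_bounds[OF n(1,2)] n by auto
    then have l: "edges ! (2 * n - 1) < - c * cos x" "- c * cos x < edges ! (2 * n)"
      using in_gap_iff[OF n(1,2)] n by blast+
    have "psi j < x \<longleftrightarrow> j < n" if j: "j < q" for j
    proof -
      have "psi j < x \<longleftrightarrow> bzero j < - c * cos x"
        unfolding psi_def using lift_less[of "bzero j" x] bzero_range[OF j] x by simp
      also have "\<dots> \<longleftrightarrow> j < n"
      proof
        assume "bzero j < - c * cos x"
        then show "j < n" using bzero[OF j] edge_mono[of "2 * n" "2 * j"] l j by fastforce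
      next
        assume "j < n"
        then show "bzero j < - c * cos x" using bzero[OF j] edge_mono[of "2 * j + 1" "2 * n - 1"] l n by fastforce
      qed
      finally show ?thesis .
    qed
    then have "{j. j < q \<and> psi j < x} = {..<n}" using n by auto
    then show ?thesis by simp
  qed
qed

lemma v_gap_value:
  assumes "1 \<le> n" "n < q" "al n < x" "x < be n"
  shows "v (of_real x) = arcosh (\<bar>poly D (- c * cos x)\<bar> / 2) / real q"
  using v_real_gt[of x] gap[OF assms] unfolding Dz_of_real norm_of_real by simp

lemma sum_cos_psi: "(\<Sum>j<q. (cos (psi j))\<^sup>2) = (\<Sum>j<q. (bzero j)\<^sup>2) / c\<^sup>2"
  unfolding psi_def sum_divide_distrib
  by (intro sum.cong refl) (use bzero_range in \<open>simp add: cos_lift less_imp_le power_divide\<close>)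

lemma open_gap_iff: "1 \<le> n \<Longrightarrow> n < q \<Longrightarrow> al n < be n \<longleftrightarrow> edges ! (2 * n - 1) < edges ! (2 * n)"
  unfolding al_def be_def using lift_mono gap_edges by blast

text \<open>arcosh t < ln (2t) reduces the claim to |D|, and the arithmetic-geometric mean
  inequality bounds the q-th root of the product of distances to the zeros by their mean.\<close>

lemma exponent_bound:
  assumes l: "\<bar>l\<bar> \<le> c" and D: "\<bar>poly D l\<bar> > 2"
  shows "arcosh (\<bar>poly D l\<bar> / 2) / real q < ln (root q (lead_coeff D) * (c + \<bar>(\<Sum>j<q. bzero j) / real q\<bar>))"
proof -
  define R where "R = root q (lead_coeff D)"
  have R: "R > 0" "R ^ q = lead_coeff D" using lead q1 by (auto simp: R_def)
  define y where "y j = \<bar>l - bzero j\<bar>" for j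
  define P where "P = (\<Prod>j<q. y j)"
  have pD: "\<bar>poly D l\<bar> = R ^ q * P"
  proof -
    have "poly D l = lead_coeff D * (\<Prod>j<q. l - bzero j)"
      using arg_cong[OF discr_factor, of "\<lambda>p. poly p l"] by (simp add: poly_prod)
    then show ?thesis using R lead by (simp add: abs_mult abs_prod y_def P_def)
  qed
  have y0: "y j \<ge> 0" for j by (simp add: y_def)
  define m where "m = c + \<bar>(\<Sum>j<q. bzero j) / real q\<bar>"
  have m: "m > 0" using c_pos by (simp add: m_def add_pos_nonneg)
  have mean: "(\<Sum>j<q. y j) \<le> real q * m"
  proof -
    \<comment> \<open>The two signs of l - \<mu>, for a zero \<mu>, come from (c - l)(c + \<mu>) >=
      0 and (c + l)(c - \<mu>) >= 0. The bound is linear in \<mu>, so summation brings in the mean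
      of the zeros.\<close>
    have "c * y j \<le> c\<^sup>2 - l * bzero j" if "j < q" for j
    proof -
      have "(c - l) * (c + bzero j) \<ge> 0" "(c + l) * (c - bzero j) \<ge> 0"
        using l bzero_range[OF that] by (auto simp: abs_le_iff abs_less_iff intro!: mult_nonneg_nonneg)
      then show ?thesis by (auto simp: y_def abs_if power2_eq_square algebra_simps)
    qed
    then have "(\<Sum>j<q. c * y j) \<le> (\<Sum>j<q. c\<^sup>2 - l * bzero j)" by (intro sum_mono) auto
    then have "c * (\<Sum>j<q. y j) \<le> real q * c\<^sup>2 - l * (\<Sum>j<q. bzero j)"
      by (simp add: sum_subtractf sum_distrib_left)
    also have "\<dots> \<le> real q * c\<^sup>2 + c * \<bar>\<Sum>j<q. bzero j\<bar>"
    proof -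
      have "- (l * (\<Sum>j<q. bzero j)) \<le> \<bar>l\<bar> * \<bar>\<Sum>j<q. bzero j\<bar>" by (metis abs_ge_minus_self abs_mult)
      also have "\<dots> \<le> c * \<bar>\<Sum>j<q. bzero j\<bar>" using l by (intro mult_right_mono) auto
      finally show ?thesis by simp
    qed
    also have "\<dots> = c * (real q * m)"
      using q_pos by (simp add: m_def abs_divide power2_eq_square field_simps)
    finally show ?thesis using c_pos by simp
  qed
  have "P powr (1 / real q) \<le> (\<Sum>j<q. y j) / real q"
    using arith_geom_mean[of "{..<q}" y] y0 q1 by (auto simp: lessThan_empty_iff sum_divide_distrib P_def)
  also have "\<dots> \<le> m" using mean q_pos by (simp add: divide_le_eq mult.commute)
  finally have "P powr (1 / real q) \<le> m" .
  moreover have p0: "P > 0"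
  proof -
    have "P \<ge> 0" using y0 by (simp add: prod_nonneg P_def)
    moreover have "P \<noteq> 0" using D unfolding pD by (metis mult_zero_right not_numeral_less_zero)
    ultimately show ?thesis by linarith
  qed
  ultimately have "ln (P powr (1 / real q)) \<le> ln m" using m by (subst ln_le_cancel_iff) auto
  then have ln1: "ln P / real q \<le> ln m" using p0 by (simp add: ln_powr)
  have "arcosh (\<bar>poly D l\<bar> / 2) < ln \<bar>poly D l\<bar>"
  proof -
    define t where "t = \<bar>poly D l\<bar> / 2"
    have t: "t > 1" using D by (simp add: t_def)
    have "sqrt (t\<^sup>2 - 1) < t" using t by (intro real_less_lsqrt) auto
    moreover have "t + sqrt (t\<^sup>2 - 1) > 0" using t by (intro add_pos_nonneg) auto
    ultimately have "ln (t + sqrt (t\<^sup>2 - 1)) < ln (2 * t)" using t by (intro ln_less_cancel_iff[THEN iffD2]) linarith+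
    then show ?thesis using t by (simp add: arcosh_real_def t_def)
  qed
  also have "ln \<bar>poly D l\<bar> = real q * ln R + ln P"
    unfolding pD using R(1) p0 by (simp add: ln_mult_pos ln_realpow)
  finally have "arcosh (\<bar>poly D l\<bar> / 2) / real q < ln R + ln P / real q"
    using q_pos by (simp add: field_simps)
  also have "\<dots> \<le> ln R + ln m" using ln1 by simp
  also have "\<dots> = ln (R * m)" using R m by (simp add: ln_mult_pos)
  finally show ?thesis by (simp add: R_def m_def)
qed

definition hplus :: real where
  "hplus = (SUP l \<in> (\<Union>n\<in>{1..q-1}. {edges ! (2 * n - 1) <..< edges ! (2 * n)}). arcosh (\<bar>poly D l\<bar> / 2) / real q)"

text \<open>The strict bound survives the supremum because v attains its maximum over [0, pi], and
  does so at a point inside a gap.\<close>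

lemma hplus:
  assumes n0: "1 \<le> n0" "n0 < q" "al n0 < be n0"
  shows "\<And>n x. 1 \<le> n \<Longrightarrow> n < q \<Longrightarrow> al n < x \<Longrightarrow> x < be n \<Longrightarrow> v (of_real x) \<le> hplus"
    and "hplus < ln (root q (lead_coeff D) * (c + \<bar>(\<Sum>j<q. bzero j) / real q\<bar>))"
proof -
  let ?G = "\<Union>n\<in>{1..q-1}. {edges ! (2 * n - 1) <..< edges ! (2 * n)}"
  let ?u = "\<lambda>l. arcosh (\<bar>poly D l\<bar> / 2) / real q"
  have lam: "\<exists>x. 0 \<le> x \<and> x \<le> pi \<and> l = - c * cos x \<and> v (of_real x) = ?u l \<and> \<bar>l\<bar> \<le> c \<and> \<bar>poly D l\<bar> > 2" if lG: "l \<in> ?G" for l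
  proof -
    obtain n where n: "1 \<le> n" "n < q" "edges ! (2 * n - 1) < l" "l < edges ! (2 * n)"
      using lG gap_index by auto
    have l: "\<bar>l\<bar> \<le> c" using gap_edges[OF n(1,2)] n by (simp add: abs_le_iff)
    have x: "0 \<le> lift l" "lift l \<le> pi" "l = - c * cos (lift l)"
      using lift_bounds[OF l] cos_lift[OF l] c_pos by auto
    have "al n < lift l" "lift l < be n" using in_gap_iff[OF n(1,2) x(1,2)] n x(3) by auto
    then have "v (of_real (lift l)) = ?u l" using v_gap_value[OF n(1,2)] x(3) by simp
    then show ?thesis using x l in_gap[OF n] by blast
  qed
  have "\<exists>y. y \<in> {0..pi} \<and> (\<forall>x\<in>{0..pi}. v (of_real x) \<le> v (of_real y))"
    using continuous_attains_sup[OF compact_Icc _ continuous_on_v_real, of 0 pi] by auto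
  then obtain y where y: "y \<in> {0..pi}" "\<And>x. x \<in> {0..pi} \<Longrightarrow> v (of_real x) \<le> v (of_real y)" by blast
  have le: "?u l \<le> v (of_real y)" if "l \<in> ?G" for l using lam[OF that] y(2) by fastforce
  then have bdd: "bdd_above (?u ` ?G)" by (intro bdd_aboveI2) auto
  have n0G: "n0 \<in> {1..q-1}" using n0 gap_index by simp
  obtain l0 where "edges ! (2 * n0 - 1) < l0" "l0 < edges ! (2 * n0)"
    using dense open_gap_iff[OF n0(1,2)] n0(3) by blast
  then have ne: "?G \<noteq> {}" using n0G by fastforce
  show up: "v (of_real x) \<le> hplus" if n: "1 \<le> n" "n < q" "al n < x" "x < be n" for n x
  proof -
    have x: "0 \<le> x" "x \<le> pi" using alpha_beta_bounds[OF n(1,2)] n by auto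
    have "- c * cos x \<in> {edges ! (2 * n - 1) <..< edges ! (2 * n)}"
      unfolding greaterThanLessThan_iff using in_gap_iff[OF n(1,2) x] n(3,4) by blast
    moreover have "n \<in> {1..q-1}" using n gap_index by simp
    ultimately have "- c * cos x \<in> ?G" by (rule UN_I[rotated])
    then have "?u (- c * cos x) \<le> hplus" unfolding hplus_def using bdd by (rule cSUP_upper)
    then show ?thesis using v_gap_value[OF n] by simp
  qed
  have "0 < v (of_real ((al n0 + be n0) / 2))" by (rule v_gap_pos[OF n0(1,2)]) (use n0 in auto)
  also have "\<dots> \<le> v (of_real y)"
    by (rule y(2)) (use alpha_beta_bounds[OF n0(1,2)] in auto)
  finally have vy: "v (of_real y) > 0" .
  then obtain n where n: "1 \<le> n" "n < q" "al n < y" "y < be n" using v_band[of y] y(1) by fastforce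
  have "\<bar>c * cos y\<bar> \<le> c * 1" unfolding abs_mult using c_pos by (intro mult_mono) auto
  moreover have "\<bar>poly D (- c * cos y)\<bar> > 2" using gap[OF n] unfolding Dz_of_real norm_of_real .
  ultimately have b: "v (of_real y) < ln (root q (lead_coeff D) * (c + \<bar>(\<Sum>j<q. bzero j) / real q\<bar>))"
    using exponent_bound[of "- c * cos y"] v_gap_value[OF n] by simp
  have "hplus \<le> v (of_real y)" unfolding hplus_def using ne le by (rule cSUP_least)
  then show "hplus < ln (root q (lead_coeff D) * (c + \<bar>(\<Sum>j<q. bzero j) / real q\<bar>))" using b by simp
qed

lemma mean_zero_less: "\<bar>(\<Sum>j<q. bzero j) / real q\<bar> < c"
proof -
  have "\<bar>\<Sum>j<q. bzero j\<bar> \<le> (\<Sum>j<q. \<bar>bzero j\<bar>)" by (rule sum_abs)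
  also have "\<dots> < (\<Sum>j<q. c)" using bzero_range q1 by (intro sum_strict_mono) (auto simp: lessThan_empty_iff)
  finally show ?thesis using q_pos by (simp add: abs_divide divide_less_eq mult.commute)
qed

text \<open>With nothing to integrate over, both gap identities become equations: ln K = 0, and the
  squares of cos at the lifted zeros add up to q / 2.\<close>

lemma closed_gaps:
  assumes "\<And>n. 1 \<le> n \<Longrightarrow> n < q \<Longrightarrow> \<not> al n < be n"
  shows "K = 1" "(\<Sum>j<q. (bzero j)\<^sup>2) = real q * c\<^sup>2 / 2"
proof -
  have z: "integral {al n..be n} f = 0" if "n \<in> {1..q - 1}" for n and f :: "real \<Rightarrow> real"
  proof -
    have "1 \<le> n" "n < q" using that gap_index by blast+
    then have "al n = be n" using assms[of n] alpha_beta_bounds[of n] by auto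
    then show ?thesis by simp
  qed
  have "pi * ln K = 0" unfolding v_gap_sum using z by (intro sum.neutral) blast
  then show "K = 1" using K_pos by simp
  have "pi * (ln K / 2 + 1 / 4 - (\<Sum>j<q. (cos (psi j))\<^sup>2) / (2 * real q)) = 0"
    unfolding v_cos_gap_sum using z by (intro sum.neutral) blast
  then show "(\<Sum>j<q. (bzero j)\<^sup>2) = real q * c\<^sup>2 / 2"
    using \<open>K = 1\<close> q_pos c_pos by (simp add: sum_cos_psi field_simps)
qed

end

text \<open>The equality case of the arithmetic-geometric mean inequality: the nonnegative terms x -
  1 - ln x add up to at most 0, and such a term vanishes only at x = 1.\<close>

lemma geometric_quadratic_equality:
  fixes x :: "'i \<Rightarrow> real"
  assumes fin: "finite I" and pos: "\<And>i. i \<in> I \<Longrightarrow> x i > 0"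
    and prod: "(\<Prod>i\<in>I. x i) = 1" and sum: "(\<Sum>i\<in>I. x i) \<le> real (card I)" and i: "i \<in> I"
  shows "x i = 1"
proof -
  have ln: "(\<Sum>i\<in>I. ln (x i)) = 0" using ln_prod[OF fin, of x] pos prod by force
  have nn: "x i - 1 - ln (x i) \<ge> 0" if "i \<in> I" for i
    using ln_le_minus_one[OF pos[OF that]] by simp
  have "(\<Sum>i\<in>I. x i - 1 - ln (x i)) \<le> 0" using sum ln by (simp add: sum_subtractf)
  then have "(\<Sum>i\<in>I. x i - 1 - ln (x i)) = 0" using nn by (intro antisym sum_nonneg) auto
  then have "x i - 1 - ln (x i) = 0" using sum_nonneg_eq_0_iff[OF fin, of "\<lambda>i. x i - 1 - ln (x i)"] nn i by blast
  then show ?thesis using ln_eq_minus_one[OF pos[OF i]] by simp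
qed

lemma periodic_int_shift:
  fixes f :: "int \<Rightarrow> 'a"
  assumes "\<forall>n. f (n + int q) = f n"
  shows "f (n + k * int q) = f n"
proof (induction k rule: int_induct[where k = 0])
  case (step1 i)
  then show ?case using assms[rule_format, of "n + i * int q"] by (simp add: algebra_simps)
next
  case (step2 i)
  then show ?case using assms[rule_format, of "n + (i - 1) * int q"] by (simp add: algebra_simps)
qed simp

lemma periodic_constant:
  fixes f :: "int \<Rightarrow> 'a"
  assumes q: "q \<ge> 1" and per: "\<forall>n. f (n + int q) = f n" and const: "\<And>j. j \<in> {1..q} \<Longrightarrow> f (int j) = C"
  shows "f n = C"
proof -
  define j where "j = nat ((n - 1) mod int q) + 1"
  have "(n - 1) mod int q < int q" "0 \<le> (n - 1) mod int q" using q by auto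
  then have j: "j \<in> {1..q}" "int j = (n - 1) mod int q + 1" by (auto simp: j_def)
  have "n = int j + ((n - 1) div int q) * int q"
    using j(2) div_mult_mod_eq[of "n - 1" "int q"] by linarith
  then show ?thesis using periodic_int_shift[OF per, of "int j" "(n - 1) div int q"] const[OF j(1)] by simp
qed

theorem theorem2:
  fixes a b :: "int \<Rightarrow> real" and q :: nat
  assumes q2: "q \<ge> 2"
    and apos: "\<forall>n. a n > 0"
    and aper: "\<forall>n. a (n + int q) = a n"
    and bper: "\<forall>n. b (n + int q) = b n"
    and minper: "\<not> (\<exists>p::nat. 1 \<le> p \<and> p < q \<and> (\<forall>n. a (n + int p) = a n \<and> b (n + int p) = b n))"
    and norm: "normalised a b q"
  defines "c \<equiv> half_width a b q"
    and "A \<equiv> geomA a q"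
    and "hp \<equiv> h_plus a b q"
  shows "(\<exists>n\<in>{1..q-1}. lam_minus a b q n < lam_plus a b q n)
    \<and> (\<Sum>n = 1..q-1. glen a b q n) > pi * ln (c / (2 * A)) / hp
    \<and> pi * ln (c / (2 * A)) / hp > pi * ln (c / (2 * A)) / ln (2 * c / A)
    \<and> (\<Sum>n = 1..q-1. integral (gset a b q n) (\<lambda>x. (cos x)\<^sup>2))
        > pi / hp * (ln (c / (2 * A)) / 2 + 1 / 4 - Re (trace_L2 a b q) / (2 * real q * c\<^sup>2))
    \<and> ln (c / (2 * A)) / max 1 (real q * hp / pi) < (\<Sum>n = 1..q-1. (glen a b q n)\<^sup>2)
    \<and> (\<Sum>n = 1..q-1. (glen a b q n)\<^sup>2) < 8 * ln (c / (2 * A))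
    \<and> 0 < hp
    \<and> hp < ln (c / A + \<bar>(1 / (A * real q)) * (\<Sum>j = 1..q. b (int j))\<bar>)
    \<and> ln (c / A + \<bar>(1 / (A * real q)) * (\<Sum>j = 1..q. b (int j))\<bar>) < ln (2 * c / A)"
proof -
  define D where "D = discr a b q"
  define Pq where "Pq = (\<Prod>j = 1..q. a (int j))"
  have aq: "a (int q) = a 0" using aper[rule_format, of 0] by simp
  have Pq: "Pq > 0" unfolding Pq_def using apos by (intro prod_pos) auto
  note co = coeff_discr[OF apos q2 aq, of b, folded D_def Pq_def]
  have lead: "lead_coeff D = 1 / Pq" using co(2) Pq by (simp add: field_simps)
  interpret bp: band_poly D q
  proof
    show "q \<ge> 1" using q2 by simp
    show "degree D = q" by (rule co(1))
    show "lead_coeff D > 0" using lead Pq by simp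
    show "l \<in> \<real>" if "cpoly D l = of_real t" "\<bar>t\<bar> \<le> 2" for l t
      using discr_band_real[of q a b l t] q2 apos aq that by (simp add: D_def)
  qed
  have be: "band_edges a b q = bp.edges" unfolding band_edges_def D_def[symmetric] by (rule bp.band_edges_unique)
  have c_def': "c = (bp.edges ! (2 * q - 1) - bp.edges ! 0) / 2"
    by (simp add: c_def half_width_def lam_minus_def lam_plus_def be)
  have e0: "bp.edges ! 0 = - bp.edges ! (2 * q - 1)"
    using norm by (simp add: normalised_def lam_minus_def lam_plus_def be)
  interpret sp: symmetric_band_poly D q c
    by unfold_locales (use q2 c_def' e0 in auto)
  have A: "A > 0" "root q (lead_coeff D) = 1 / A"
    using Pq q2 unfolding lead A_def geomA_def Pq_def[symmetric] by (auto simp: real_root_divide)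
  have Aq: "A ^ q = Pq" unfolding A_def geomA_def Pq_def[symmetric] using Pq q2 by simp
  have K: "sp.K = c / (2 * A)" by (simp add: sp.K_def A(2))
  obtain m where m: "q = Suc (Suc m)" using q2 by (metis add_2_eq_Suc le_Suc_ex)
  have cD: "coeff D k = lead_coeff D * coeff (\<Prod>i<q. [:- bp.bzero i, 1:]) k" for k
    using arg_cong[OF bp.discr_factor, of "\<lambda>p. coeff p k"] by simp
  have lP: "lead_coeff D * Pq = 1" using lead Pq by simp
  have sumb: "(\<Sum>j<q. bp.bzero j) = (\<Sum>j = 1..q. b (int j))"
  proof -
    have "coeff D (q - 1) * Pq = (lead_coeff D * Pq) * coeff (\<Prod>i<q. [:- bp.bzero i, 1:]) (q - 1)"
      unfolding cD[of "q - 1"] by simp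
    then show ?thesis using co(3) coeff_prod_linear(3)[of bp.bzero "Suc m"] unfolding lP by (simp add: m)
  qed
  \<comment> \<open>In comparing third coefficients the squares of the sums cancel, which leaves the
    power sum of the zeros.\<close>
  have sumsq: "(\<Sum>j<q. (bp.bzero j)\<^sup>2) = Re (trace_L2 a b q)"
  proof -
    have "coeff D (q - 2) * Pq = (lead_coeff D * Pq) * coeff (\<Prod>i<q. [:- bp.bzero i, 1:]) (q - 2)"
      unfolding cD[of "q - 2"] by simp
    also have "\<dots> = ((\<Sum>j<q. bp.bzero j)\<^sup>2 - (\<Sum>j<q. (bp.bzero j)\<^sup>2)) / 2"
      unfolding lP using coeff_prod_linear(4)[of bp.bzero m] by (simp add: m)
    finally have "((\<Sum>j = 1..q. b (int j))\<^sup>2 - (\<Sum>j<q. (bp.bzero j)\<^sup>2)) / 2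
        = ((\<Sum>j = 1..q. b (int j))\<^sup>2 - (\<Sum>j = 1..q. (b (int j))\<^sup>2)) / 2 - (\<Sum>j = 1..q. (a (int j))\<^sup>2)"
      unfolding co(4) sumb by simp
    moreover have "z = y + 2 * w" if "(u - z) / 2 = (u - y) / 2 - w" for u y z w :: real
      using that by (simp add: field_simps)
    ultimately show ?thesis unfolding Re_trace_L2[OF q2] by blast
  qed
  have lm: "lam_minus a b q n = bp.edges ! (2 * n - 1)" and lp: "lam_plus a b q n = bp.edges ! (2 * n)" for n
    by (simp_all add: lam_minus_def lam_plus_def be)
  \<comment> \<open>Without open gaps every a_n would equal A and every b_n would vanish, so the
    operator would have period 1 < q.\<close>
  have "\<exists>n. 1 \<le> n \<and> n < q \<and> sp.al n < sp.be n"
  proof (rule ccontr)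
    assume "\<not> ?thesis"
    then have cl: "\<And>n. 1 \<le> n \<Longrightarrow> n < q \<Longrightarrow> \<not> sp.al n < sp.be n" by blast
    have "c = 2 * A" using sp.closed_gaps(1)[OF cl] A(1) by (simp add: K)
    then have tr: "(\<Sum>j = 1..q. (b (int j))\<^sup>2) + 2 * (\<Sum>j = 1..q. (a (int j))\<^sup>2) = 2 * (real q * A\<^sup>2)"
      using sp.closed_gaps(2)[OF cl] unfolding sumsq Re_trace_L2[OF q2] by simp
    \<comment> \<open>Dropping the b_j leaves the mean of the a_j^2 at most A^2, which is their
      geometric mean.\<close>
    then have le: "(\<Sum>j = 1..q. (a (int j))\<^sup>2) \<le> real q * A\<^sup>2"
      using sum_nonneg[of "{1..q}" "\<lambda>j. (b (int j))\<^sup>2"] by simp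
    have aA: "a (int j) = A" if "j \<in> {1..q}" for j
    proof -
      have "(a (int j))\<^sup>2 / A\<^sup>2 = 1"
      proof (rule geometric_quadratic_equality[of "{1..q}" "\<lambda>j. (a (int j))\<^sup>2 / A\<^sup>2"])
        show "(a (int i))\<^sup>2 / A\<^sup>2 > 0" for i using apos[rule_format, of "int i"] A(1) by simp
        have "(\<Prod>i = 1..q. (a (int i))\<^sup>2) = (A ^ q)\<^sup>2"
          unfolding Aq Pq_def by (rule prod_power_distrib[symmetric])
        then show "(\<Prod>i = 1..q. (a (int i))\<^sup>2 / A\<^sup>2) = 1"
          using A(1) by (simp add: prod_dividef power_mult[symmetric] mult.commute)
        show "(\<Sum>i = 1..q. (a (int i))\<^sup>2 / A\<^sup>2) \<le> real (card {1..q})"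
          using le A(1) by (simp add: sum_divide_distrib[symmetric] divide_le_eq)
      qed (use that in auto)
      then have "(a (int j))\<^sup>2 = A\<^sup>2" using A(1) by (simp add: divide_eq_1_iff)
      then show ?thesis using apos[rule_format, of "int j"] A(1) by (simp add: power2_eq_iff_nonneg less_imp_le)
    qed
    then have "(\<Sum>j = 1..q. (b (int j))\<^sup>2) = 0" using tr by simp
    then have b0: "b (int j) = 0" if "j \<in> {1..q}" for j using that by (simp add: sum_nonneg_eq_0_iff)
    have "a n = A" "b n = 0" for n
      using periodic_constant[OF _ aper, of A n] periodic_constant[OF _ bper, of 0 n] aA b0 q2 by auto
    then show False using minper q2 by (metis One_nat_def Suc_1 Suc_le_lessD order_refl)
  qed
  then obtain n0 where n0: "1 \<le> n0" "n0 < q" "sp.al n0 < sp.be n0" by blast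
  have hp: "hp = sp.hplus"
    unfolding hp_def h_plus_def gap_def lm lp sp.hplus_def D_def[symmetric] ..
  note H = sp.hplus(1)[OF n0, folded hp]
  have abs1: "root q (lead_coeff D) * (c + \<bar>(\<Sum>j<q. bp.bzero j) / real q\<bar>)
      = c / A + \<bar>(1 / (A * real q)) * (\<Sum>j = 1..q. b (int j))\<bar>"
    using A(1) unfolding A(2) sumb by (simp add: abs_mult abs_divide field_simps)
  have hp1: "hp < ln (c / A + \<bar>(1 / (A * real q)) * (\<Sum>j = 1..q. b (int j))\<bar>)"
    using sp.hplus(2)[OF n0, folded hp] unfolding abs1 .
  have lnlt: "ln (c / A + \<bar>(1 / (A * real q)) * (\<Sum>j = 1..q. b (int j))\<bar>) < ln (2 * c / A)"
  proof -
    have "1 / A * (c + \<bar>(\<Sum>j<q. bp.bzero j) / real q\<bar>) < 1 / A * (2 * c)"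
      using sp.mean_zero_less A(1) by (intro mult_strict_left_mono) auto
    moreover have "0 < 1 / A * (c + \<bar>(\<Sum>j<q. bp.bzero j) / real q\<bar>)"
      using sp.c_pos A(1) by (intro mult_pos_pos add_pos_nonneg) auto
    ultimately show ?thesis
      unfolding abs1[symmetric] A(2) by (subst ln_less_cancel_iff) (auto simp: mult.commute)
  qed
  have hpos: "hp > 0" by (rule sp.hp_pos[OF n0 H])
  have Kpos: "ln (c / (2 * A)) > 0" using sp.lnK_pos[OF n0] by (simp add: K)
  have gl: "glen a b q n = sp.be n - sp.al n" if "n \<in> {1..q - 1}" for n
  proof -
    have n: "1 \<le> n" "n < q" using that q2 by auto
    have "-1 \<le> bp.edges ! i / c \<and> bp.edges ! i / c \<le> 1" if "\<bar>bp.edges ! i\<bar> \<le> c" for i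
      using that sp.c_pos by (auto simp: field_simps abs_le_iff)
    then show ?thesis
      using sp.gap_edges(4,5)[OF n] arccos_minus[of "bp.edges ! (2 * n - 1) / c"] arccos_minus[of "bp.edges ! (2 * n) / c"]
      by (simp add: glen_def c_def[symmetric] lm lp sp.al_def sp.be_def sp.lift_def)
  qed
  have gs: "gset a b q n = {sp.al n<..<sp.be n}" for n
    by (simp add: gset_def c_def[symmetric] lm lp sp.al_def sp.be_def sp.lift_def)
  have len: "pi * ln (c / (2 * A)) / hp < (\<Sum>n = 1..q-1. glen a b q n)"
  proof -
    have "(\<Sum>n = 1..q-1. glen a b q n) = (\<Sum>n = 1..q-1. sp.be n - sp.al n)" by (intro sum.cong refl gl)
    then show ?thesis using sp.gap_length_lower[OF n0 H] hpos by (simp add: K divide_less_eq mult.commute)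
  qed
  have len2: "pi * ln (c / (2 * A)) / ln (2 * c / A) < pi * ln (c / (2 * A)) / hp"
    using hp1 lnlt hpos Kpos by (intro divide_strict_left_mono) auto
  have cs: "pi / hp * (ln (c / (2 * A)) / 2 + 1 / 4 - Re (trace_L2 a b q) / (2 * real q * c\<^sup>2))
      < (\<Sum>n = 1..q-1. integral (gset a b q n) (\<lambda>x. (cos x)\<^sup>2))"
  proof -
    have "(\<Sum>n = 1..q-1. integral (gset a b q n) (\<lambda>x. (cos x)\<^sup>2)) = (\<Sum>n = 1..q-1. integral {sp.al n..sp.be n} (\<lambda>x. (cos x)\<^sup>2))"
      unfolding gs integral_open_interval_real ..
    moreover have "(\<Sum>j<q. (cos (sp.psi j))\<^sup>2) / (2 * real q) = Re (trace_L2 a b q) / (2 * real q * c\<^sup>2)"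
      unfolding sp.sum_cos_psi sumsq by simp
    ultimately show ?thesis using sp.gap_cos_lower[OF n0 H] hpos
      by (simp add: K pos_divide_less_eq mult.commute)
  qed
  have sq: "(\<Sum>n = 1..q-1. (glen a b q n)\<^sup>2) = (\<Sum>n = 1..q-1. (sp.be n - sp.al n)\<^sup>2)"
    by (intro sum.cong refl) (simp add: gl)
  have sq1: "ln (c / (2 * A)) / max 1 (real q * hp / pi) < (\<Sum>n = 1..q-1. (glen a b q n)\<^sup>2)"
  proof -
    have "max 1 (real q * hp / pi) > 0" by (simp add: less_max_iff_disj)
    then show ?thesis using sp.gap_squares_lower[OF n0 H] unfolding sq K by (simp add: pos_divide_less_eq mult.commute)
  qed
  have sq2: "(\<Sum>n = 1..q-1. (glen a b q n)\<^sup>2) < 8 * ln (c / (2 * A))"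
    using sp.gap_length_squares[OF n0] unfolding sq K .
  have "\<exists>n\<in>{1..q-1}. lam_minus a b q n < lam_plus a b q n"
    using n0 sp.open_gap_iff[OF n0(1,2)] by (intro bexI[of _ n0]) (auto simp: lm lp)
  then show ?thesis using len len2 cs sq1 sq2 hpos hp1 lnlt by blast
qed

end
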